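(* Let $\Omega\subset\mathbb{R}^n$ be bounded and open and $m\le n$. Assume: (1) $K:\overline\Omega\times\mathbb{R}\times\mathbb{R}^n\times S^n\to\mathbb{R}$ is continuous and $K(x,r,p,X)\le K(x,s,p,Y)$ for all $x\in\overline\Omega$, $p\in\mathbb{R}^n$, $r\le s$, $Y\le X$; (2) for some modulus $\omega$, $$K\Big(y,r,\frac{x-y}{\epsilon},Y\Big)-K\Big(x,r,\frac{x-y}{\epsilon},X\Big)\le\omega\Big(|x-y|\Big(1+\frac{|x-y|}{\epsilon}\Big)\Big)$$ for all $\epsilon>0$, $x,y\in\overline\Omega$, $r\in\mathbb{R}$ and $X,Y\in S^n$ satisfying $$-\frac3\epsilon\begin{pmatrix}I&0\\0&I\end{pmatrix}\le\begin{pmatrix}X&0\\0&-Y\end{pmatrix}\le\frac3\epsilon\begin{pmatrix}I&-I\\-I&I\end{pmatrix};$$ (3) $\sigma$ is a Lipschitz continuous $n\times m$ matrix-valued function on $\overline\Omega$; (4) $A:\overline\Omega\times\mathbb{R}^n\to S^m$ is continuous and for some constant $C_1$, $-C_1|x-y|(1+|p|)I\le A(x,p)-A(y,p)\le C_1|x-y|(1+|p|)I$ for all $x,y\in\overline\Omega$, $p\in\mathbb{R}^n$. Let $u\in USC(\overline\Omega)$ be bounded and, for some $\gamma,\gamma_1>0$, a viscosity subsolution of both $$-\sigma^T(x)D^2u\,\sigma(x)-A(x,Du)\le-\gamma I\quad\text{in }\Omega$$ and $$-\log\det\big(\sigma^T(x)D^2u\,\sigma(x)+A(x,Du)\big)+K(x,u,Du,D^2u)\le-\gamma_1\quad\text{in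 }\Omega.$$ Let $v\in LSC(\overline\Omega)$ be a bounded viscosity supersolution of $$-\log\det\big(\sigma^T(x)D^2v\,\sigma(x)+A(x,Dv)\big)+K(x,v,Dv,D^2v)=0\quad\text{in }\Omega.$$ Then $\sup_\Omega(u-v)\le\max_{\partial\Omega}(u-v)^+$.
   Context: $S^k$ is the set of symmetric $k\times k$ matrices with the usual partial order; $s^+=\max\{s,0\}$. A modulus is a nondecreasing function $\omega:[0,\infty)\to[0,\infty)$ with $\omega(s)\to\omega(0)=0$ as $s\to0^+$. For $\Psi:\overline\Omega\times\mathbb{R}^n\times S^n\to S^m$ and $N\in S^m$, $u$ is a viscosity subsolution of the matrix inequality $\Psi(x,Du,D^2u)\le N$ in $\Omega$ if $u$ is USC and $\Psi(x,D\varphi(x),D^2\varphi(x))\le N$ for all $\varphi\in C^2(\Omega)$ and all maximum points $x\in\Omega$ of $u-\varphi$. A function $u\in USC(\overline\Omega)$ is a viscosity subsolution of the scalar inequality with right-hand side $-\gamma_1$ if for all $\varphi\in C^2(\overline\Omega)$ and all maximum points $x_0\in\Omega$ of $u-\varphi$, $-\log\det(\sigma^T(x_0)D^2\varphi(x_0)\sigma(x_0)+A(x_0,D\varphi(x_0)))+K(x_0,u(x_0),D\varphi(x_0),D^2\varphi(x_0))\le-\gamma_1$ (the argument of $\log\det$ is positive definite because of the matrix inequality satisfied by $u$). A function $v\in LSC(\overline\Omega)$ is a viscosity supersolution of the equation if for all $\varphi\in C^2(\overline\Omega)$ and all minimum points $x_0\in\Omega$ of $v-\varphi$ such that $\sigma^T(x_0)D^2\varphi(x_0)\sigma(x_0)+A(x_0,D\varphi(x_0))$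 is positive definite, $-\log\det(\sigma^T(x_0)D^2\varphi(x_0)\sigma(x_0)+A(x_0,D\varphi(x_0)))+K(x_0,v(x_0),D\varphi(x_0),D^2\varphi(x_0))\ge0$. *)

theory Defs
  imports "HOL-Analysis.Analysis"
begin

section \<open>Symmetric matrices and their partial order\<close>

definition sym_mats :: "(real ^ 'k ^ 'k) set" where
  "sym_mats = {A. transpose A = A}"

definition loewner_le :: "real ^ 'k ^ 'k \<Rightarrow> real ^ 'k ^ 'k \<Rightarrow> bool"  (infix "\<preceq>" 50) where
  "A \<preceq> B \<longleftrightarrow>
     A \<in> sym_mats \<and> B \<in> sym_mats \<and> (\<forall>\<xi>. \<xi> \<bullet> (A *v \<xi>) \<le> \<xi> \<bullet> (B *v \<xi>))"

definition pos_definite :: "real ^ 'k ^ 'k \<Rightarrow> bool" where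
  "pos_definite A \<longleftrightarrow> A \<in> sym_mats \<and> (\<forall>\<xi>. \<xi> \<noteq> 0 \<longrightarrow> 0 < \<xi> \<bullet> (A *v \<xi>))"

text \<open>The matrix with block rows \<open>(A B)\<close> and \<open>(C D)\<close>.\<close>

definition block_mat ::
  "real ^ 'n ^ 'n \<Rightarrow> real ^ 'n ^ 'n \<Rightarrow> real ^ 'n ^ 'n \<Rightarrow> real ^ 'n ^ 'n \<Rightarrow>
    real ^ ('n + 'n) ^ ('n + 'n)" where
  "block_mat A B C D =
    (\<chi> i j. case (i, j) of
       (Inl a, Inl b) \<Rightarrow> A $ a $ b
     | (Inl a, Inr b) \<Rightarrow> B $ a $ b
     | (Inr a, Inl b) \<Rightarrow> C $ a $ b
     | (Inr a, Inr b) \<Rightarrow> D $ a $ b)"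


section \<open>Moduli and semicontinuity\<close>

definition modulus :: "(real \<Rightarrow> real) \<Rightarrow> bool" where
  "modulus \<omega> \<longleftrightarrow>
     mono_on {0..} \<omega> \<and> (\<forall>s\<ge>0. 0 \<le> \<omega> s) \<and> \<omega> 0 = 0 \<and> (\<omega> \<longlongrightarrow> 0) (at_right 0)"

definition usc_on :: "'a::topological_space set \<Rightarrow> ('a \<Rightarrow> real) \<Rightarrow> bool" where
  "usc_on S f \<longleftrightarrow> (\<forall>x\<in>S. \<forall>c>f x. \<forall>\<^sub>F y in at x within S. f y < c)"

definition lsc_on :: "'a::topological_space set \<Rightarrow> ('a \<Rightarrow> real) \<Rightarrow> bool" where
  "lsc_on S f \<longleftrightarrow> (\<forall>x\<in>S. \<forall>c<f x. \<forall>\<^sub>F y in at x within S. c < f y)"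


section \<open>Functions of class C2\<close>

text \<open>Both operators are meaningful only where the derivative in question exists;
  \<open>C2_on\<close> guarantees this at every point of the open set.\<close>

definition grad :: "(real ^ 'n \<Rightarrow> real) \<Rightarrow> real ^ 'n \<Rightarrow> real ^ 'n" where
  "grad \<phi> x = (THE D. GDERIV \<phi> x :> D)"

definition hess :: "(real ^ 'n \<Rightarrow> real) \<Rightarrow> real ^ 'n \<Rightarrow> real ^ 'n ^ 'n" where
  "hess \<phi> x = jacobian (grad \<phi>) (at x)"

lemma grad_eqI:
  assumes "GDERIV \<phi> x :> D"
  shows "grad \<phi> x = D"
  unfolding grad_def
proof (rule the_equality)
  show "GDERIV \<phi> x :> D" by (rule assms)
next
  fix E assume "GDERIV \<phi> x :> E"
  then have "(\<lambda>h. h \<bullet> E) = (\<lambda>h. h \<bullet> D)"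
    using assms unfolding gderiv_def by (rule has_derivative_unique)
  then have "h \<bullet> E = h \<bullet> D" for h
    by meson
  then show "E = D"
    using vector_eq_ldot by blast
qed

definition C2_on :: "(real ^ 'n) set \<Rightarrow> (real ^ 'n \<Rightarrow> real) \<Rightarrow> bool" where
  "C2_on \<Omega> \<phi> \<longleftrightarrow>
     (\<forall>x\<in>\<Omega>. \<phi> differentiable (at x)) \<and>
     (\<forall>x\<in>\<Omega>. grad \<phi> differentiable (at x)) \<and>
     continuous_on \<Omega> (hess \<phi>)"

text \<open>Class C2 up to the boundary: C2 in the open set \<open>\<Omega>\<close>, and the function and its derivatives
  up to order two extend continuously to the closure.\<close>

definition C2_closure :: "(real ^ 'n) set \<Rightarrow> (real ^ 'n \<Rightarrow> real) \<Rightarrow> bool" where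
  "C2_closure \<Omega> \<phi> \<longleftrightarrow>
     C2_on \<Omega> \<phi> \<and>
     continuous_on (closure \<Omega>) \<phi> \<and>
     (\<exists>G. continuous_on (closure \<Omega>) G \<and> (\<forall>x\<in>\<Omega>. G x = grad \<phi> x)) \<and>
     (\<exists>H. continuous_on (closure \<Omega>) H \<and> (\<forall>x\<in>\<Omega>. H x = hess \<phi> x))"


section \<open>Viscosity sub- and supersolutions\<close>

definition visc_subsol_matrix ::
  "(real ^ 'n) set \<Rightarrow> (real ^ 'n \<Rightarrow> real ^ 'n \<Rightarrow> real ^ 'n ^ 'n \<Rightarrow> real ^ 'm ^ 'm) \<Rightarrow>
    real ^ 'm ^ 'm \<Rightarrow> (real ^ 'n \<Rightarrow> real) \<Rightarrow> bool" where
  "visc_subsol_matrix \<Omega> \<Psi> N u \<longleftrightarrow>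
     usc_on \<Omega> u \<and>
     (\<forall>\<phi> x. C2_on \<Omega> \<phi> \<and> x \<in> \<Omega> \<and> (\<forall>y\<in>\<Omega>. u y - \<phi> y \<le> u x - \<phi> x) \<longrightarrow>
        \<Psi> x (grad \<phi> x) (hess \<phi> x) \<preceq> N)"

definition augmented_hess ::
  "(real ^ 'n \<Rightarrow> real ^ 'm ^ 'n) \<Rightarrow> (real ^ 'n \<Rightarrow> real ^ 'n \<Rightarrow> real ^ 'm ^ 'm) \<Rightarrow>
    real ^ 'n \<Rightarrow> real ^ 'n \<Rightarrow> real ^ 'n ^ 'n \<Rightarrow> real ^ 'm ^ 'm" where
  "augmented_hess \<sigma> A x p X = transpose (\<sigma> x) ** X ** \<sigma> x + A x p"

definition visc_subsol_logdet ::
  "(real ^ 'n) set \<Rightarrow>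
    (real ^ 'n \<Rightarrow> real ^ 'm ^ 'n) \<Rightarrow>
    (real ^ 'n \<Rightarrow> real ^ 'n \<Rightarrow> real ^ 'm ^ 'm) \<Rightarrow>
    (real ^ 'n \<Rightarrow> real \<Rightarrow> real ^ 'n \<Rightarrow> real ^ 'n ^ 'n \<Rightarrow> real) \<Rightarrow>
    real \<Rightarrow> (real ^ 'n \<Rightarrow> real) \<Rightarrow> bool" where
  "visc_subsol_logdet \<Omega> \<sigma> A K c u \<longleftrightarrow>
     usc_on (closure \<Omega>) u \<and>
     (\<forall>\<phi> x. C2_closure \<Omega> \<phi> \<and> x \<in> \<Omega> \<and>
        (\<forall>y\<in>closure \<Omega>. u y - \<phi> y \<le> u x - \<phi> x) \<longrightarrow>
        - ln (det (augmented_hess \<sigma> A x (grad \<phi> x) (hess \<phi> x)))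
          + K x (u x) (grad \<phi> x) (hess \<phi> x) \<le> c)"

definition visc_supersol_logdet ::
  "(real ^ 'n) set \<Rightarrow>
    (real ^ 'n \<Rightarrow> real ^ 'm ^ 'n) \<Rightarrow>
    (real ^ 'n \<Rightarrow> real ^ 'n \<Rightarrow> real ^ 'm ^ 'm) \<Rightarrow>
    (real ^ 'n \<Rightarrow> real \<Rightarrow> real ^ 'n \<Rightarrow> real ^ 'n ^ 'n \<Rightarrow> real) \<Rightarrow>
    (real ^ 'n \<Rightarrow> real) \<Rightarrow> bool" where
  "visc_supersol_logdet \<Omega> \<sigma> A K v \<longleftrightarrow>
     lsc_on (closure \<Omega>) v \<and>
     (\<forall>\<phi> x. C2_closure \<Omega> \<phi> \<and> x \<in> \<Omega> \<and>
        (\<forall>y\<in>closure \<Omega>. v x - \<phi> x \<le> v y - \<phi> y) \<and>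
        pos_definite (augmented_hess \<sigma> A x (grad \<phi> x) (hess \<phi> x)) \<longrightarrow>
        - ln (det (augmented_hess \<sigma> A x (grad \<phi> x) (hess \<phi> x)))
          + K x (v x) (grad \<phi> x) (hess \<phi> x) \<ge> 0)"


section \<open>Maxima over possibly infinite sets\<close>

text \<open>\<open>M\<close> is the (attained) maximum of \<open>f\<close> over \<open>S\<close>; the library's \<open>Max\<close> is restricted to
  finite sets.\<close>

definition is_max_of :: "('a \<Rightarrow> real) \<Rightarrow> 'a set \<Rightarrow> real \<Rightarrow> bool" where
  "is_max_of f S M \<longleftrightarrow> (\<exists>z\<in>S. f z = M) \<and> (\<forall>y\<in>S. f y \<le> M)"

end

theory Submission
  imports Defs
begin

text \<open>Doubling of variables: at a maximum point of \<open>u x - v y - \<bar>x - y\<bar>\<^sup>2 / (2 \<epsilon>)\<close> the theorem on sums yields Hessians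
  \<open>X\<close> and \<open>Y\<close> that satisfy the sandwich condition of the structure hypothesis on \<open>K\<close>. The strict matrix
  inequality for \<open>u\<close> together with the Lipschitz bounds on \<open>\<sigma>\<close> and \<open>A\<close> makes the augmented Hessian at \<open>y\<close>
  positive definite and bounded below by the one at \<open>x\<close> up to a vanishing multiple of the identity; as the
  determinant is monotone, the gap \<open>\<gamma>1\<close> between the two scalar inequalities tends to 0 with \<open>\<epsilon>\<close>.

  The theorem on sums follows from sup-convolution, which makes both functions semiconvex. By Jensen's
  lemma the points where a linear perturbation of the doubled function is maximal form a set that is not
  null. On it each of the functions is squeezed between two paraboloids, so its gradient is Lipschitz there, and
  Rademacher's theorem gives second-order expansions at almost every such point; the full theorem of
  Alexandrov is not required.\<close>

section \<open>Vitali coverings and porous sets\<close>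

text \<open>There are two limits. The theorem on sums only yields points near the doubling maximum,
  with errors of size \<open>\<eta>\<close>, whereas the structure condition on \<open>K\<close>
  demands the slope \<open>(x - y) / \<epsilon>\<close> and the constant
  \<open>3 / \<epsilon>\<close> exactly. So \<open>\<eta>\<close> tends to 0 first, with
  \<open>\<epsilon>\<close> fixed and the Hessians in a compact set; only then does
  \<open>\<epsilon>\<close> tend to 0. On the measure-theoretic side the obstacle is that gradients
  are known on the contact set alone, and no measurability of that set is at hand. Rademacher's
  theorem applies to an extension of the gradient, and its expansion says something about the
  function only at contact points. Porosity closes the gap: almost every point of an arbitrary set
  has points of the set near every small displacement, up to a small fraction of its length. The
  same device gives Rademacher's theorem from differentiability along lines, with no proof that
  directional derivatives depend linearly on the direction. The covering estimate below, with its
  factor \<open>\<theta>\<close>, serves both for porosity and for the derivative on the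
  line.\<close>

lemma outer_measure_image_le:
  fixes f :: "'a::euclidean_space \<Rightarrow> 'b::euclidean_space"
  assumes null: "\<And>N. negligible N \<Longrightarrow> negligible (f ` N)"
    and cov: "\<And>x d. \<lbrakk>x \<in> S; 0 < d\<rbrakk> \<Longrightarrow>
        \<exists>a r W. 0 < r \<and> r < d \<and> x \<in> cball a r \<and> W \<in> sets lebesgue \<and> f ` (S \<inter> cball a r) \<subseteq> W \<and>
          emeasure lebesgue W \<le> ennreal \<theta> * emeasure lebesgue (cball a r)"
  shows "outer_measure_of lebesgue (f ` S) \<le> ennreal \<theta> * outer_measure_of lebesgue S"
proof -
  obtain E where E: "E \<in> sets lebesgue" "S \<subseteq> E" "outer_measure_of lebesgue S = emeasure lebesgue E"
    using outer_measure_of_attain[of S lebesgue] by auto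
  have step: "outer_measure_of lebesgue (f ` S) \<le> ennreal \<theta> * emeasure lebesgue E + ennreal \<theta> * ennreal e"
    if e: "e > 0" for e
  proof -
    obtain U where U: "open U" "E \<subseteq> U" "emeasure lebesgue (U - E) < ennreal e"
      using sets_lebesgue_outer_open[OF E(1) e] by metis
    \<comment> \<open>The index carries the covering set \<open>W\<close> along with the ball, so
      that the disjoint balls selected by Vitali come with bounds for their images. The balls lie in
      \<open>U\<close>, which exceeds the measurable hull \<open>E\<close> by measure less than
      \<open>e\<close>.\<close>
    define K where "K = {(a, r, W). 0 < r \<and> cball a r \<subseteq> U \<and> W \<in> sets lebesgue \<and>
       f ` (S \<inter> cball a r) \<subseteq> W \<and> emeasure lebesgue W \<le> ennreal \<theta> * emeasure lebesgue (cball a r)}"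
    define c :: "'a \<times> real \<times> 'b set \<Rightarrow> 'a" where "c = fst"
    define \<rho> :: "'a \<times> real \<times> 'b set \<Rightarrow> real" where "\<rho> = fst \<circ> snd"
    define W :: "'a \<times> real \<times> 'b set \<Rightarrow> 'b set" where "W = snd \<circ> snd"
    have fine: "\<exists>i. i \<in> K \<and> x \<in> cball (c i) (\<rho> i) \<and> \<rho> i < d" if "x \<in> S" "0 < d" for x d
    proof -
      have "x \<in> U" using that E U by blast
      then obtain s where s: "s > 0" "ball x s \<subseteq> U"
        using U(1) open_contains_ball by blast
      obtain a r V where arV: "0 < r" "r < min d (s/2)" "x \<in> cball a r" "V \<in> sets lebesgue"
        "f ` (S \<inter> cball a r) \<subseteq> V" "emeasure lebesgue V \<le> ennreal \<theta> * emeasure lebesgue (cball a r)"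
        using cov[OF \<open>x \<in> S\<close>, of "min d (s/2)"] \<open>0 < d\<close> s(1) by auto
      have "cball a r \<subseteq> ball x s"
      proof
        fix y assume "y \<in> cball a r"
        then have "dist x y \<le> r + r"
          using arV(3) dist_triangle[of x y a] by (simp add: dist_commute)
        then show "y \<in> ball x s" using arV(2) by simp
      qed
      then have "(a, r, V) \<in> K" using arV s by (auto simp: K_def)
      then show ?thesis using arV by (intro exI[of _ "(a, r, V)"]) (auto simp: c_def \<rho>_def)
    qed
    have pos: "0 < \<rho> i" if "i \<in> K" for i using that by (auto simp: K_def \<rho>_def)
    obtain C where C: "countable C" "C \<subseteq> K"
      "pairwise (\<lambda>i j. disjnt (cball (c i) (\<rho> i)) (cball (c j) (\<rho> j))) C"
      "negligible (S - (\<Union>i\<in>C. cball (c i) (\<rho> i)))"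
      by (rule Vitali_covering_theorem_cballs[of K \<rho> S c]) (use pos fine in blast)+
    \<comment> \<open>Numbering by natural numbers, with empty sets outside \<open>T\<close>, treats
      finite and infinite \<open>C\<close> alike in the series below.\<close>
    define T where "T = to_nat_on C ` C"
    define B' where "B' n = (if n \<in> T then cball (c (from_nat_into C n)) (\<rho> (from_nat_into C n)) else {})" for n
    define W' where "W' n = (if n \<in> T then W (from_nat_into C n) else {})" for n
    have fni: "from_nat_into C n \<in> C" "to_nat_on C (from_nat_into C n) = n" if "n \<in> T" for n
      using that C(1) by (auto simp: T_def)
    have disj: "disjoint_family B'"
      unfolding disjoint_family_on_def
    proof (intro ballI impI)
      fix m n :: nat assume "m \<noteq> n"
      show "B' m \<inter> B' n = {}"
      proof (cases "m \<in> T \<and> n \<in> T")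
        case True
        then have "from_nat_into C m \<noteq> from_nat_into C n"
          using fni \<open>m \<noteq> n\<close> by metis
        then show ?thesis using C(3) fni True
          by (auto simp: B'_def pairwise_def disjnt_def)
      qed (auto simp: B'_def)
    qed
    have WS: "W' n \<in> sets lebesgue" "emeasure lebesgue (W' n) \<le> ennreal \<theta> * emeasure lebesgue (B' n)"
      "B' n \<subseteq> U" for n
    proof -
      have KD: "cball (c i) (\<rho> i) \<subseteq> U \<and> W i \<in> sets lebesgue \<and>
          emeasure lebesgue (W i) \<le> ennreal \<theta> * emeasure lebesgue (cball (c i) (\<rho> i))" if "i \<in> K" for i
        using that by (cases i) (simp add: K_def c_def \<rho>_def W_def del: emeasure_completion)
      show "W' n \<in> sets lebesgue" "emeasure lebesgue (W' n) \<le> ennreal \<theta> * emeasure lebesgue (B' n)"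
        "B' n \<subseteq> U"
        using KD[of "from_nat_into C n"] fni(1)[of n] C(2) unfolding W'_def B'_def
        by (cases "n \<in> T"; fastforce)+
    qed
    have covW: "f ` S \<subseteq> (\<Union>n. W' n) \<union> f ` (S - (\<Union>i\<in>C. cball (c i) (\<rho> i)))"
    proof
      fix y assume "y \<in> f ` S"
      then obtain x where x: "x \<in> S" "y = f x" by blast
      show "y \<in> (\<Union>n. W' n) \<union> f ` (S - (\<Union>i\<in>C. cball (c i) (\<rho> i)))"
      proof (cases "x \<in> (\<Union>i\<in>C. cball (c i) (\<rho> i))")
        case True
        then obtain i where i: "i \<in> C" "x \<in> cball (c i) (\<rho> i)" by blast
        moreover have "f ` (S \<inter> cball (c i) (\<rho> i)) \<subseteq> W i"
          using i(1) C(2) by (cases i) (auto simp: K_def W_def c_def \<rho>_def)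
        ultimately have "y \<in> W i" using x by blast
        then have "y \<in> W' (to_nat_on C i)" using i C(1) by (auto simp: W'_def T_def)
        then show ?thesis by blast
      qed (use x in auto)
    qed
    have negN: "f ` (S - (\<Union>i\<in>C. cball (c i) (\<rho> i))) \<in> null_sets lebesgue"
      using null[OF C(4)] negligible_iff_null_sets by blast
    have "outer_measure_of lebesgue (f ` S) \<le>
        emeasure lebesgue ((\<Union>n. W' n) \<union> f ` (S - (\<Union>i\<in>C. cball (c i) (\<rho> i))))"
      using outer_measure_of_mono[OF covW, of lebesgue] WS(1) negN
      by (subst (asm) (2) outer_measure_of_eq) auto
    also have "\<dots> = emeasure lebesgue (\<Union>n. W' n)"
      using WS(1) negN by (intro emeasure_Un_null_set) auto
    also have "\<dots> \<le> (\<Sum>n. emeasure lebesgue (W' n))"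
      using WS(1) by (intro emeasure_subadditive_countably) auto
    also have "\<dots> \<le> (\<Sum>n. ennreal \<theta> * emeasure lebesgue (B' n))"
      using WS(2) by (intro suminf_le) auto
    also have "\<dots> = ennreal \<theta> * (\<Sum>n. emeasure lebesgue (B' n))"
      by simp
    also have "(\<Sum>n. emeasure lebesgue (B' n)) = emeasure lebesgue (\<Union>n. B' n)"
      by (intro suminf_emeasure disj) (auto simp: B'_def)
    also have "\<dots> \<le> emeasure lebesgue U"
      using WS(3) U(1) by (intro emeasure_mono) auto
    also have "\<dots> \<le> emeasure lebesgue (E \<union> (U - E))"
      using U by (intro emeasure_mono) (auto intro!: sets.Un simp: E(1))
    also have "\<dots> \<le> emeasure lebesgue E + emeasure lebesgue (U - E)"
      using E(1) U(1) by (intro emeasure_subadditive) auto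
    also have "\<dots> \<le> emeasure lebesgue E + ennreal e"
      using U(3) by (intro add_left_mono) auto
    finally show ?thesis by (simp add: distrib_left mult_left_mono)
  qed
  show ?thesis unfolding E(3)
  proof (rule ennreal_le_epsilon)
    fix e :: real assume e: "0 < e"
    \<comment> \<open>A negative \<open>\<theta>\<close> becomes 0 in \<open>ennreal\<close>;
      \<open>t\<close> is the value that really occurs.\<close>
    define t where "t = max \<theta> 0"
    have "ennreal \<theta> = ennreal t" by (simp add: t_def max_def ennreal_neg)
    have "t * (e / (t + 1)) \<le> e" using e by (simp add: t_def field_simps)
    have "outer_measure_of lebesgue (f ` S) \<le> ennreal \<theta> * emeasure lebesgue E + ennreal \<theta> * ennreal (e / (t+1))"
      using e by (intro step) (auto simp: t_def)
    also have "ennreal \<theta> * ennreal (e / (t+1)) = ennreal (t * (e / (t+1)))"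
      unfolding \<open>ennreal \<theta> = ennreal t\<close> using e by (subst ennreal_mult) (auto simp: t_def)
    also have "\<dots> \<le> ennreal e" using \<open>t * (e / (t + 1)) \<le> e\<close> by (rule ennreal_leI)
    finally show "outer_measure_of lebesgue (f ` S) \<le> ennreal \<theta> * emeasure lebesgue E + ennreal e"
      by (simp add: add_left_mono)
  qed
qed

lemma negligible_if_outer_measure_zero:
  fixes S :: "'a::euclidean_space set"
  assumes "outer_measure_of lebesgue S = 0"
  shows "negligible S"
proof -
  obtain E where E: "E \<in> sets lebesgue" "S \<subseteq> E" "outer_measure_of lebesgue S = emeasure lebesgue E"
    using outer_measure_of_attain[of S lebesgue] by auto
  then have "E \<in> null_sets lebesgue" using assms by (simp add: null_sets_def del: emeasure_completion)
  then show ?thesis using E(2) negligible_iff_null_sets negligible_subset by blast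
qed

text \<open>Covering a set with a proportional loss at all small scales gives an estimate of its
  outer measure by a fraction of itself. Boundedness makes that measure finite, so a factor below 1
  forces it to be 0.\<close>

lemma negligible_if_outer_measure_contracts:
  fixes S :: "'a::euclidean_space set"
  assumes "bounded S" "0 \<le> \<theta>" "\<theta> < 1"
    and le: "outer_measure_of lebesgue S \<le> ennreal \<theta> * outer_measure_of lebesgue S"
  shows "negligible S"
proof -
  obtain r where r: "S \<subseteq> cball 0 r"
    using bounded_subset_ballD[OF assms(1), of 0] ball_subset_cball by blast
  have "outer_measure_of lebesgue S \<le> outer_measure_of lebesgue (cball (0::'a) r)"
    by (rule outer_measure_of_mono[OF r])
  also have "\<dots> < \<infinity>"
    using emeasure_bounded_finite[of "cball (0::'a) r"] by simp
  finally have fin: "outer_measure_of lebesgue S < \<infinity>" .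
  then obtain m where m: "m \<ge> 0" "outer_measure_of lebesgue S = ennreal m"
    by (cases "outer_measure_of lebesgue S") auto
  have "m \<le> \<theta> * m" using le m assms(2) by (simp add: ennreal_mult[symmetric])
  then have "m = 0" using m(1) assms(3) by (metis mult_le_cancel_right1 not_le order_antisym)
  then show ?thesis using m negligible_if_outer_measure_zero by auto
qed

lemma negligible_Int_balls:
  fixes S :: "'a::euclidean_space set"
  assumes "\<And>n::nat. negligible (S \<inter> ball 0 (real n))"
  shows "negligible S"
proof -
  have "S = (\<Union>n::nat. S \<inter> ball 0 (real n))"
    using reals_Archimedean2 by fastforce
  then show ?thesis using assms negligible_countable_Union[of "range (\<lambda>n::nat. S \<inter> ball 0 (real n))"] by auto
qed

text \<open>Porosity in the usual sense: holes of radius proportional to their distance from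
  \<open>x\<close>, at arbitrarily small scales. At a point of \<open>A\<close> off this set,
  \<open>A\<close> meets \<open>ball (x + h) (\<epsilon> * norm h)\<close> for every small nonzero
  \<open>h\<close>. This takes the place of density points and makes sense for arbitrary
  \<open>A\<close>.\<close>

definition porosity_points :: "'a::euclidean_space set \<Rightarrow> real \<Rightarrow> 'a set" where
  "porosity_points A \<epsilon> = {x\<in>A. \<forall>d>0. \<exists>h. h \<noteq> 0 \<and> norm h < d \<and> A \<inter> ball (x + h) (\<epsilon> * norm h) = {}}"

text \<open>The covering estimate is applied to the identity map: near a porosity point a hole
  removes a fixed fraction of some arbitrarily small ball.\<close>

lemma negligible_porosity_points:
  fixes A :: "'a::euclidean_space set"
  assumes \<epsilon>: "0 < \<epsilon>"
  shows "negligible (porosity_points A \<epsilon>)"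
proof (rule negligible_Int_balls)
  fix n :: nat
  define S where "S = porosity_points A \<epsilon> \<inter> ball 0 (real n)"
  \<comment> \<open>The hole of radius \<open>\<epsilon> * norm h\<close> lies in the ball of radius
    \<open>(1 + \<epsilon>) * norm h\<close> about \<open>x\<close>; \<open>\<theta>\<close> is the
    fraction of the volume that remains.\<close>
  define \<theta> where "\<theta> = 1 - (\<epsilon> / (1 + \<epsilon>)) ^ DIM('a)"
  have q: "0 < (\<epsilon> / (1 + \<epsilon>)) ^ DIM('a)" "(\<epsilon> / (1 + \<epsilon>)) ^ DIM('a) \<le> 1"
    using \<epsilon> by (auto intro!: power_le_one)
  have "outer_measure_of lebesgue ((\<lambda>x. x) ` S) \<le> ennreal \<theta> * outer_measure_of lebesgue S"
  proof (rule outer_measure_image_le)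
    fix x :: 'a and d :: real assume x: "x \<in> S" and d: "0 < d"
    have "0 < d / (1 + \<epsilon>)" using d \<epsilon> by simp
    then obtain h where h: "h \<noteq> 0" "norm h < d / (1 + \<epsilon>)" "A \<inter> ball (x + h) (\<epsilon> * norm h) = {}"
      using x unfolding S_def porosity_points_def by blast
    define r where "r = (1 + \<epsilon>) * norm h"
    have r: "0 < r" "r < d" using h \<epsilon> by (auto simp: r_def field_simps add_pos_pos)
    let ?H = "ball (x + h) (\<epsilon> * norm h)"
    have sub: "?H \<subseteq> cball x r"
    proof
      fix y assume "y \<in> ?H"
      then have "dist (x + h) y < \<epsilon> * norm h" by simp
      moreover have "dist x y \<le> dist x (x + h) + dist (x + h) y" by (rule dist_triangle)
      moreover have "dist x (x + h) = norm h" by (simp add: dist_norm)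
      ultimately show "y \<in> cball x r" by (simp add: r_def algebra_simps)
    qed
    have "measure lebesgue (cball x r - ?H) = measure lebesgue (cball x r) - measure lebesgue ?H"
      using sub by (intro measurable_measure_Diff) auto
    also have "\<dots> = unit_ball_vol (real DIM('a)) * r ^ DIM('a) - unit_ball_vol (real DIM('a)) * (\<epsilon> * norm h) ^ DIM('a)"
      using r \<epsilon> by (simp add: content_cball content_ball)
    also have "\<dots> = \<theta> * (unit_ball_vol (real DIM('a)) * r ^ DIM('a))"
    proof -
      have "\<epsilon> * norm h = (\<epsilon> / (1 + \<epsilon>)) * r"
        using \<epsilon> by (simp add: r_def field_simps)
      then show ?thesis
        by (simp only: power_mult_distrib \<theta>_def) (simp add: algebra_simps)
    qed
    also have "\<dots> = \<theta> * measure lebesgue (cball x r)" using r by (simp add: content_cball)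
    finally have m: "measure lebesgue (cball x r - ?H) = \<theta> * measure lebesgue (cball x r)" .
    have lm: "cball x r - ?H \<in> lmeasurable" by (intro fmeasurable.Diff) auto
    have "emeasure lebesgue (cball x r - ?H) = ennreal (measure lebesgue (cball x r - ?H))"
      using lm emeasure_eq_measure2 by blast
    also have "\<dots> = ennreal \<theta> * ennreal (measure lebesgue (cball x r))"
      unfolding m using q by (intro ennreal_mult) (auto simp: \<theta>_def)
    also have "ennreal (measure lebesgue (cball x r)) = emeasure lebesgue (cball x r)"
      using emeasure_eq_measure2 lmeasurable_cball by metis
    finally have em: "emeasure lebesgue (cball x r - ?H) \<le> ennreal \<theta> * emeasure lebesgue (cball x r)" by simp
    have "S \<inter> cball x r \<subseteq> cball x r - ?H"
      using h(3) by (auto simp: S_def porosity_points_def)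
    then show "\<exists>a r W. 0 < r \<and> r < d \<and> x \<in> cball a r \<and> W \<in> sets lebesgue \<and>
         (\<lambda>x. x) ` (S \<inter> cball a r) \<subseteq> W \<and> emeasure lebesgue W \<le> ennreal \<theta> * emeasure lebesgue (cball a r)"
      using r em lm by (intro exI[of _ x] exI[of _ r] exI[of _ "cball x r - ?H"]) auto
  qed auto
  moreover have "bounded S" unfolding S_def by (meson bounded_Int bounded_ball)
  ultimately show "negligible (porosity_points A \<epsilon> \<inter> ball 0 (real n))"
    using q unfolding S_def[symmetric]
    by (intro negligible_if_outer_measure_contracts[of S \<theta>]) (auto simp: \<theta>_def)
qed

section \<open>Rademacher's theorem\<close>

lemma outer_measure_strict_mono_image_le:
  fixes g :: "real \<Rightarrow> real"
  assumes mono: "strict_mono g" and null: "\<And>N. negligible N \<Longrightarrow> negligible (g ` N)" and "0 \<le> \<theta>"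
    and slope: "\<And>x d. \<lbrakk>x \<in> S; 0 < d\<rbrakk> \<Longrightarrow> \<exists>y. y \<noteq> x \<and> \<bar>y - x\<bar> < d \<and> \<bar>g y - g x\<bar> \<le> \<theta> * \<bar>y - x\<bar>"
  shows "outer_measure_of lebesgue (g ` S) \<le> ennreal \<theta> * outer_measure_of lebesgue S"
proof (rule outer_measure_image_le[OF null])
  fix x d :: real assume "x \<in> S" "0 < d"
  then obtain y where y: "y \<noteq> x" "\<bar>y - x\<bar> < d" "\<bar>g y - g x\<bar> \<le> \<theta> * \<bar>y - x\<bar>"
    using slope by blast
  \<comment> \<open>The ball is the interval with endpoints \<open>x\<close> and \<open>y\<close>.
    The covering lemma only asks that it contain \<open>x\<close>, not that it be centred there; by
    monotonicity its image lies between \<open>g lo\<close> and \<open>g hi\<close>.\<close>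
  define a where "a = (x + y) / 2"
  define r where "r = \<bar>y - x\<bar> / 2"
  define lo where "lo = min x y"
  define hi where "hi = max x y"
  have c: "cball a r = {lo..hi}"
    unfolding cball_eq_atLeastAtMost by (auto simp: a_def r_def lo_def hi_def field_simps min_def max_def abs_if)
  have lh: "lo \<le> hi" "hi - lo = \<bar>y - x\<bar>" "g hi - g lo \<le> \<theta> * (hi - lo)"
    using y strict_mono_less[OF mono] by (auto simp: lo_def hi_def min_def max_def abs_if split: if_splits)
  have sub: "g ` (S \<inter> cball a r) \<subseteq> {g lo..g hi}"
    unfolding c using strict_mono_less_eq[OF mono] by auto
  have "emeasure lebesgue {g lo..g hi} = ennreal (g hi - g lo)"
    using lh(1) strict_mono_less_eq[OF mono] by simp
  also have "\<dots> \<le> ennreal (\<theta> * (hi - lo))" by (rule ennreal_leI[OF lh(3)])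
  also have "\<dots> = ennreal \<theta> * ennreal (hi - lo)" using \<open>0 \<le> \<theta>\<close> lh(1) by (intro ennreal_mult) auto
  also have "ennreal (hi - lo) = emeasure lebesgue (cball a r)"
    unfolding c using lh(1) by simp
  finally have em: "emeasure lebesgue {g lo..g hi} \<le> ennreal \<theta> * emeasure lebesgue (cball a r)" .
  show "\<exists>a r W. 0 < r \<and> r < d \<and> x \<in> cball a r \<and> W \<in> sets lebesgue \<and> g ` (S \<inter> cball a r) \<subseteq> W \<and>
      emeasure lebesgue W \<le> ennreal \<theta> * emeasure lebesgue (cball a r)"
    by (intro exI[of _ a] exI[of _ r] exI[of _ "{g lo..g hi}"] conjI sub em)
      (use y in \<open>auto simp: r_def a_def dist_real_def field_simps abs_if\<close>)
qed auto

lemma negligible_lipschitz_image: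
  fixes f :: "'a::euclidean_space \<Rightarrow> 'a"
  assumes "\<And>x y. norm (f y - f x) \<le> B * norm (y - x)" "negligible N"
  shows "negligible (f ` N)"
proof (rule negligible_locally_Lipschitz_image)
  show "\<exists>T B. open T \<and> x \<in> T \<and> (\<forall>y\<in>N \<inter> T. norm (f y - f x) \<le> B * norm (y - x))" for x
    using assms(1) open_UNIV by blast
qed (use assms in auto)

text \<open>If a bounded quotient diverges, two rationals fit strictly between its lower and upper
  limits. Rational levels are what later makes the set of bad points a countable union.\<close>

lemma real_diff_quotient_convergent:
  fixes Q :: "'a \<Rightarrow> real"
  assumes nt: "F \<noteq> bot" and bd: "\<forall>\<^sub>F y in F. a \<le> Q y \<and> Q y \<le> b"
    and osc: "\<And>p q. p < q \<Longrightarrow> \<not> ((\<exists>\<^sub>F y in F. Q y < real_of_rat p) \<and> (\<exists>\<^sub>F y in F. real_of_rat q < Q y))"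
  shows "\<exists>l. (Q \<longlongrightarrow> l) F"
proof -
  let ?X = "\<lambda>y. ereal (Q y)"
  have "Limsup F ?X \<le> Liminf F ?X"
  proof (rule ccontr)
    assume "\<not> ?thesis"
    then obtain p where p: "Liminf F ?X < ereal (real_of_rat p)" "ereal (real_of_rat p) < Limsup F ?X"
      using ereal_dense3 by (metis not_le)
    then obtain q where q: "ereal (real_of_rat p) < ereal (real_of_rat q)" "ereal (real_of_rat q) < Limsup F ?X"
      using ereal_dense3 by blast
    have "p < q" using q(1) by (simp add: of_rat_less)
    have "\<exists>\<^sub>F y in F. Q y < real_of_rat p"
    proof (rule ccontr)
      assume "\<not> ?thesis"
      then have "\<forall>\<^sub>F y in F. ereal (real_of_rat p) \<le> ?X y" by (simp add: not_frequently not_less)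
      then have "ereal (real_of_rat p) \<le> Liminf F ?X" by (rule Liminf_bounded)
      with p(1) show False by simp
    qed
    moreover have "\<exists>\<^sub>F y in F. real_of_rat q < Q y"
    proof (rule ccontr)
      assume "\<not> ?thesis"
      then have "\<forall>\<^sub>F y in F. ?X y \<le> ereal (real_of_rat q)" by (simp add: not_frequently not_less)
      then have "Limsup F ?X \<le> ereal (real_of_rat q)" by (rule Limsup_bounded)
      with q(2) show False by simp
    qed
    ultimately show False using osc[OF \<open>p < q\<close>] by blast
  qed
  then have eq: "Liminf F ?X = Limsup F ?X" using Liminf_le_Limsup[OF nt, of ?X] by simp
  have "ereal a \<le> Liminf F ?X"
    using bd by (intro Liminf_bounded) (auto elim: eventually_mono)
  moreover have "Limsup F ?X \<le> ereal b"
    using bd by (intro Limsup_bounded) (auto elim: eventually_mono)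
  ultimately obtain l where l: "Limsup F ?X = ereal l"
    using eq by (cases "Limsup F ?X") auto
  have "(?X \<longlongrightarrow> ereal l) F"
    using tendsto_iff_Liminf_eq_Limsup[OF nt, of ?X "ereal l"] eq l by simp
  then show ?thesis by (auto simp: lim_ereal)
qed

text \<open>The covering estimate, applied to \<open>g\<close> and to its inverse, compares the outer measures of a set
  and of its image in both directions; hence the set where the lower derivative is below \<open>p\<close> and the
  upper one above \<open>q > p\<close> has measure at most \<open>p / q\<close> times itself.\<close>

lemma negligible_not_differentiable_bilipschitz:
  fixes g :: "real \<Rightarrow> real"
  assumes lo: "\<And>x y. x \<le> y \<Longrightarrow> y - x \<le> g y - g x"
    and hi: "\<And>x y. x \<le> y \<Longrightarrow> g y - g x \<le> M * (y - x)"
  shows "negligible {x. \<not> g differentiable (at x)}"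
proof -
  define Q where "Q x y = (g y - g x) / (y - x)" for x y
  define S where "S p q = {x. (\<exists>\<^sub>F y in at x. Q x y < p) \<and> (\<exists>\<^sub>F y in at x. q < Q x y)}" for p q
  have Qb: "1 \<le> Q x y \<and> Q x y \<le> M" if "y \<noteq> x" for x y
    using lo[of x y] hi[of x y] lo[of y x] hi[of y x] that
    by (cases "x < y") (auto simp: Q_def field_simps)
  have sm: "strict_mono g"
  proof (rule strict_monoI)
    fix x y :: real assume "x < y"
    then show "g x < g y" using lo[of x y] by linarith
  qed
  have gabs: "\<bar>g y - g x\<bar> = Q x y * \<bar>y - x\<bar>" for x y
  proof (cases "x = y")
    case False
    then have "g y - g x = Q x y * (y - x)" by (simp add: Q_def)
    then have "\<bar>g y - g x\<bar> = \<bar>Q x y\<bar> * \<bar>y - x\<bar>" by (simp add: abs_mult)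
    then show ?thesis using Qb[of y x] False by auto
  qed (simp add: Q_def)
  have M: "1 \<le> M" using Qb[of 1 0] by auto
  have gL: "norm (g y - g x) \<le> M * norm (y - x)" for x y
    unfolding real_norm_def gabs using Qb[of y x] M by (cases "x = y") (auto intro: mult_right_mono)
  have cont: "continuous_on UNIV g"
    by (rule lipschitz_on_continuous_on[of M], rule lipschitz_onI)
      (use gL M in \<open>auto simp: dist_norm norm_minus_commute\<close>)
  have "surj g"
  proof -
    have "\<exists>x. g x = y" for y
    proof -
      define t where "t = \<bar>y - g 0\<bar>"
      have "g (- t) \<le> y" "y \<le> g t" using lo[of "-t" 0] lo[of 0 t] by (auto simp: t_def)
      moreover have "- t \<le> t" by (simp add: t_def)
      ultimately show ?thesis
        using IVT'[of g "-t" y t] continuous_on_subset[OF cont] by blast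
    qed
    then show ?thesis by (metis surjI)
  qed
  then have bij: "bij g" using sm strict_mono_imp_inj_on bij_def by blast
  define h where "h = inv g"
  have hg: "h (g x) = x" for x using bij by (simp add: h_def bij_is_inj)
  have gh: "g (h x) = x" for x using bij by (simp add: h_def bij_is_surj surj_f_inv_f)
  have smh: "strict_mono h"
    by (rule strict_monoI) (metis gh sm strict_mono_less)
  have hL: "norm (h y - h x) \<le> 1 * norm (y - x)" for x y
    using lo[of "h x" "h y"] lo[of "h y" "h x"] gh by (cases "h x \<le> h y") auto
  have Sneg: "negligible (S p q)" if pq: "p < q" for p q
  proof (cases "0 < p")
    case False
    \<comment> \<open>All difference quotients are at least 1, so none falls below
      \<open>p \<le> 0\<close>.\<close>
    have "S p q = {}"
    proof -
      have "\<not> (\<exists>\<^sub>F y in at x. Q x y < p)" for x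
        unfolding not_frequently
      proof (rule eventually_at_topological[THEN iffD2, OF exI[of _ UNIV]], intro conjI ballI impI)
        fix y assume "y \<noteq> x" then show "\<not> Q x y < p" using Qb[of y x] False by linarith
      qed auto
      then show ?thesis by (auto simp: S_def)
    qed
    then show ?thesis by simp
  next
    case p: True
    show ?thesis
    proof (rule negligible_Int_balls)
      fix n :: nat
      define T where "T = S p q \<inter> ball 0 (real n)"
      have 1: "outer_measure_of lebesgue (g ` T) \<le> ennreal p * outer_measure_of lebesgue T"
      proof (rule outer_measure_strict_mono_image_le[OF sm])
        fix x d :: real assume "x \<in> T" "0 < d"
        then have "\<exists>\<^sub>F y in at x. Q x y < p" by (auto simp: T_def S_def)
        then have "\<exists>\<^sub>F y in at x. Q x y < p \<and> y \<noteq> x \<and> dist y x < d"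
          by (rule frequently_rev_mp) (use \<open>0 < d\<close> in \<open>auto simp: eventually_at intro!: exI[of _ d]\<close>)
        then obtain y where y: "Q x y < p" "y \<noteq> x" "dist y x < d" using frequently_ex by blast
        then show "\<exists>y. y \<noteq> x \<and> \<bar>y - x\<bar> < d \<and> \<bar>g y - g x\<bar> \<le> p * \<bar>y - x\<bar>"
          by (intro exI[of _ y]) (auto simp: gabs dist_real_def intro: mult_right_mono)
      qed (use p negligible_lipschitz_image[OF gL] in auto)
      have 2: "outer_measure_of lebesgue (h ` (g ` T)) \<le> ennreal (1 / q) * outer_measure_of lebesgue (g ` T)"
      proof (rule outer_measure_strict_mono_image_le[OF smh])
        fix x' d :: real assume "x' \<in> g ` T" "0 < d"
        then obtain x where x: "x \<in> T" "x' = g x" by blast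
        then have "\<exists>\<^sub>F y in at x. q < Q x y" by (auto simp: T_def S_def)
        \<comment> \<open>\<open>g\<close> stretches by at most \<open>M\<close>, so this radius
          keeps \<open>g y\<close> within \<open>d\<close> of \<open>g x\<close>.\<close>
        moreover have "d / M > 0" using \<open>0 < d\<close> M by simp
        ultimately have "\<exists>\<^sub>F y in at x. q < Q x y \<and> y \<noteq> x \<and> dist y x < d / M"
          by (auto elim!: frequently_rev_mp simp: eventually_at intro!: exI[of _ "d / M"])
        then obtain y where y: "q < Q x y" "y \<noteq> x" "dist y x < d / M" using frequently_ex by blast
        have "\<bar>g y - g x\<bar> \<le> M * \<bar>y - x\<bar>" using gL by simp
        also have "\<dots> < d" using y(3) M by (simp add: dist_real_def field_simps)
        finally have a: "\<bar>g y - g x\<bar> < d" .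
        have b: "\<bar>h (g y) - h (g x)\<bar> \<le> 1 / q * \<bar>g y - g x\<bar>"
          unfolding gabs hg using y(1) p pq by (simp add: field_simps mult_right_mono)
        have "g y \<noteq> g x" using y(2) hg by metis
        then show "\<exists>y. y \<noteq> x' \<and> \<bar>y - x'\<bar> < d \<and> \<bar>h y - h x'\<bar> \<le> 1 / q * \<bar>y - x'\<bar>"
          using a b x(2) by blast
      qed (use p pq negligible_lipschitz_image[OF hL] in auto)
      have "outer_measure_of lebesgue T \<le> ennreal (1 / q) * (ennreal p * outer_measure_of lebesgue T)"
        using 2 mult_left_mono[OF 1, of "ennreal (1/q)"] by (simp add: image_image hg)
      also have "\<dots> = ennreal (p / q) * outer_measure_of lebesgue T"
        using p pq by (simp add: mult.assoc[symmetric] ennreal_mult[symmetric])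
      finally show "negligible (S p q \<inter> ball 0 (real n))"
        unfolding T_def[symmetric] using p pq
        by (intro negligible_if_outer_measure_contracts[of T "p/q"]) (auto simp: T_def bounded_Int)
    qed
  qed
  have "{x. \<not> g differentiable (at x)} \<subseteq> (\<Union>(p, q)\<in>{(p, q). p < q}. S (real_of_rat p) (real_of_rat q))"
  proof (rule subsetI, rule ccontr)
    fix x assume x: "x \<in> {x. \<not> g differentiable (at x)}"
      and n: "x \<notin> (\<Union>(p, q)\<in>{(p, q). p < q}. S (real_of_rat p) (real_of_rat q))"
    have "\<exists>l. ((\<lambda>y. Q x y) \<longlongrightarrow> l) (at x)"
    proof (rule real_diff_quotient_convergent)
      show "\<forall>\<^sub>F y in at x. 1 \<le> Q x y \<and> Q x y \<le> M"
        using Qb by (auto simp: eventually_at intro!: exI[of _ 1])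
    qed (use n in \<open>auto simp: S_def\<close>)
    then obtain l where "((\<lambda>y. Q x y) \<longlongrightarrow> l) (at x)" by blast
    then have "(g has_real_derivative l) (at x)"
      unfolding Q_def has_field_derivative_iff .
    then show False using x real_differentiable_def by blast
  qed
  moreover have "negligible (\<Union>(p, q)\<in>{(p, q). p < q}. S (real_of_rat p) (real_of_rat q))"
    by (intro negligible_countable_Union countable_image)
      (auto intro!: Sneg simp: of_rat_less countable_Collect)
  ultimately show ?thesis using negligible_subset by blast
qed

lemma negligible_not_differentiable_lipschitz_real:
  fixes f :: "real \<Rightarrow> real"
  assumes "L-lipschitz_on UNIV f"
  shows "negligible {x. \<not> f differentiable (at x)}"
proof -
  have L: "\<bar>f y - f x\<bar> \<le> L * \<bar>y - x\<bar>" for x y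
    using lipschitz_onD[OF assms, of y x] by (simp add: dist_real_def)
  \<comment> \<open>Slopes of \<open>f\<close> lie between \<open>- L\<close> and \<open>L\<close>;
    the shift by \<open>L + 1\<close> puts those of \<open>g\<close> between 1 and
    \<open>2 * L + 1\<close>.\<close>
  define g where "g x = f x + (L + 1) * x" for x
  have "negligible {x. \<not> g differentiable (at x)}"
  proof (rule negligible_not_differentiable_bilipschitz[of g "2 * L + 1"])
    show "y - x \<le> g y - g x" if "x \<le> y" for x y
      using L[of y x] that by (auto simp: g_def algebra_simps abs_le_iff)
    show "g y - g x \<le> (2 * L + 1) * (y - x)" if "x \<le> y" for x y
      using L[of y x] that by (auto simp: g_def algebra_simps abs_le_iff)
  qed
  moreover have "{x. \<not> f differentiable (at x)} \<subseteq> {x. \<not> g differentiable (at x)}"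
  proof (rule subsetI, rule ccontr)
    fix x assume x: "x \<in> {x. \<not> f differentiable (at x)}" "x \<notin> {x. \<not> g differentiable (at x)}"
    then have "(\<lambda>x. g x - (L + 1) * x) differentiable (at x)"
      by (intro derivative_intros) auto
    then show False using x(1) by (simp add: g_def)
  qed
  ultimately show ?thesis using negligible_subset by blast
qed

text \<open>Fubini's theorem for the indicator of \<open>x + t e \<in> N\<close>, \<open>t \<in> [0, 1]\<close>, and translation invariance.\<close>

lemma negligible_if_line_sections_negligible:
  fixes N :: "'a::euclidean_space set"
  assumes N: "N \<in> sets borel" and sec: "\<And>x. negligible {t::real. x + t *\<^sub>R e \<in> N}"
  shows "negligible N"
proof -
  \<comment> \<open>The cutoff to \<open>{0..1}\<close> keeps the integral over \<open>t\<close>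
    finite on bounded measure; its length 1 makes the double integral equal to the measure of
    \<open>N\<close>.\<close>
  have m1: "(\<lambda>(x, t). indicator N (x + t *\<^sub>R e) * indicator {0..1::real} t :: ennreal)
      \<in> borel_measurable (lborel \<Otimes>\<^sub>M lborel)"
  proof -
    have "(\<lambda>p. fst p + snd p *\<^sub>R e) \<in> borel_measurable (lborel \<Otimes>\<^sub>M lborel)"
      by measurable
    then have "(\<lambda>p. indicator N (fst p + snd p *\<^sub>R e) :: ennreal) \<in> borel_measurable (lborel \<Otimes>\<^sub>M lborel)"
      using borel_measurable_indicator[OF N] by (rule measurable_compose)
    moreover have "(\<lambda>p. indicator {0..1::real} (snd p) :: ennreal) \<in> borel_measurable (lborel \<Otimes>\<^sub>M lborel)"
      by measurable
    ultimately show ?thesis by (simp add: case_prod_beta borel_measurable_times_ennreal)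
  qed
  have 0: "(\<integral>\<^sup>+t. indicator N (x + t *\<^sub>R e) * indicator {0..1::real} t \<partial>lborel) = 0" for x
  proof -
    have "{t::real. x + t *\<^sub>R e \<in> N} = (\<lambda>t. x + t *\<^sub>R e) -` N \<inter> space borel" by auto
    moreover have "(\<lambda>t. x + t *\<^sub>R e) \<in> borel_measurable borel" by measurable
    ultimately have b: "{t::real. x + t *\<^sub>R e \<in> N} \<in> sets borel"
      using measurable_sets N by metis
    have "emeasure lborel {t::real. x + t *\<^sub>R e \<in> N} = 0"
      using sec[of x] b by (auto simp: negligible_iff_null_sets null_sets_completion_iff[where M=lborel] null_sets_def)
    then have "AE t in lborel. t \<notin> {t::real. x + t *\<^sub>R e \<in> N}"
      using b by (intro AE_not_in) (auto simp: null_sets_def)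
    then have "AE t in lborel. indicator N (x + t *\<^sub>R e) * indicator {0..1::real} t = (0::ennreal)"
      by eventually_elim auto
    then have "(\<integral>\<^sup>+t. indicator N (x + t *\<^sub>R e) * indicator {0..1::real} t \<partial>lborel) = (\<integral>\<^sup>+t. 0 \<partial>(lborel :: real measure))"
      by (rule nn_integral_cong_AE)
    then show ?thesis by simp
  qed
  have tr: "(\<integral>\<^sup>+x. indicator N (x + c) \<partial>lborel) = emeasure lborel N" for c
  proof -
    have "emeasure lborel N = (\<integral>\<^sup>+x. indicator N x \<partial>(distr lborel borel ((+) c)))"
      using N by (simp add: lborel_distr_plus)
    also have "\<dots> = (\<integral>\<^sup>+x. indicator N (c + x) \<partial>lborel)"
      using N by (subst nn_integral_distr) auto
    finally show ?thesis by (simp add: add.commute)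
  qed
  have "0 = (\<integral>\<^sup>+x. (\<integral>\<^sup>+t. indicator N (x + t *\<^sub>R e) * indicator {0..1::real} t \<partial>lborel) \<partial>lborel)"
    by (simp add: 0)
  also have "\<dots> = (\<integral>\<^sup>+t. (\<integral>\<^sup>+x. indicator N (x + t *\<^sub>R e) * indicator {0..1::real} t \<partial>lborel) \<partial>lborel)"
    by (rule lborel_pair.Fubini'[symmetric]) (rule m1)
  also have "\<dots> = (\<integral>\<^sup>+t. emeasure lborel N * indicator {0..1::real} t \<partial>lborel)"
  proof (rule nn_integral_cong)
    fix t :: real
    show "(\<integral>\<^sup>+x. indicator N (x + t *\<^sub>R e) * indicator {0..1::real} t \<partial>lborel) = emeasure lborel N * indicator {0..1::real} t"
      using tr[of "t *\<^sub>R e"] by (cases "t \<in> {0..1}") auto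
  qed
  also have "\<dots> = emeasure lborel N"
    by (subst nn_integral_cmult) auto
  finally show ?thesis
    using N by (auto simp: negligible_iff_null_sets null_sets_completion_iff[where M=lborel] null_sets_def)
qed

section \<open>From increments along the axes to linear approximation\<close>

definition directional_approx ::
  "('a::euclidean_space \<Rightarrow> real) \<Rightarrow> 'a \<Rightarrow> real \<Rightarrow> nat \<Rightarrow> real \<Rightarrow> 'a set" where
  "directional_approx G e \<epsilon> k q =
     {x. \<forall>h. \<bar>h\<bar> \<le> 1 / real (Suc k) \<longrightarrow> \<bar>G (x + h *\<^sub>R e) - G x - q * h\<bar> \<le> \<epsilon> * \<bar>h\<bar>}"

text \<open>An intersection of closed conditions, one for each increment \<open>h\<close>. This
  supplies the Borel sets that the section lemma demands, without discussing the measurability of a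
  derivative. The scale \<open>k\<close> and the slope \<open>q\<close> are separate parameters so
  that countably many such sets suffice up to a null set.\<close>

lemma closed_directional_approx:
  assumes "continuous_on UNIV G"
  shows "closed (directional_approx G e \<epsilon> k q)"
proof -
  have "directional_approx G e \<epsilon> k q =
      (\<Inter>h\<in>{h. \<bar>h\<bar> \<le> 1 / real (Suc k)}. {x. \<bar>G (x + h *\<^sub>R e) - G x - q * h\<bar> \<le> \<epsilon> * \<bar>h\<bar>})"
    by (auto simp: directional_approx_def)
  moreover have "closed {x. \<bar>G (x + h *\<^sub>R e) - G x - q * h\<bar> \<le> \<epsilon> * \<bar>h\<bar>}" for h
    by (intro closed_Collect_le continuous_intros continuous_on_compose2[OF assms]) auto
  ultimately show ?thesis by auto
qed

text \<open>On each line in direction \<open>e\<close> the function is Lipschitz in one real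
  variable, so the exceptional points of the line form a null set; then the section lemma
  applies.\<close>

lemma negligible_not_directional_approx:
  fixes G :: "'a::euclidean_space \<Rightarrow> real"
  assumes G: "L-lipschitz_on UNIV G" and e: "norm e = 1" and \<epsilon>: "0 < \<epsilon>"
  shows "negligible (- (\<Union>k. \<Union>q\<in>\<rat>. directional_approx G e \<epsilon> k q))" (is "negligible ?N")
proof (rule negligible_if_line_sections_negligible)
  have cont: "continuous_on UNIV G" using G lipschitz_on_continuous_on by blast
  show "?N \<in> sets borel"
    by (intro borel_comp sets.countable_UN'' countable_rat borel_closed
        closed_directional_approx cont) auto
  fix x :: 'a
  define f where "f t = G (x + t *\<^sub>R e)" for t :: real
  have "L-lipschitz_on UNIV f"
  proof (rule lipschitz_onI)
    fix s t :: real
    have "dist (f s) (f t) \<le> L * dist (x + s *\<^sub>R e) (x + t *\<^sub>R e)"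
      unfolding f_def using lipschitz_onD[OF G] by blast
    also have "dist (x + s *\<^sub>R e) (x + t *\<^sub>R e) = norm ((s - t) *\<^sub>R e)"
      by (simp add: dist_norm scaleR_diff_left)
    finally show "dist (f s) (f t) \<le> L * dist s t" using e by (simp add: dist_norm)
  qed (use G lipschitz_on_nonneg in blast)
  then have "negligible {t. \<not> f differentiable (at t)}"
    by (rule negligible_not_differentiable_lipschitz_real)
  moreover have "{t. x + t *\<^sub>R e \<in> ?N} \<subseteq> {t. \<not> f differentiable (at t)}"
  proof (rule subsetI, rule ccontr)
    fix t assume t: "t \<in> {t. x + t *\<^sub>R e \<in> ?N}" "t \<notin> {t. \<not> f differentiable (at t)}"
    then obtain D where D: "(f has_real_derivative D) (at t)"
      by (auto simp: real_differentiable_def)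
    have "\<exists>d>0. \<forall>y. norm (y - t) < d \<longrightarrow> norm (f y - f t - D * (y - t)) \<le> \<epsilon> / 2 * norm (y - t)"
      using D[unfolded has_field_derivative_def has_derivative_at_alt] half_gt_zero[OF \<epsilon>] by blast
    then obtain d where d: "d > 0" "\<And>y. norm (y - t) < d \<Longrightarrow> norm (f y - f t - D * (y - t)) \<le> \<epsilon> / 2 * norm (y - t)"
      by blast
    obtain k where k: "1 / real (Suc k) < d" using nat_approx_posE[OF d(1)] by blast
    \<comment> \<open>Replacing the derivative by a nearby rational slope takes half of the
      tolerance, the expansion of \<open>f\<close> the other half.\<close>
    obtain q where q: "q \<in> \<rat>" "D < q" "q < D + \<epsilon> / 2"
      using Rats_dense_in_real[of D "D + \<epsilon> / 2"] \<epsilon> by auto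
    have "x + t *\<^sub>R e \<in> directional_approx G e \<epsilon> k q"
      unfolding directional_approx_def
    proof (intro CollectI allI impI)
      fix h :: real assume "\<bar>h\<bar> \<le> 1 / real (Suc k)"
      then have 1: "\<bar>f (t + h) - f t - D * h\<bar> \<le> \<epsilon> / 2 * \<bar>h\<bar>" using d(2)[of "t + h"] k by simp
      have 2: "\<bar>(D - q) * h\<bar> \<le> \<epsilon> / 2 * \<bar>h\<bar>" unfolding abs_mult using q by (intro mult_right_mono) auto
      have "\<bar>f (t + h) - f t - q * h\<bar> = \<bar>(f (t + h) - f t - D * h) + (D - q) * h\<bar>"
        by (simp add: algebra_simps)
      also have "\<dots> \<le> \<bar>f (t + h) - f t - D * h\<bar> + \<bar>(D - q) * h\<bar>" by (rule abs_triangle_ineq)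
      also have "\<dots> \<le> \<epsilon> * \<bar>h\<bar>" using 1 2 by simp
      finally show "\<bar>G (x + t *\<^sub>R e + h *\<^sub>R e) - G (x + t *\<^sub>R e) - q * h\<bar> \<le> \<epsilon> * \<bar>h\<bar>"
        by (simp add: f_def scaleR_add_left add.assoc)
    qed
    then show False using t(1) q(1) by auto
  qed
  ultimately show "negligible {t. x + t *\<^sub>R e \<in> ?N}" using negligible_subset by blast
qed

text \<open>Every corner of the coordinate path from \<open>x\<close> to \<open>x + h\<close> is close to a point of \<open>A\<close>, where the next
  coordinate increment of \<open>G\<close> is under control.\<close>

lemma linear_approx_at_nonporous_point:
  fixes G :: "'a::euclidean_space \<Rightarrow> real"
  assumes G: "L-lipschitz_on UNIV G" and \<epsilon>: "0 < \<epsilon>"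
    and A: "\<And>y. y \<in> A \<Longrightarrow> \<forall>e\<in>Basis. y \<in> directional_approx G e \<epsilon> k (q e)"
    and x: "x \<in> A" "x \<notin> porosity_points A \<epsilon>"
  shows "\<exists>d>0. \<forall>h. norm h < d \<longrightarrow>
     \<bar>G (x + h) - G x - (\<Sum>e\<in>Basis. q e *\<^sub>R e) \<bullet> h\<bar> \<le> real DIM('a) * ((2 * L + 1) * \<epsilon>) * norm h"
proof -
  have L: "\<bar>G y - G z\<bar> \<le> L * norm (y - z)" for y z
    using lipschitz_onD[OF G, of y z] by (simp add: dist_norm)
  have L0: "0 \<le> L" using G lipschitz_on_nonneg by blast
  obtain d where d: "d > 0" "\<And>h. \<lbrakk>h \<noteq> 0; norm h < d\<rbrakk> \<Longrightarrow> A \<inter> ball (x + h) (\<epsilon> * norm h) \<noteq> {}"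
    using x unfolding porosity_points_def by blast
  show ?thesis
  proof (intro exI[of _ "min d (1 / real (Suc k))"] conjI allI impI)
    fix h :: 'a assume h: "norm h < min d (1 / real (Suc k))"
    define hF where "hF F = (\<Sum>e\<in>F. (h \<bullet> e) *\<^sub>R e)" for F
    have main: "\<bar>G (x + hF F) - G x - (\<Sum>e\<in>F. q e * (h \<bullet> e))\<bar> \<le> real (card F) * ((2 * L + 1) * \<epsilon>) * norm h"
      if "F \<subseteq> Basis" for F
      using finite_subset[OF that finite_Basis] that
    proof (induction F rule: finite_induct)
      case empty
      then show ?case by (simp add: hF_def)
    next
      case (insert e F)
      have e: "e \<in> Basis" and F: "F \<subseteq> Basis" using insert by auto
      have "norm (hF F) \<le> norm h"
      proof -
        have i: "hF F \<bullet> b = (if b \<in> F then h \<bullet> b else 0)" if "b \<in> Basis" for b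
        proof -
          have "hF F \<bullet> b = (\<Sum>e\<in>F. (h \<bullet> e) * (e \<bullet> b))" by (simp add: hF_def inner_sum_left)
          also have "\<dots> = (\<Sum>e\<in>F. if e = b then h \<bullet> b else 0)"
            using F that by (intro sum.cong) (auto simp: inner_Basis subset_iff)
          also have "\<dots> = (if b \<in> F then h \<bullet> b else 0)" using insert(1) by simp
          finally show ?thesis .
        qed
        show ?thesis by (rule norm_le_componentwise) (simp add: i)
      qed
      \<comment> \<open>Non-porosity says nothing about a zero displacement, but then the corner is
        \<open>x\<close> itself, which lies in \<open>A\<close>.\<close>
      obtain x' where x': "x' \<in> A" "norm (x' - (x + hF F)) \<le> \<epsilon> * norm h"
      proof (cases "hF F = 0")
        case True
        show ?thesis by (rule that[of x]) (use x \<epsilon> True in auto)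
      next
        case False
        moreover have "norm (hF F) < d" using h \<open>norm (hF F) \<le> norm h\<close> by simp
        ultimately obtain x' where "x' \<in> A" "dist (x + hF F) x' < \<epsilon> * norm (hF F)"
          using d(2)[of "hF F"] by auto
        moreover have "\<epsilon> * norm (hF F) \<le> \<epsilon> * norm h"
          using \<open>norm (hF F) \<le> norm h\<close> \<epsilon> by simp
        ultimately show ?thesis by (intro that[of x']) (auto simp: dist_norm norm_minus_commute)
      qed
      define s where "s = h \<bullet> e"
      have s: "\<bar>s\<bar> \<le> norm h" using Basis_le_norm[OF e] by (simp add: s_def)
      have "x' \<in> directional_approx G e \<epsilon> k (q e)" using A[OF x'(1)] e by blast
      then have 1: "\<bar>G (x' + s *\<^sub>R e) - G x' - q e * s\<bar> \<le> \<epsilon> * \<bar>s\<bar>"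
        using s h unfolding directional_approx_def by force
      have 2: "\<bar>G (x + hF (insert e F)) - G (x' + s *\<^sub>R e)\<bar> \<le> L * (\<epsilon> * norm h)"
      proof -
        have "x + hF (insert e F) - (x' + s *\<^sub>R e) = - (x' - (x + hF F))"
          using insert(1,2) by (simp add: hF_def s_def)
        then show ?thesis
          using L[of "x + hF (insert e F)" "x' + s *\<^sub>R e"] x'(2) L0
          by (smt (verit) mult_left_mono norm_minus_cancel)
      qed
      have 3: "\<bar>G x' - G (x + hF F)\<bar> \<le> L * (\<epsilon> * norm h)"
        using L[of x' "x + hF F"] x'(2) L0 by (smt (verit) mult_left_mono)
      have 4: "\<epsilon> * \<bar>s\<bar> \<le> \<epsilon> * norm h" using s \<epsilon> by simp
      have IH: "\<bar>G (x + hF F) - G x - (\<Sum>e\<in>F. q e * (h \<bullet> e))\<bar> \<le> real (card F) * ((2 * L + 1) * \<epsilon>) * norm h"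
        using insert(3) F by simp
      have sum: "(\<Sum>e\<in>insert e F. q e * (h \<bullet> e)) = q e * s + (\<Sum>e\<in>F. q e * (h \<bullet> e))"
        using insert(1,2) by (simp add: s_def)
      \<comment> \<open>Going from the corner to \<open>x'\<close> and back costs
        \<open>L * (\<epsilon> * norm h)\<close> each time, the increment along \<open>e\<close>
        costs \<open>\<epsilon> * norm h\<close>; hence the constant \<open>2 * L + 1\<close> per
        coordinate.\<close>
      have "\<bar>G (x + hF (insert e F)) - G x - (\<Sum>e\<in>insert e F. q e * (h \<bullet> e))\<bar>
          \<le> real (card F) * ((2 * L + 1) * \<epsilon>) * norm h + (L * (\<epsilon> * norm h) + L * (\<epsilon> * norm h) + \<epsilon> * norm h)"
        unfolding sum using 1 2 3 4 IH by linarith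
      also have "\<dots> = real (card (insert e F)) * ((2 * L + 1) * \<epsilon>) * norm h"
        using insert(1,2) by (simp add: algebra_simps)
      finally show ?case .
    qed
    have "hF Basis = h" by (simp add: hF_def euclidean_representation)
    moreover have "(\<Sum>e\<in>Basis. q e * (h \<bullet> e)) = (\<Sum>e\<in>Basis. q e *\<^sub>R e) \<bullet> h"
      by (simp add: inner_sum_left inner_commute[of h])
    ultimately show "\<bar>G (x + h) - G x - (\<Sum>e\<in>Basis. q e *\<^sub>R e) \<bullet> h\<bar> \<le> real DIM('a) * ((2 * L + 1) * \<epsilon>) * norm h"
      using main[of Basis] by simp
  qed (use d in auto)
qed

text \<open>The vector \<open>w\<close> may depend on \<open>\<epsilon>\<close>: at a fixed
  tolerance countably many rational slope vectors suffice, and the later expansions ask for no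
  more.\<close>

lemma negligible_not_linear_approx_lipschitz:
  fixes G :: "'a::euclidean_space \<Rightarrow> real"
  assumes G: "L-lipschitz_on UNIV G" and \<epsilon>: "0 < \<epsilon>"
  shows "negligible {x. \<not> (\<exists>w. \<exists>d>0. \<forall>h. norm h < d \<longrightarrow> \<bar>G (x + h) - G x - w \<bullet> h\<bar> \<le> \<epsilon> * norm h)}"
    (is "negligible ?B")
proof -
  define c where "c = real DIM('a) * (2 * L + 1)"
  have L0: "0 \<le> L" using G lipschitz_on_nonneg by blast
  have c: "0 < c" using L0 by (simp add: c_def)
  define \<eta> where "\<eta> = \<epsilon> / c"
  have \<eta>: "0 < \<eta>" using \<epsilon> c by (simp add: \<eta>_def)
  define A where "A k q = {x. \<forall>e\<in>Basis. x \<in> directional_approx G e \<eta> k (q e)}" for k and q :: "'a \<Rightarrow> real"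
  \<comment> \<open>Extensional functions on the finite set \<open>Basis\<close> with rational
    values form a countable family of slope vectors.\<close>
  define Q where "Q = (PiE Basis (\<lambda>_. \<rat>) :: ('a \<Rightarrow> real) set)"
  define N1 where "N1 = (\<Union>e\<in>Basis. - (\<Union>k. \<Union>q\<in>\<rat>. directional_approx G e \<eta> k q))"
  define N2 where "N2 = (\<Union>(k, q)\<in>UNIV \<times> Q. porosity_points (A k q) \<eta>)"
  have "negligible N1" unfolding N1_def
    by (intro negligible_Union finite_imageI finite_Basis)
      (use negligible_not_directional_approx[OF G _ \<eta>] norm_Basis in blast)
  moreover have "countable Q" unfolding Q_def by (intro countable_PiE finite_Basis countable_rat)
  then have "negligible N2" unfolding N2_def
    by (intro negligible_countable_Union countable_image countable_SIGMA)
      (auto intro!: negligible_porosity_points[OF \<eta>])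
  moreover have "?B \<subseteq> N1 \<union> N2"
  proof (rule subsetI, rule ccontr)
    fix x assume x: "x \<in> ?B" "x \<notin> N1 \<union> N2"
    have "\<forall>e\<in>Basis. \<exists>k. \<exists>q\<in>\<rat>. x \<in> directional_approx G e \<eta> k q"
      using x(2) by (auto simp: N1_def)
    then obtain kf qf where kq: "\<And>e. e \<in> Basis \<Longrightarrow> qf e \<in> \<rat> \<and> x \<in> directional_approx G e \<eta> (kf e) (qf e)"
      by metis
    \<comment> \<open>The finest of the scales works for all axes at once.\<close>
    define k where "k = Max (kf ` Basis)"
    define q where "q = restrict qf Basis"
    have "q \<in> Q" using kq by (auto simp: q_def Q_def)
    have "x \<in> A k q"
      unfolding A_def
    proof (intro CollectI ballI)
      fix e :: 'a assume e: "e \<in> Basis"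
      have "kf e \<le> k" using e by (simp add: k_def)
      then have "1 / real (Suc k) \<le> 1 / real (Suc (kf e))" by (simp add: field_simps)
      then show "x \<in> directional_approx G e \<eta> k (q e)"
        using kq[OF e] e unfolding directional_approx_def q_def by fastforce
    qed
    moreover have "x \<notin> porosity_points (A k q) \<eta>"
      using x(2) \<open>q \<in> Q\<close> by (auto simp: N2_def)
    ultimately have "\<exists>d>0. \<forall>h. norm h < d \<longrightarrow>
     \<bar>G (x + h) - G x - (\<Sum>e\<in>Basis. q e *\<^sub>R e) \<bullet> h\<bar> \<le> real DIM('a) * ((2 * L + 1) * \<eta>) * norm h"
      by (intro linear_approx_at_nonporous_point[OF G \<eta>, of "A k q" k]) (auto simp: A_def)
    moreover have "real DIM('a) * ((2 * L + 1) * \<eta>) = \<epsilon>"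
      using L0 by (simp add: \<eta>_def c_def add_nonneg_eq_0_iff)
    ultimately show False using x(1) by auto
  qed
  ultimately show ?thesis using negligible_Un negligible_subset by blast
qed

lemma negligible_not_linear_approx_lipschitz_vector:
  fixes G :: "'a::euclidean_space \<Rightarrow> 'b::euclidean_space"
  assumes G: "\<And>b. b \<in> Basis \<Longrightarrow> L-lipschitz_on UNIV (\<lambda>x. G x \<bullet> b)"
  shows "negligible {x. \<not> (\<forall>\<epsilon>>0. \<exists>T. linear T \<and> (\<exists>d>0. \<forall>h. norm h < d \<longrightarrow> norm (G (x + h) - G x - T h) \<le> \<epsilon> * norm h))}"
    (is "negligible ?B")
proof -
  define N where "N b n = {x. \<not> (\<exists>w. \<exists>d>0. \<forall>h. norm h < d \<longrightarrow>
      \<bar>G (x + h) \<bullet> b - G x \<bullet> b - w \<bullet> h\<bar> \<le> 1 / real (Suc n) * norm h)}" for b n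
  have "negligible (N b n)" if "b \<in> Basis" for b n
    unfolding N_def by (rule negligible_not_linear_approx_lipschitz[OF G[OF that]]) simp
  then have "negligible (\<Union>(b, n)\<in>Basis \<times> UNIV. N b n)"
    by (intro negligible_countable_Union countable_image countable_SIGMA)
      (auto intro: countable_finite)
  moreover have "?B \<subseteq> (\<Union>(b, n)\<in>Basis \<times> UNIV. N b n)"
  proof (rule subsetI, rule ccontr)
    fix x assume x: "x \<in> ?B" "x \<notin> (\<Union>(b, n)\<in>Basis \<times> UNIV. N b n)"
    then obtain \<epsilon> where \<epsilon>: "\<epsilon> > 0"
      and no: "\<not> (\<exists>T. linear T \<and> (\<exists>d>0. \<forall>h. norm h < d \<longrightarrow> norm (G (x + h) - G x - T h) \<le> \<epsilon> * norm h))"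
      by blast
    \<comment> \<open>The norm is bounded by the sum of the components, so each component gets an
      equal share of \<open>\<epsilon>\<close>.\<close>
    obtain n where n: "1 / real (Suc n) < \<epsilon> / real DIM('b)"
      using nat_approx_posE[of "\<epsilon> / real DIM('b)"] \<epsilon> by auto
    have "\<forall>b\<in>Basis. \<exists>w. \<exists>d>0. \<forall>h. norm h < d \<longrightarrow>
        \<bar>G (x + h) \<bullet> b - G x \<bullet> b - w \<bullet> h\<bar> \<le> 1 / real (Suc n) * norm h"
      using x(2) by (auto simp: N_def)
    then obtain w d where wd: "\<And>b. b \<in> Basis \<Longrightarrow> d b > 0 \<and> (\<forall>h. norm h < d b \<longrightarrow>
        \<bar>G (x + h) \<bullet> b - G x \<bullet> b - w b \<bullet> h\<bar> \<le> 1 / real (Suc n) * norm h)"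
      by metis
    define T where "T h = (\<Sum>b\<in>Basis. (w b \<bullet> h) *\<^sub>R b)" for h
    have "linear T" unfolding T_def
      by (intro linear_compose_sum ballI) (auto intro!: linearI simp: inner_add_right scaleR_add_left)
    moreover have "Min (d ` Basis) > 0" using wd by simp
    moreover have "norm (G (x + h) - G x - T h) \<le> \<epsilon> * norm h" if h: "norm h < Min (d ` Basis)" for h
    proof -
      have comp: "\<bar>(G (x + h) - G x - T h) \<bullet> b\<bar> \<le> 1 / real (Suc n) * norm h" if b: "b \<in> Basis" for b
      proof -
        have "T h \<bullet> b = w b \<bullet> h" unfolding T_def using b by simp
        moreover have "norm h < d b" using h b by simp
        ultimately show ?thesis using wd[OF b] by (simp add: inner_diff_left)
      qed
      have "norm (G (x + h) - G x - T h) \<le> (\<Sum>b\<in>Basis. \<bar>(G (x + h) - G x - T h) \<bullet> b\<bar>)"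
        by (rule norm_le_l1)
      also have "\<dots> \<le> (\<Sum>b\<in>(Basis::'b set). 1 / real (Suc n) * norm h)"
        by (rule sum_mono[OF comp])
      also have "\<dots> = (real DIM('b) * (1 / real (Suc n))) * norm h" by simp
      also have "\<dots> \<le> \<epsilon> * norm h"
        using n by (intro mult_right_mono) (auto simp: field_simps)
      finally show ?thesis .
    qed
    ultimately show False using no by blast
  qed
  ultimately show ?thesis using negligible_subset by blast
qed

section \<open>Second-order expansions on contact sets\<close>

text \<open>Contact with a paraboloid from each side, with common slope \<open>p\<close>. The bound
  holds on the whole space and not just near \<open>x\<close>, so that contact points at any
  distance can be compared.\<close>

definition second_order_jet :: "('a::euclidean_space \<Rightarrow> real) \<Rightarrow> real \<Rightarrow> 'a \<Rightarrow> 'a \<Rightarrow> bool" where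
  "second_order_jet f C x p \<longleftrightarrow> (\<forall>y. \<bar>f y - f x - p \<bullet> (y - x)\<bar> \<le> C * (norm (y - x))\<^sup>2)"

text \<open>The linear map may vary with \<open>\<epsilon>\<close> and need not be symmetric: only
  its quadratic form enters, and the theorem on sums uses a single tolerance. Symmetry is restored
  by \<open>symmetric_matrix_of_linear\<close>.\<close>

definition second_order_approx :: "('a::euclidean_space \<Rightarrow> real) \<Rightarrow> 'a \<Rightarrow> 'a \<Rightarrow> bool" where
  "second_order_approx f x p \<longleftrightarrow> (\<forall>\<epsilon>>0. \<exists>T. linear T \<and> (\<exists>d>0. \<forall>h. norm h < d \<longrightarrow>
     \<bar>f (x + h) - f x - p \<bullet> h - T h \<bullet> h / 2\<bar> \<le> \<epsilon> * (norm h)\<^sup>2))"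

text \<open>At \<open>y + k\<close>, with \<open>k\<close> in the direction of \<open>p - q\<close>
  and as long as \<open>y - x\<close>, the lower paraboloid at \<open>x\<close> must stay below the
  upper paraboloid at \<open>y\<close>. This limits how much the slopes can differ.\<close>

lemma second_order_jet_lipschitz:
  assumes x: "second_order_jet f C x p" and y: "second_order_jet f C y q"
    and "x \<noteq> y"
  shows "norm (p - q) \<le> 6 * C * norm (x - y)"
proof (cases "p = q")
  case True
  have "0 \<le> C * (norm (y - x))\<^sup>2"
    using x[unfolded second_order_jet_def, rule_format, of y] by simp
  then have "0 \<le> C" using \<open>x \<noteq> y\<close> by (simp add: zero_le_mult_iff)
  then show ?thesis using True by simp
next
  case False
  define r where "r = norm (y - x)"
  define v where "v = p - q"
  define k where "k = (r / norm v) *\<^sub>R v"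
  have v: "norm v > 0" and r: "r > 0" using False \<open>x \<noteq> y\<close> by (auto simp: v_def r_def)
  have k: "norm k = r" "v \<bullet> k = r * norm v"
    using v r by (auto simp: k_def power2_norm_eq_inner[symmetric] power2_eq_square)
  have C: "0 \<le> C"
  proof -
    have "0 \<le> C * r\<^sup>2"
      using x[unfolded second_order_jet_def, rule_format, of y] by (simp add: r_def)
    then show ?thesis using r by (simp add: zero_le_mult_iff)
  qed
  have 1: "f (y + k) \<ge> f x + p \<bullet> (y + k - x) - C * (norm (y + k - x))\<^sup>2"
    using x[unfolded second_order_jet_def, rule_format, of "y + k"] by (simp add: abs_le_iff)
  have 2: "f (y + k) \<le> f y + q \<bullet> k + C * r\<^sup>2"
    using y[unfolded second_order_jet_def, rule_format, of "y + k"] k by (simp add: abs_le_iff)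
  have 3: "f y \<le> f x + p \<bullet> (y - x) + C * r\<^sup>2"
    using x[unfolded second_order_jet_def, rule_format, of y] by (simp add: abs_le_iff r_def)
  \<comment> \<open>The lower paraboloid is evaluated at distance up to \<open>2 * r\<close>, which
    contributes 4 to the constant 6; the two upper bounds contribute 1 each.\<close>
  have "norm (y + k - x) \<le> 2 * r"
    using norm_triangle_ineq[of "y - x" k] k by (simp add: r_def algebra_simps)
  then have "(norm (y + k - x))\<^sup>2 \<le> (2 * r)\<^sup>2" by (intro power_mono) auto
  then have "C * (norm (y + k - x))\<^sup>2 \<le> C * (4 * r\<^sup>2)" using C by (intro mult_left_mono) auto
  moreover have "p \<bullet> (y + k - x) = p \<bullet> (y - x) + p \<bullet> k" by (simp add: algebra_simps inner_diff_right inner_add_right)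
  moreover have "v \<bullet> k = p \<bullet> k - q \<bullet> k" by (simp add: v_def inner_diff_left)
  ultimately have "v \<bullet> k \<le> 6 * C * r\<^sup>2" using 1 2 3 by simp
  then have "r * norm v \<le> r * (6 * C * r)" using k by (simp add: power2_eq_square algebra_simps)
  then have "norm v \<le> 6 * C * r" using r by simp
  then show ?thesis by (simp add: v_def r_def norm_minus_commute)
qed

text \<open>McShane's extension: the lower envelope of the cones of slope \<open>L\<close> with
  vertices on the graph.\<close>

lemma lipschitz_extension_real:
  fixes g :: "'a::metric_space \<Rightarrow> real"
  assumes g: "L-lipschitz_on E g"
  obtains G where "L-lipschitz_on UNIV G" "\<And>x. x \<in> E \<Longrightarrow> G x = g x"
proof (cases "E = {}")
  case True
  show ?thesis
    by (rule that[of "\<lambda>_. 0"]) (use True g lipschitz_on_nonneg in \<open>auto intro!: lipschitz_onI\<close>)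
next
  case False
  have L: "0 \<le> L" using g lipschitz_on_nonneg by blast
  define G where "G x = (INF e\<in>E. g e + L * dist x e)" for x
  obtain e0 where e0: "e0 \<in> E" using False by blast
  have bdd: "bdd_below ((\<lambda>e. g e + L * dist x e) ` E)" for x
  proof (rule bdd_belowI2)
    fix e assume e: "e \<in> E"
    have "g e0 - g e \<le> L * dist e0 e"
      using lipschitz_onD[OF g e0 e] by (simp add: dist_real_def)
    also have "\<dots> \<le> L * (dist x e0 + dist x e)"
      using L by (intro mult_left_mono) (auto intro: dist_triangle3)
    finally show "g e0 - L * dist x e0 \<le> g e + L * dist x e" by (simp add: algebra_simps)
  qed
  have up: "G x \<le> g e + L * dist x e" if "e \<in> E" for x e
    unfolding G_def by (rule cINF_lower[OF bdd that])
  have half: "G x \<le> G y + L * dist x y" for x y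
  proof -
    have "G x - L * dist x y \<le> g e + L * dist y e" if "e \<in> E" for e
    proof -
      have "L * dist x e \<le> L * (dist x y + dist y e)"
        using L by (intro mult_left_mono dist_triangle) auto
      then show ?thesis using up[OF that, of x] by (simp add: algebra_simps)
    qed
    then have "G x - L * dist x y \<le> G y"
      unfolding G_def[of y] using False by (intro cINF_greatest) auto
    then show ?thesis by simp
  qed
  show ?thesis
  proof (rule that[of G])
    show "L-lipschitz_on UNIV G"
    proof (rule lipschitz_onI)
      fix x y
      show "dist (G x) (G y) \<le> L * dist x y"
        using half[of x y] half[of y x] by (simp add: dist_real_def dist_commute abs_le_iff)
    qed (rule L)
    fix x assume x: "x \<in> E"
    show "G x = g x"
    proof (rule antisym)
      show "G x \<le> g x" using up[OF x, of x] by simp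
      show "g x \<le> G x" unfolding G_def
      proof (rule cINF_greatest[OF False])
        fix e assume "e \<in> E"
        then show "g x \<le> g e + L * dist x e"
          using lipschitz_onD[OF g x, of e] by (simp add: dist_real_def abs_le_iff)
      qed
    qed
  qed
qed

text \<open>A chain of contact points close to the segment from \<open>x\<close> to \<open>x + h\<close> turns the first-order
  expansion of \<open>g\<close> along the contact set into a second-order expansion of \<open>f\<close>, by a Riemann sum.\<close>

lemma second_order_expansion_along_chain:
  fixes f :: "'a::euclidean_space \<Rightarrow> real" and N :: nat
  assumes jet: "\<And>y. y \<in> E \<Longrightarrow> second_order_jet f C y (g y)"
    and C: "0 \<le> C" and K: "0 \<le> K" and N: "0 < N" and \<epsilon>1: "0 \<le> \<epsilon>1"
    and \<epsilon>2: "0 < \<epsilon>2" "\<epsilon>2 \<le> 1 / (2 * (real N)\<^sup>2)"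
    and T: "linear T" "\<And>z. norm (T z) \<le> K * norm z"
    and e: "\<And>i. i \<le> N \<Longrightarrow> e i \<in> E" "e 0 = x"
      "\<And>i. i \<le> N \<Longrightarrow> norm (e i - x - (real i / real N) *\<^sub>R h) \<le> \<epsilon>2 * norm h"
    and lin: "\<And>i. i \<le> N \<Longrightarrow> norm (g (e i) - g x - T (e i - x)) \<le> \<epsilon>1 * norm (e i - x)"
    and lip: "norm (g (e N) - g x) \<le> K * norm (e N - x)"
  shows "\<bar>f (x + h) - f x - g x \<bullet> h - T h \<bullet> h / 2\<bar> \<le> (4 * \<epsilon>1 + (5 * C + 4 * K) / real N) * (norm h)\<^sup>2"
proof -
  define n where "n = norm h"
  define r where "r i = e i - x" for i
  define \<tau> where "\<tau> = T h \<bullet> h"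
  have N1: "1 \<le> real N" using N by simp
  have sq: "1 / (2 * (real N)\<^sup>2) \<le> 1 / (2 * real N)"
    using N1 by (simp add: power2_eq_square divide_simps)
  have \<epsilon>2': "\<epsilon>2 \<le> 1 / (2 * real N)" "\<epsilon>2 \<le> 1"
  proof -
    show "\<epsilon>2 \<le> 1 / (2 * real N)" using \<epsilon>2(2) sq by linarith
    moreover have "1 / (2 * real N) \<le> 1" using N1 by (simp add: divide_simps)
    ultimately show "\<epsilon>2 \<le> 1" by linarith
  qed
  have n0: "0 \<le> n" by (simp add: n_def)
  have rb: "norm (r i) \<le> 2 * n" if i: "i \<le> N" for i
  proof -
    have "norm (r i) \<le> norm (r i - (real i / real N) *\<^sub>R h) + norm ((real i / real N) *\<^sub>R h)"
      using norm_triangle_sub by (metis add.commute)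
    also have "\<dots> \<le> \<epsilon>2 * n + (real i / real N) * n"
      using e(3)[OF i] by (simp add: r_def n_def)
    also have "\<dots> \<le> 1 * n + 1 * n"
      using i N \<epsilon>2'(2) n0 by (intro add_mono mult_right_mono) auto
    finally show ?thesis by simp
  qed
  \<comment> \<open>The gradient at \<open>e i\<close> is nearly \<open>g x + T (e i - x)\<close>,
    the position nearly \<open>i / N\<close> and the increment nearly \<open>1 / N\<close> times
    \<open>h\<close>. The errors come from the expansion of \<open>g\<close>, from the paraboloids,
    and from the displacement of the chain.\<close>
  have step: "\<bar>f (e (Suc i)) - f (e i) - g x \<bullet> (r (Suc i) - r i) - (real i / (real N)\<^sup>2) * \<tau>\<bar>
      \<le> (4 * \<epsilon>1 / real N + 4 * C / (real N)\<^sup>2 + 4 * K * \<epsilon>2) * n\<^sup>2" if i: "i < N" for i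
  proof -
    define D where "D = r (Suc i) - r i"
    define s where "s = (real i / real N) *\<^sub>R h"
    define h' where "h' = (1 / real N) *\<^sub>R h"
    have s': "(real (Suc i) / real N) *\<^sub>R h = s + h'"
      by (simp add: s_def h'_def scaleR_add_left[symmetric] add_divide_distrib add.commute)
    have rs: "norm (r i - s) \<le> \<epsilon>2 * n" using e(3)[of i] i by (simp add: r_def s_def n_def)
    have "norm (r (Suc i) - (s + h')) \<le> \<epsilon>2 * n"
      using e(3)[of "Suc i"] i unfolding s' by (simp add: r_def n_def)
    moreover have "norm (D - h') \<le> norm (r (Suc i) - (s + h')) + norm (r i - s)"
    proof -
      have "D - h' = (r (Suc i) - (s + h')) - (r i - s)" by (simp add: D_def)
      then show ?thesis by (metis norm_triangle_ineq4)
    qed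
    ultimately have Dh: "norm (D - h') \<le> 2 * \<epsilon>2 * n" using rs by simp
    have h'n: "norm h' = n / real N" by (simp add: h'_def n_def)
    have Dn: "norm D \<le> 2 * n / real N"
    proof -
      have "2 * \<epsilon>2 * n \<le> (1 / real N) * n"
        using \<epsilon>2'(1) n0 by (intro mult_right_mono) (auto simp: field_simps)
      then show ?thesis using norm_triangle_ineq[of "D - h'" h'] Dh h'n by simp
    qed
    have "real i / real N \<le> 1" using i N by simp
    then have sn: "norm s \<le> n" using n0 mult_right_mono[of "real i / real N" 1 n] by (simp add: s_def n_def)
    have 1: "\<bar>f (e (Suc i)) - f (e i) - g (e i) \<bullet> D\<bar> \<le> C * (norm D)\<^sup>2"
      using jet[OF e(1)[of i]] i by (simp add: second_order_jet_def D_def r_def)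
    have "C * (norm D)\<^sup>2 \<le> C * (2 * n / real N)\<^sup>2"
      using C Dn by (intro mult_left_mono power_mono) auto
    also have "\<dots> = 4 * C / (real N)\<^sup>2 * n\<^sup>2" by (simp add: power_divide power_mult_distrib)
    finally have nD: "C * (norm D)\<^sup>2 \<le> 4 * C / (real N)\<^sup>2 * n\<^sup>2" .
    have "\<bar>(g (e i) - g x - T (r i)) \<bullet> D\<bar> \<le> norm (g (e i) - g x - T (r i)) * norm D"
      by (rule Cauchy_Schwarz_ineq2)
    also have "\<dots> \<le> (\<epsilon>1 * (2 * n)) * (2 * n / real N)"
    proof (intro mult_mono Dn)
      have "norm (g (e i) - g x - T (r i)) \<le> \<epsilon>1 * norm (r i)" using lin[of i] i by (simp add: r_def)
      also have "\<dots> \<le> \<epsilon>1 * (2 * n)" using rb[of i] i \<epsilon>1 by (intro mult_left_mono) auto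
      finally show "norm (g (e i) - g x - T (r i)) \<le> \<epsilon>1 * (2 * n)" .
    qed (use \<epsilon>1 n0 in auto)
    also have "\<dots> = 4 * \<epsilon>1 / real N * n\<^sup>2" by (simp add: power2_eq_square)
    finally have 2: "\<bar>(g (e i) - g x - T (r i)) \<bullet> D\<bar> \<le> 4 * \<epsilon>1 / real N * n\<^sup>2" .
    have "T (r i) \<bullet> D - T s \<bullet> h' = T (r i - s) \<bullet> D + T s \<bullet> (D - h')"
      by (simp add: linear_diff[OF T(1)] inner_diff_left inner_diff_right)
    also have "\<bar>\<dots>\<bar> \<le> norm (T (r i - s)) * norm D + norm (T s) * norm (D - h')"
      by (meson Cauchy_Schwarz_ineq2 abs_triangle_ineq add_mono order_trans)
    also have "\<dots> \<le> (K * (\<epsilon>2 * n)) * (2 * n) + (K * n) * (2 * \<epsilon>2 * n)"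
    proof (intro add_mono mult_mono Dh)
      show "norm (T (r i - s)) \<le> K * (\<epsilon>2 * n)"
        using T(2)[of "r i - s"] rs K by (meson mult_left_mono order_trans)
      show "norm (T s) \<le> K * n" using T(2)[of s] sn K by (meson mult_left_mono order_trans)
      have "2 * n / real N \<le> 2 * n" using N1 n0 mult_left_mono[OF N1 n0] by (simp add: divide_simps)
      then show "norm D \<le> 2 * n" using Dn by linarith
    qed (use K \<epsilon>2 n0 in auto)
    also have "\<dots> = 4 * K * \<epsilon>2 * n\<^sup>2" by (simp add: power2_eq_square)
    finally have 3: "\<bar>T (r i) \<bullet> D - T s \<bullet> h'\<bar> \<le> 4 * K * \<epsilon>2 * n\<^sup>2" .
    have 4: "T s \<bullet> h' = (real i / (real N)\<^sup>2) * \<tau>"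
      by (simp add: s_def h'_def \<tau>_def linear_cmul[OF T(1)] power2_eq_square)
    have "f (e (Suc i)) - f (e i) - g x \<bullet> D - (real i / (real N)\<^sup>2) * \<tau>
       = (f (e (Suc i)) - f (e i) - g (e i) \<bullet> D) + (g (e i) - g x - T (r i)) \<bullet> D + (T (r i) \<bullet> D - T s \<bullet> h')"
      by (simp add: 4 inner_diff_left)
    moreover have "\<bar>a + b + c\<bar> \<le> A + B + C'" if "\<bar>a\<bar> \<le> A" "\<bar>b\<bar> \<le> B" "\<bar>c\<bar> \<le> C'" for a b c A B C' :: real
      using that by linarith
    note this[OF order_trans[OF 1 nD] 2 3]
    ultimately have "\<bar>f (e (Suc i)) - f (e i) - g x \<bullet> D - (real i / (real N)\<^sup>2) * \<tau>\<bar>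
       \<le> 4 * C / (real N)\<^sup>2 * n\<^sup>2 + 4 * \<epsilon>1 / real N * n\<^sup>2 + 4 * K * \<epsilon>2 * n\<^sup>2"
      by simp
    then show ?thesis by (simp add: D_def algebra_simps)
  qed
  define \<eta> where "\<eta> = (4 * \<epsilon>1 / real N + 4 * C / (real N)\<^sup>2 + 4 * K * \<epsilon>2) * n\<^sup>2"
  have chain: "\<bar>f (e j) - f x - g x \<bullet> r j - (\<Sum>i<j. real i / (real N)\<^sup>2) * \<tau>\<bar> \<le> real j * \<eta>" if "j \<le> N" for j
    using that
  proof (induction j)
    case 0
    then show ?case using e(2) by (simp add: r_def)
  next
    case (Suc j)
    have "f (e (Suc j)) - f x - g x \<bullet> r (Suc j) - (\<Sum>i<Suc j. real i / (real N)\<^sup>2) * \<tau>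
      = (f (e j) - f x - g x \<bullet> r j - (\<Sum>i<j. real i / (real N)\<^sup>2) * \<tau>)
        + (f (e (Suc j)) - f (e j) - g x \<bullet> (r (Suc j) - r j) - (real j / (real N)\<^sup>2) * \<tau>)"
      by (simp add: inner_diff_right algebra_simps)
    then show ?case using Suc.IH Suc.prems step[of j, folded \<eta>_def] by (simp add: algebra_simps)
  qed
  \<comment> \<open>A left Riemann sum for the integral of the identity over the unit interval: it
    misses 1/2 by \<open>1 / (2 * real N)\<close>, which joins the errors.\<close>
  have sum: "(\<Sum>i<N. real i / (real N)\<^sup>2) = 1 / 2 - 1 / (2 * real N)"
  proof -
    have gauss: "(\<Sum>i<k. real i) = real k * (real k - 1) / 2" for k
      by (induction k) (auto simp: field_simps)
    have "(\<Sum>i<N. real i / (real N)\<^sup>2) = (real N * (real N - 1) / 2) / (real N)\<^sup>2"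
      by (simp only: sum_divide_distrib[symmetric] gauss)
    also have "\<dots> = 1 / 2 - 1 / (2 * real N)" using N by (simp add: power2_eq_square field_simps)
    finally show ?thesis .
  qed
  have A: "\<bar>f (e N) - f x - g x \<bullet> r N - (1 / 2 - 1 / (2 * real N)) * \<tau>\<bar> \<le> real N * \<eta>"
    using chain[of N] unfolding sum by simp
  have \<tau>b: "\<bar>\<tau>\<bar> \<le> K * n\<^sup>2"
  proof -
    have "\<bar>\<tau>\<bar> \<le> norm (T h) * norm h" unfolding \<tau>_def by (rule Cauchy_Schwarz_ineq2)
    also have "\<dots> \<le> (K * norm h) * norm h" by (intro mult_right_mono T(2)) auto
    finally show ?thesis by (simp add: n_def power2_eq_square)
  qed
  \<comment> \<open>The chain ends at \<open>e N\<close>, only near \<open>x + h\<close>; the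
    paraboloids at \<open>e N\<close> bridge the remaining gap.\<close>
  have eNh: "norm (h - r N) \<le> \<epsilon>2 * n"
    using e(3)[of N] N by (simp add: r_def n_def norm_minus_commute)
  have B1: "\<bar>f (x + h) - f (e N) - g (e N) \<bullet> (h - r N)\<bar> \<le> C * (\<epsilon>2 * n)\<^sup>2"
  proof -
    have "\<bar>f (x + h) - f (e N) - g (e N) \<bullet> (h - r N)\<bar> \<le> C * (norm (h - r N))\<^sup>2"
      using jet[OF e(1)[of N], unfolded second_order_jet_def, rule_format, of "x + h"]
      by (simp add: r_def algebra_simps)
    also have "\<dots> \<le> C * (\<epsilon>2 * n)\<^sup>2" using C eNh by (intro mult_left_mono power_mono) auto
    finally show ?thesis .
  qed
  have B2: "\<bar>(g (e N) - g x) \<bullet> (h - r N)\<bar> \<le> 2 * K * \<epsilon>2 * n\<^sup>2"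
  proof -
    have "\<bar>(g (e N) - g x) \<bullet> (h - r N)\<bar> \<le> norm (g (e N) - g x) * norm (h - r N)"
      by (rule Cauchy_Schwarz_ineq2)
    also have "\<dots> \<le> (K * (2 * n)) * (\<epsilon>2 * n)"
    proof (intro mult_mono eNh)
      show "norm (g (e N) - g x) \<le> K * (2 * n)"
        using lip rb[of N] K unfolding r_def by (meson mult_left_mono order_refl order_trans)
    qed (use K n0 in auto)
    finally show ?thesis by (simp add: power2_eq_square mult_ac)
  qed
  have eq: "f (x + h) - f x - g x \<bullet> h - \<tau> / 2 =
     (f (e N) - f x - g x \<bullet> r N - (1 / 2 - 1 / (2 * real N)) * \<tau>)
     + (f (x + h) - f (e N) - g (e N) \<bullet> (h - r N)) + (g (e N) - g x) \<bullet> (h - r N) - \<tau> / (2 * real N)"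
    by (simp add: inner_diff_left inner_diff_right algebra_simps)
  have \<tau>N: "\<bar>\<tau> / (2 * real N)\<bar> \<le> K / (2 * real N) * n\<^sup>2"
    using \<tau>b N1 by (simp add: abs_divide divide_right_mono)
  have "\<bar>f (x + h) - f x - g x \<bullet> h - \<tau> / 2\<bar>
      \<le> real N * \<eta> + C * (\<epsilon>2 * n)\<^sup>2 + 2 * K * \<epsilon>2 * n\<^sup>2 + K / (2 * real N) * n\<^sup>2"
  proof -
    have "\<bar>a + b + c - d\<bar> \<le> A + B + C' + D" if "\<bar>a\<bar> \<le> A" "\<bar>b\<bar> \<le> B" "\<bar>c\<bar> \<le> C'" "\<bar>d\<bar> \<le> D" for a b c d A B C' D :: real
      using that by linarith
    from this[OF A B1 B2 \<tau>N] show ?thesis unfolding eq .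
  qed
  also have "\<dots> = (real N * (4 * \<epsilon>1 / real N + 4 * C / (real N)\<^sup>2 + 4 * K * \<epsilon>2) + C * \<epsilon>2\<^sup>2 + 2 * K * \<epsilon>2 + K / (2 * real N)) * n\<^sup>2"
    by (simp add: \<eta>_def algebra_simps power_mult_distrib)
  also have "\<dots> \<le> (4 * \<epsilon>1 + (5 * C + 4 * K) / real N) * n\<^sup>2"
  proof (rule mult_right_mono)
    have a: "real N * (4 * \<epsilon>1 / real N + 4 * C / (real N)\<^sup>2 + 4 * K * \<epsilon>2)
       = 4 * \<epsilon>1 + 4 * C / real N + real N * (4 * K * \<epsilon>2)"
      using N1 by (simp add: field_simps power2_eq_square)
    \<comment> \<open>Here the bound of \<open>\<epsilon>2\<close> by the inverse square of
      \<open>N\<close> is spent: the displacement errors of \<open>N\<close> steps must add up to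
      order \<open>1 / N\<close>.\<close>
    have "real N * (4 * K * \<epsilon>2) \<le> real N * (4 * K * (1 / (2 * (real N)\<^sup>2)))"
      using \<epsilon>2 K by (intro mult_left_mono) auto
    also have "\<dots> = 2 * K / real N" using N1 by (simp add: field_simps power2_eq_square)
    finally have b: "real N * (4 * K * \<epsilon>2) \<le> 2 * K / real N" .
    have "\<epsilon>2\<^sup>2 \<le> \<epsilon>2" using \<epsilon>2'(2) \<epsilon>2(1) by (simp add: power2_eq_square mult_left_le)
    then have "\<epsilon>2\<^sup>2 \<le> 1 / real N" using \<epsilon>2'(1) N1 by (smt (verit) frac_le)
    then have c: "C * \<epsilon>2\<^sup>2 \<le> C / real N" using C mult_left_mono[of "\<epsilon>2\<^sup>2" "1 / real N" C] by simp
    have d: "2 * K * \<epsilon>2 \<le> K / real N"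
      using mult_left_mono[OF \<epsilon>2'(1), of "2 * K"] K by simp
    have e': "K / (2 * real N) \<le> K / real N" using K N1 by (intro frac_le) auto
    have "(5 * C + 4 * K) / real N = 4 * C / real N + 2 * K / real N + C / real N + K / real N + K / real N"
      by (simp add: add_divide_distrib[symmetric])
    then show "real N * (4 * \<epsilon>1 / real N + 4 * C / (real N)\<^sup>2 + 4 * K * \<epsilon>2) + C * \<epsilon>2\<^sup>2 + 2 * K * \<epsilon>2 + K / (2 * real N)
       \<le> 4 * \<epsilon>1 + (5 * C + 4 * K) / real N"
      using a b c d e' by linarith
  qed simp
  finally show ?thesis by (simp add: n_def \<tau>_def)
qed

text \<open>On \<open>E\<close> the paraboloids make \<open>g\<close> Lipschitz. Its extension has
  first-order expansions almost everywhere, but these concern \<open>f\<close> only at points of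
  \<open>E\<close>; away from porosity points there are enough of those to build a chain towards
  every small \<open>h\<close>.\<close>

lemma negligible_second_order_jet_not_approx:
  fixes f :: "'a::euclidean_space \<Rightarrow> real"
  assumes jet: "\<And>y. y \<in> E \<Longrightarrow> second_order_jet f C y (g y)"
  shows "negligible {x\<in>E. \<not> second_order_approx f x (g x)}"
proof (cases "E = {}")
  case False
  then obtain y0 where y0: "y0 \<in> E" by blast
  have C: "0 \<le> C"
  proof -
    obtain b :: 'a where b: "b \<in> Basis" by fastforce
    show ?thesis
      using jet[OF y0, unfolded second_order_jet_def, rule_format, of "y0 + b"] b by simp
  qed
  have gL: "norm (g x - g y) \<le> 6 * C * norm (x - y)" if "x \<in> E" "y \<in> E" for x y
    using second_order_jet_lipschitz[OF jet[OF that(1)] jet[OF that(2)]] by (cases "x = y") auto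
  have "\<exists>Gb. (6 * C)-lipschitz_on UNIV Gb \<and> (\<forall>x\<in>E. Gb x = g x \<bullet> b)" if b: "b \<in> Basis" for b
  proof -
    have "(6 * C)-lipschitz_on E (\<lambda>x. g x \<bullet> b)"
    proof (rule lipschitz_onI)
      fix x y assume xy: "x \<in> E" "y \<in> E"
      have "\<bar>(g x - g y) \<bullet> b\<bar> \<le> norm (g x - g y)" by (rule Basis_le_norm[OF b])
      then show "dist (g x \<bullet> b) (g y \<bullet> b) \<le> 6 * C * dist x y"
        using gL[OF xy] by (simp add: dist_norm inner_diff_left)
    qed (use C in simp)
    then show ?thesis using lipschitz_extension_real by metis
  qed
  then obtain Gc where Gc: "\<And>b. b \<in> Basis \<Longrightarrow> (6 * C)-lipschitz_on UNIV (Gc b)"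
    "\<And>b x. \<lbrakk>b \<in> Basis; x \<in> E\<rbrakk> \<Longrightarrow> Gc b x = g x \<bullet> b"
    by metis
  define G where "G x = (\<Sum>b\<in>Basis. Gc b x *\<^sub>R b)" for x
  have Gb: "G x \<bullet> b = Gc b x" if "b \<in> Basis" for x b using that by (simp add: G_def)
  have Gg: "G x = g x" if "x \<in> E" for x
    using Gc(2) that by (simp add: euclidean_eq_iff[of "G x"] Gb)
  define \<Lambda> where "\<Lambda> = real DIM('a) * (6 * C)"
  have GL: "norm (G x - G y) \<le> \<Lambda> * norm (x - y)" for x y
  proof -
    have "norm (G x - G y) \<le> (\<Sum>b\<in>Basis. \<bar>(G x - G y) \<bullet> b\<bar>)" by (rule norm_le_l1)
    also have "\<dots> \<le> (\<Sum>b\<in>(Basis::'a set). 6 * C * norm (x - y))"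
    proof (rule sum_mono)
      fix b :: 'a assume b: "b \<in> Basis"
      show "\<bar>(G x - G y) \<bullet> b\<bar> \<le> 6 * C * norm (x - y)"
        using lipschitz_onD[OF Gc(1)[OF b], of x y] b by (simp add: inner_diff_left Gb dist_norm)
    qed
    finally show ?thesis by (simp add: \<Lambda>_def)
  qed
  \<comment> \<open>One constant for two bounds: \<open>\<Lambda>\<close> is a Lipschitz constant of
    \<open>G\<close>, and the additional 1 covers \<open>T\<close>, which differs from the
    increments of \<open>G\<close> by at most \<open>\<epsilon>1 \<le> 1\<close> times the
    step.\<close>
  define K where "K = \<Lambda> + 1"
  have K: "0 \<le> K" using C by (simp add: K_def \<Lambda>_def)
  define N1 where "N1 = {x. \<not> (\<forall>\<epsilon>>0. \<exists>T. linear T \<and> (\<exists>d>0. \<forall>h. norm h < d \<longrightarrow> norm (G (x + h) - G x - T h) \<le> \<epsilon> * norm h))}"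
  define N2 where "N2 = (\<Union>n. porosity_points E (1 / real (Suc n)))"
  have "negligible N1" unfolding N1_def
  proof (rule negligible_not_linear_approx_lipschitz_vector)
    fix b :: 'a assume "b \<in> Basis"
    then show "(6 * C)-lipschitz_on UNIV (\<lambda>x. G x \<bullet> b)" using Gc(1)[of b] by (simp add: Gb)
  qed
  moreover have "negligible N2" unfolding N2_def
    by (intro negligible_countable_Union) (auto intro!: negligible_porosity_points)
  moreover have "second_order_approx f x (g x)" if x: "x \<in> E" "x \<notin> N1" "x \<notin> N2" for x
    unfolding second_order_approx_def
  proof (intro allI impI)
    fix \<epsilon> :: real assume \<epsilon>: "0 < \<epsilon>"
    \<comment> \<open>The term \<open>4 * \<epsilon>1\<close> takes half of
      \<open>\<epsilon>\<close>, the term of order \<open>1 / N\<close> the other half.\<close>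
    define \<epsilon>1 where "\<epsilon>1 = min 1 (\<epsilon> / 8)"
    have \<epsilon>1: "0 < \<epsilon>1" "\<epsilon>1 \<le> 1" "\<epsilon>1 \<le> \<epsilon> / 8" using \<epsilon> by (auto simp: \<epsilon>1_def)
    obtain N0 :: nat where N0: "2 * (5 * C + 4 * K) / \<epsilon> < real N0" using reals_Archimedean2 by blast
    define N where "N = Suc N0"
    have N: "0 < N" "2 * (5 * C + 4 * K) / \<epsilon> \<le> real N" using N0 by (auto simp: N_def)
    \<comment> \<open>The reciprocal of an integer, so that the countable union \<open>N2\<close>
      excludes porosity with exactly this constant.\<close>
    define \<epsilon>2 where "\<epsilon>2 = 1 / real (Suc (2 * N\<^sup>2))"
    have \<epsilon>2: "0 < \<epsilon>2" "\<epsilon>2 \<le> 1 / (2 * (real N)\<^sup>2)" "\<epsilon>2 \<le> 1"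
    proof -
      have "0 < 2 * (real N)\<^sup>2" using N(1) by simp
      then show "0 < \<epsilon>2" "\<epsilon>2 \<le> 1 / (2 * (real N)\<^sup>2)" "\<epsilon>2 \<le> 1"
        unfolding \<epsilon>2_def by (auto intro!: divide_left_mono mult_pos_pos simp: field_simps add_pos_pos)
    qed
    obtain T d1 where T: "linear T" and d1: "d1 > 0"
      "\<And>h. norm h < d1 \<Longrightarrow> norm (G (x + h) - G x - T h) \<le> \<epsilon>1 * norm h"
      using x(2) \<epsilon>1(1) unfolding N1_def by blast
    have TK: "norm (T z) \<le> K * norm z" for z
    proof (cases "z = 0")
      case False
      define c where "c = d1 / (2 * norm z)"
      have c: "c > 0" using d1(1) False by (simp add: c_def)
      have cz: "norm (c *\<^sub>R z) < d1" using d1(1) False by (simp add: c_def)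
      have "norm (T (c *\<^sub>R z)) \<le> norm (G (x + c *\<^sub>R z) - G x) + norm (G (x + c *\<^sub>R z) - G x - T (c *\<^sub>R z))"
        using norm_triangle_ineq4[of "G (x + c *\<^sub>R z) - G x" "G (x + c *\<^sub>R z) - G x - T (c *\<^sub>R z)"] by simp
      also have "\<dots> \<le> \<Lambda> * norm (c *\<^sub>R z) + \<epsilon>1 * norm (c *\<^sub>R z)"
        using GL[of "x + c *\<^sub>R z" x] d1(2)[OF cz] by (intro add_mono) auto
      also have "\<dots> \<le> K * norm (c *\<^sub>R z)"
        using mult_right_mono[OF \<epsilon>1(2), of "norm (c *\<^sub>R z)"] by (simp add: K_def distrib_right)
      finally show ?thesis using c by (simp add: linear_cmul[OF T])
    qed (simp add: linear_0[OF T])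
    have "x \<notin> porosity_points E \<epsilon>2" using x(3) unfolding N2_def \<epsilon>2_def by blast
    then obtain d2 where d2: "d2 > 0" "\<And>h. \<lbrakk>h \<noteq> 0; norm h < d2\<rbrakk> \<Longrightarrow> E \<inter> ball (x + h) (\<epsilon>2 * norm h) \<noteq> {}"
      using x(1) unfolding porosity_points_def by blast
    \<comment> \<open>The chain stays within \<open>2 * norm h\<close> of \<open>x\<close>, so the
      factor 1/3 keeps it in the range of the expansion of \<open>G\<close>.\<close>
    have "\<bar>f (x + h) - f x - g x \<bullet> h - T h \<bullet> h / 2\<bar> \<le> \<epsilon> * (norm h)\<^sup>2" if h: "norm h < min (d1 / 3) d2" for h
    proof -
      have "\<exists>y. y \<in> E \<and> (i = 0 \<longrightarrow> y = x) \<and> norm (y - x - (real i / real N) *\<^sub>R h) \<le> \<epsilon>2 * norm h" if i: "i \<le> N" for i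
      proof (cases "i = 0 \<or> h = 0")
        case True
        then show ?thesis using x(1) \<epsilon>2 by (intro exI[of _ x]) auto
      next
        case False
        let ?k = "(real i / real N) *\<^sub>R h"
        have "real i / real N \<le> 1" using i N(1) by simp
        then have kh: "norm ?k \<le> norm h" using mult_right_mono[of "real i / real N" 1 "norm h"] by simp
        have "?k \<noteq> 0" using False N(1) by simp
        moreover have "norm ?k < d2" using kh h by simp
        ultimately obtain y where y: "y \<in> E" "dist (x + ?k) y < \<epsilon>2 * norm ?k"
          using d2(2)[of ?k] by auto
        have "\<epsilon>2 * norm ?k \<le> \<epsilon>2 * norm h" using kh \<epsilon>2(1) by (intro mult_left_mono) auto
        moreover have "norm (y - x - ?k) = dist (x + ?k) y"
          by (metis diff_diff_add dist_commute dist_norm)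
        ultimately show ?thesis using y False by (intro exI[of _ y]) auto
      qed
      then obtain e where e: "\<And>i. i \<le> N \<Longrightarrow> e i \<in> E \<and> (i = 0 \<longrightarrow> e i = x) \<and> norm (e i - x - (real i / real N) *\<^sub>R h) \<le> \<epsilon>2 * norm h"
        by metis
      have eb: "norm (e i - x) < d1" if i: "i \<le> N" for i
      proof -
        have "norm (e i - x) \<le> norm (e i - x - (real i / real N) *\<^sub>R h) + norm ((real i / real N) *\<^sub>R h)"
          using norm_triangle_sub by (metis add.commute)
        also have "\<dots> \<le> \<epsilon>2 * norm h + 1 * norm h"
        proof (intro add_mono)
          have "real i / real N \<le> 1" using i N(1) by simp
          then show "norm ((real i / real N) *\<^sub>R h) \<le> 1 * norm h"
            using mult_right_mono[of "real i / real N" 1 "norm h"] by simp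
        qed (use e[OF i] in blast)
        also have "\<dots> \<le> 1 * norm h + 1 * norm h" using \<epsilon>2(3) by (intro add_mono mult_right_mono) auto
        also have "\<dots> < d1" using h d1(1) by simp
        finally show ?thesis .
      qed
      have "\<bar>f (x + h) - f x - g x \<bullet> h - T h \<bullet> h / 2\<bar> \<le> (4 * \<epsilon>1 + (5 * C + 4 * K) / real N) * (norm h)\<^sup>2"
      proof (rule second_order_expansion_along_chain[where E = E and e = e and ?\<epsilon>2.0 = \<epsilon>2])
        fix i assume i: "i \<le> N"
        show "norm (g (e i) - g x - T (e i - x)) \<le> \<epsilon>1 * norm (e i - x)"
          using d1(2)[OF eb[OF i]] e[OF i] x(1) by (simp add: Gg)
      next
        show "norm (g (e N) - g x) \<le> K * norm (e N - x)"
          using GL[of "e N" x] e[of N] x(1) norm_ge_zero[of "e N - x"] unfolding K_def distrib_right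
          by (simp add: Gg del: norm_ge_zero)
      qed (use jet C K N \<epsilon>1 \<epsilon>2 T TK e in auto)
      also have "\<dots> \<le> \<epsilon> * (norm h)\<^sup>2"
      proof (rule mult_right_mono)
        have "(5 * C + 4 * K) / real N \<le> \<epsilon> / 2" using N \<epsilon> by (simp add: field_simps)
        then show "4 * \<epsilon>1 + (5 * C + 4 * K) / real N \<le> \<epsilon>" using \<epsilon>1(3) by linarith
      qed simp
      finally show ?thesis .
    qed
    moreover have "0 < min (d1 / 3) d2" using d1 d2 by simp
    ultimately show "\<exists>T. linear T \<and> (\<exists>d>0. \<forall>h. norm h < d \<longrightarrow>
        \<bar>f (x + h) - f x - g x \<bullet> h - T h \<bullet> h / 2\<bar> \<le> \<epsilon> * (norm h)\<^sup>2)"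
      using T by blast
  qed
  then have "{x\<in>E. \<not> second_order_approx f x (g x)} \<subseteq> N1 \<union> N2" by blast
  ultimately show ?thesis using negligible_Un negligible_subset by blast
qed simp

section \<open>Jensen's lemma\<close>

text \<open>This is how two slopes at the same contact point are identified throughout: their
  difference is a linear function dominated by a quadratic one.\<close>

lemma inner_le_quadratic_imp_zero:
  fixes a :: "'a::real_inner"
  assumes "\<And>h. a \<bullet> h \<le> C * (norm h)\<^sup>2"
  shows "a = 0"
proof (rule ccontr)
  assume a: "a \<noteq> 0"
  define t where "t = 1 / (2 * (\<bar>C\<bar> + 1))"
  have t: "t > 0" by (simp add: t_def)
  have n: "norm a > 0" using a by simp
  have "t * (norm a)\<^sup>2 \<le> C * (t\<^sup>2 * (norm a)\<^sup>2)"
    using assms[of "t *\<^sub>R a"] by (simp add: power_mult_distrib power2_norm_eq_inner)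
  also have "\<dots> \<le> \<bar>C\<bar> * (t\<^sup>2 * (norm a)\<^sup>2)" by (intro mult_right_mono) auto
  also have "\<dots> = (\<bar>C\<bar> * t) * (t * (norm a)\<^sup>2)" by (simp add: power2_eq_square)
  also have "\<dots> < 1 * (t * (norm a)\<^sup>2)"
    using t n by (intro mult_strict_right_mono) (auto simp: t_def field_simps)
  finally show False by simp
qed

lemma convex_on_if_subgradients:
  fixes F :: "'a::real_inner \<Rightarrow> real"
  assumes sub: "\<And>x. \<exists>p. \<forall>y. F x + p \<bullet> (y - x) \<le> F y"
  shows "convex_on UNIV F"
proof (rule convex_onI)
  fix t :: real and x y :: 'a assume t: "0 < t" "t < 1"
  let ?z = "(1 - t) *\<^sub>R x + t *\<^sub>R y"
  obtain p where p: "\<And>y. F ?z + p \<bullet> (y - ?z) \<le> F y" using sub by blast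
  have "(1 - t) * (F ?z + p \<bullet> (x - ?z)) + t * (F ?z + p \<bullet> (y - ?z)) \<le> (1 - t) * F x + t * F y"
    using t p by (intro add_mono mult_left_mono) auto
  moreover have "(1 - t) * (F ?z + p \<bullet> (x - ?z)) + t * (F ?z + p \<bullet> (y - ?z))
     = F ?z + p \<bullet> ((1 - t) *\<^sub>R (x - ?z) + t *\<^sub>R (y - ?z))"
    by (simp add: inner_add_right algebra_simps)
  moreover have "(1 - t) *\<^sub>R (x - ?z) + t *\<^sub>R (y - ?z) = 0"
    by (simp add: algebra_simps)
  ultimately show "F ?z \<le> (1 - t) * F x + t * F y" by simp
qed simp

text \<open>Semiconvexity in the form in which sup-convolutions provide it. Adding
  \<open>\<Lambda>\<close> times the squared norm turns the supporting paraboloids into supporting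
  affine functions, hence \<open>W\<close> into a convex function.\<close>

definition supported_below :: "real \<Rightarrow> ('a::real_inner \<Rightarrow> real) \<Rightarrow> bool" where
  "supported_below \<Lambda> W \<longleftrightarrow> (\<forall>x. \<exists>p. \<forall>y. W x + p \<bullet> (y - x) - \<Lambda> * (norm (y - x))\<^sup>2 \<le> W y)"

lemma supported_below_continuous:
  fixes W :: "'a::euclidean_space \<Rightarrow> real"
  assumes "supported_below \<Lambda> W"
  shows "continuous_on UNIV W"
proof -
  define F where "F x = W x + \<Lambda> * (norm x)\<^sup>2" for x
  have "\<exists>p. \<forall>y. F x + p \<bullet> (y - x) \<le> F y" for x
  proof -
    obtain p where p: "\<And>y. W x + p \<bullet> (y - x) - \<Lambda> * (norm (y - x))\<^sup>2 \<le> W y"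
      using assms unfolding supported_below_def by blast
    have "F x + (p + (2 * \<Lambda>) *\<^sub>R x) \<bullet> (y - x) \<le> F y" for y
    proof -
      have eq: "(norm (y - x))\<^sup>2 = (norm y)\<^sup>2 - (norm x)\<^sup>2 - 2 * (x \<bullet> (y - x))"
        by (simp add: power2_norm_eq_inner inner_diff_left inner_diff_right inner_commute)
      have "\<Lambda> * (norm (y - x))\<^sup>2 = \<Lambda> * (norm y)\<^sup>2 - \<Lambda> * (norm x)\<^sup>2 - 2 * \<Lambda> * (x \<bullet> (y - x))"
        unfolding eq by (simp add: right_diff_distrib)
      moreover have "(p + (2 * \<Lambda>) *\<^sub>R x) \<bullet> (y - x) = p \<bullet> (y - x) + 2 * \<Lambda> * (x \<bullet> (y - x))"
        by (simp add: inner_add_left)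
      ultimately show ?thesis using p[of y] unfolding F_def by linarith
    qed
    then show ?thesis by blast
  qed
  then have "continuous_on UNIV F"
    by (intro convex_on_continuous convex_on_if_subgradients) auto
  then have "continuous_on UNIV (\<lambda>x. F x - \<Lambda> * (norm x)\<^sup>2)"
    by (intro continuous_intros)
  then show ?thesis by (simp add: F_def)
qed

section \<open>Contact points of tilted functions\<close>

definition supergradients :: "('a::real_inner \<Rightarrow> real) \<Rightarrow> 'a \<Rightarrow> 'a set" where
  "supergradients W x = {q. \<forall>y. W y \<le> W x + q \<bullet> (y - x)}"

text \<open>An affine function touches \<open>W\<close> at \<open>x\<close> from above, a paraboloid
  from below; the two slopes must agree.\<close>

lemma second_order_jet_if_supergradient:
  fixes W :: "'a::euclidean_space \<Rightarrow> real"
  assumes W: "supported_below \<Lambda> W" and q: "q \<in> supergradients W x"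
  shows "second_order_jet W \<Lambda> x q"
proof -
  obtain p where p: "\<And>y. W x + p \<bullet> (y - x) - \<Lambda> * (norm (y - x))\<^sup>2 \<le> W y"
    using W unfolding supported_below_def by blast
  have "(p - q) \<bullet> h \<le> \<Lambda> * (norm h)\<^sup>2" for h
  proof -
    have "W (x + h) \<le> W x + q \<bullet> h"
      using q unfolding supergradients_def by (metis (mono_tags) add_diff_cancel_left' mem_Collect_eq)
    then show ?thesis using p[of "x + h"] by (simp add: inner_diff_left)
  qed
  then have "p = q" using inner_le_quadratic_imp_zero by (metis eq_iff_diff_eq_0)
  show ?thesis unfolding second_order_jet_def
  proof
    fix y
    have 1: "W y \<le> W x + q \<bullet> (y - x)" using q by (simp add: supergradients_def)
    have 2: "W x + q \<bullet> (y - x) - \<Lambda> * (norm (y - x))\<^sup>2 \<le> W y" using p \<open>p = q\<close> by simp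
    show "\<bar>W y - W x - q \<bullet> (y - x)\<bar> \<le> \<Lambda> * (norm (y - x))\<^sup>2"
      using 1 2 by (simp add: abs_le_iff)
  qed
qed

lemma second_order_jet_unique:
  assumes "second_order_jet f C x p" "second_order_jet f C' x q"
  shows "p = q"
proof -
  have "(p - q) \<bullet> h \<le> (C + C') * (norm h)\<^sup>2" for h
    using assms[unfolded second_order_jet_def, rule_format, of "x + h"]
    by (simp add: inner_diff_left abs_le_iff distrib_right)
  then show ?thesis using inner_le_quadratic_imp_zero by (metis eq_iff_diff_eq_0)
qed

text \<open>The affine majorant at \<open>t\<close> must lie above the value 0 at the origin,
  although \<open>W t\<close> has decayed quadratically. Small tilts thus keep the contact point
  near the origin.\<close>

lemma norm_le_if_supergradient:
  assumes W: "\<And>t. W t \<le> - (\<eta> / 2) * (norm t)\<^sup>2" "W 0 = 0" and \<eta>: "0 < \<eta>"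
    and q: "q \<in> supergradients W t"
  shows "norm t \<le> 2 * norm q / \<eta>"
proof (cases "t = 0")
  case False
  have "W 0 \<le> W t + q \<bullet> (0 - t)" using q unfolding supergradients_def by blast
  then have "0 \<le> - (\<eta> / 2) * (norm t)\<^sup>2 - q \<bullet> t" using W(1)[of t] W(2) by simp
  moreover have "- (q \<bullet> t) \<le> norm q * norm t" using Cauchy_Schwarz_ineq2[of q t] by simp
  ultimately have "(\<eta> / 2 * norm t) * norm t \<le> norm q * norm t" by (simp add: power2_eq_square)
  then have "\<eta> / 2 * norm t \<le> norm q" using False by simp
  then show ?thesis using \<eta> by (simp add: field_simps)
qed (use \<eta> in simp)

text \<open>The gradient maps the contact set in a Lipschitz way onto a ball, so the
  contact set cannot be a null set.\<close>

lemma not_negligible_contact_set: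
  fixes W :: "'a::euclidean_space \<Rightarrow> real"
  assumes sb: "supported_below \<Lambda> W" and W: "\<And>t. W t \<le> - (\<eta> / 2) * (norm t)\<^sup>2" "W 0 = 0"
    and \<eta>: "0 < \<eta>" and r: "0 < r"
  shows "\<not> negligible {t. \<exists>q\<in>supergradients W t. norm q \<le> r}" (is "\<not> negligible ?E")
proof
  assume neg: "negligible ?E"
  have cont: "continuous_on UNIV W" by (rule supported_below_continuous[OF sb])
  have surj: "\<exists>t. q \<in> supergradients W t" if q: "norm q \<le> r" for q
  proof -
    \<comment> \<open>Beyond this radius a tilt of size \<open>r\<close> loses against the quadratic
      decay, so a maximum over the ball is global.\<close>
    define R where "R = 2 * r / \<eta>"
    have R: "R > 0" using r \<eta> by (simp add: R_def)
    have "\<exists>t\<in>cball 0 R. \<forall>y\<in>cball 0 R. W y - q \<bullet> y \<le> W t - q \<bullet> t"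
      using R by (intro continuous_attains_sup continuous_intros continuous_on_subset[OF cont]) auto
    then obtain t where t: "\<And>y. norm y \<le> R \<Longrightarrow> W y - q \<bullet> y \<le> W t - q \<bullet> t"
      by (metis mem_cball_0)
    have "W y - q \<bullet> y \<le> W t - q \<bullet> t" for y
    proof (cases "norm y \<le> R")
      case False
      have "- (q \<bullet> y) \<le> norm q * norm y" using Cauchy_Schwarz_ineq2[of q y] by simp
      also have "\<dots> \<le> r * norm y" using q by (simp add: mult_right_mono)
      also have "\<dots> \<le> (\<eta> / 2 * norm y) * norm y"
        using False \<eta> by (intro mult_right_mono) (auto simp: R_def field_simps)
      finally have "W y - q \<bullet> y \<le> 0" using W(1)[of y] by (simp add: power2_eq_square)
      also have "0 \<le> W t - q \<bullet> t" using t[of 0] R W(2) by simp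
      finally show ?thesis .
    qed (rule t)
    then have "q \<in> supergradients W t" by (simp add: supergradients_def inner_diff_right algebra_simps)
    then show ?thesis by blast
  qed
  \<comment> \<open>The choice is unambiguous wherever a supergradient exists, since a two-sided
    contact has only one slope.\<close>
  define Q where "Q t = (SOME q. q \<in> supergradients W t)" for t
  have Q: "Q t = q" if "q \<in> supergradients W t" for q t
    unfolding Q_def
  proof (rule some_equality)
    fix q' assume "q' \<in> supergradients W t"
    then show "q' = q"
      by (rule second_order_jet_unique[OF second_order_jet_if_supergradient[OF sb]
            second_order_jet_if_supergradient[OF sb that]])
  qed (rule that)
  have lip: "norm (Q s - Q t) \<le> (6 * \<Lambda>) * norm (s - t)" if st: "s \<in> ?E" "t \<in> ?E" for s t
  proof (cases "s = t")
    case False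
    obtain p q where "p \<in> supergradients W s" "q \<in> supergradients W t" using st by blast
    then show ?thesis
      using second_order_jet_lipschitz[OF second_order_jet_if_supergradient[OF sb, of p s]
          second_order_jet_if_supergradient[OF sb, of q t] False] Q by simp
  qed simp
  have "negligible (Q ` ?E)"
  proof (rule negligible_locally_Lipschitz_image[OF order_refl neg])
    fix s assume s: "s \<in> ?E"
    have "\<forall>t\<in>?E \<inter> UNIV. norm (Q t - Q s) \<le> (6 * \<Lambda>) * norm (t - s)"
    proof
      fix t assume "t \<in> ?E \<inter> UNIV"
      then have "t \<in> ?E" by simp
      from lip[OF this s] show "norm (Q t - Q s) \<le> (6 * \<Lambda>) * norm (t - s)" .
    qed
    then show "\<exists>T B. open T \<and> s \<in> T \<and> (\<forall>t\<in>?E \<inter> T. norm (Q t - Q s) \<le> B * norm (t - s))"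
      using open_UNIV UNIV_I by (intro exI conjI)
  qed
  moreover have "ball 0 r \<subseteq> Q ` ?E"
  proof
    fix q :: 'a assume "q \<in> ball 0 r"
    then have q: "norm q \<le> r" by simp
    then obtain t where "q \<in> supergradients W t" using surj by blast
    then show "q \<in> Q ` ?E" using Q q by blast
  qed
  ultimately have "negligible (ball (0::'a) r)" using negligible_subset by blast
  then show False using r open_not_negligible[of "ball (0::'a) r"] by simp
qed

text \<open>Each function of the doubled problem has its bad points in its own variable; the
  cylinders over these null sets are to be avoided in the product space.\<close>

lemma negligible_Times_UNIV:
  fixes N :: "'a::euclidean_space set"
  assumes "negligible N"
  shows "negligible (N \<times> (UNIV :: 'b::euclidean_space set))" "negligible ((UNIV :: 'b set) \<times> N)"
proof -
  have "N \<in> null_sets (completion lborel)"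
    using assms by (simp add: negligible_iff_null_sets)
  then obtain B where B: "N \<subseteq> B" "B \<in> null_sets lborel"
    by (auto simp: null_sets_completion_iff2)
  have b: "B \<in> sets borel" "emeasure lborel B = 0" using B by (auto simp: null_sets_def)
  have "emeasure (lborel \<Otimes>\<^sub>M lborel) (B \<times> (UNIV :: 'b set)) = 0"
    using b by (subst lborel.emeasure_pair_measure_Times) auto
  moreover have "emeasure (lborel \<Otimes>\<^sub>M lborel) ((UNIV :: 'b set) \<times> B) = 0"
    using b by (subst lborel.emeasure_pair_measure_Times) auto
  moreover have "B \<times> (UNIV :: 'b set) \<in> sets (lborel \<Otimes>\<^sub>M lborel)" "(UNIV :: 'b set) \<times> B \<in> sets (lborel \<Otimes>\<^sub>M lborel)"
    using b by (auto intro!: pair_measureI)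
  ultimately have "B \<times> (UNIV :: 'b set) \<in> null_sets lborel" "(UNIV :: 'b set) \<times> B \<in> null_sets lborel"
    unfolding lborel_prod by (auto simp: null_sets_def)
  then have "negligible (B \<times> (UNIV :: 'b set))" "negligible ((UNIV :: 'b set) \<times> B)"
    by (auto simp: negligible_iff_null_sets intro: null_sets_completionI)
  then show "negligible (N \<times> (UNIV :: 'b set))" "negligible ((UNIV :: 'b set) \<times> N)"
    using B(1) by (auto elim!: negligible_subset)
qed

section \<open>Sup-convolutions\<close>

lemma usc_on_attains_max:
  fixes f :: "'a::metric_space \<Rightarrow> real"
  assumes S: "compact S" "S \<noteq> {}" and f: "usc_on S f"
  shows "\<exists>x\<in>S. \<forall>y\<in>S. f y \<le> f x"
proof (rule ccontr)
  assume no: "\<not> ?thesis"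
  then have "\<forall>x\<in>S. \<exists>y\<in>S. f x < f y" by (meson not_le)
  then obtain g where g: "\<And>x. x \<in> S \<Longrightarrow> g x \<in> S \<and> f x < f (g x)" by metis
  have "\<exists>U. open U \<and> x \<in> U \<and> (\<forall>y\<in>S \<inter> U. f y < f (g x))" if x: "x \<in> S" for x
  proof -
    have "\<forall>\<^sub>F y in at x within S. f y < f (g x)" using f x g[OF x] unfolding usc_on_def by blast
    then obtain U where U: "open U" "x \<in> U" "\<And>y. \<lbrakk>y \<in> U; y \<noteq> x; y \<in> S\<rbrakk> \<Longrightarrow> f y < f (g x)"
      unfolding eventually_at_topological by blast
    then show ?thesis using g[OF x] by (intro exI[of _ U]) (metis Int_iff)
  qed
  then obtain U where U: "\<And>x. x \<in> S \<Longrightarrow> open (U x) \<and> x \<in> U x \<and> (\<forall>y\<in>S \<inter> U x. f y < f (g x))"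
    by metis
  have "S \<subseteq> (\<Union>x\<in>S. U x)" using U by blast
  then obtain T where T: "T \<subseteq> S" "finite T" "S \<subseteq> (\<Union>x\<in>T. U x)"
    using compactE_image[OF S(1), of S U] U by metis
  have "T \<noteq> {}" using T(3) S(2) by auto
  then have "Max ((\<lambda>x. f (g x)) ` T) \<in> (\<lambda>x. f (g x)) ` T" using T(2) by (intro Max_in) auto
  then obtain z where z: "z \<in> T" "f (g z) = Max ((\<lambda>x. f (g x)) ` T)" by auto
  have "g z \<in> S" using z(1) T(1) g by blast
  then obtain x where x: "x \<in> T" "g z \<in> U x" using T(3) by blast
  then have "f (g z) < f (g x)" using U[of x] T(1) \<open>g z \<in> S\<close> by blast
  also have "f (g x) \<le> f (g z)" unfolding z(2) using x(1) T(2) by (intro Max_ge) auto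
  finally show False by simp
qed

lemma usc_on_add_continuous:
  fixes f c :: "'a::metric_space \<Rightarrow> real"
  assumes f: "usc_on S f" and c: "continuous_on S c"
  shows "usc_on S (\<lambda>x. f x + c x)"
  unfolding usc_on_def
proof (intro ballI allI impI)
  fix x M assume x: "x \<in> S" and M: "f x + c x < M"
  define e where "e = (M - (f x + c x)) / 2"
  have e: "e > 0" using M by (simp add: e_def)
  have "\<forall>\<^sub>F y in at x within S. f y < f x + e" using f x e unfolding usc_on_def by simp
  moreover have "\<forall>\<^sub>F y in at x within S. c y < c x + e"
    using c x e unfolding continuous_on_def by (intro order_tendstoD(2)) auto
  ultimately show "\<forall>\<^sub>F y in at x within S. f y + c y < M"
    by eventually_elim (simp add: e_def field_simps)
qed

lemma norm_add3_power2_le: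
  fixes a b c :: "'a::real_normed_vector"
  shows "(norm (a + b + c))\<^sup>2 \<le> 3 * ((norm a)\<^sup>2 + (norm b)\<^sup>2 + (norm c)\<^sup>2)"
proof -
  have "norm (a + b + c) \<le> norm a + norm b + norm c" by norm
  then have "(norm (a + b + c))\<^sup>2 \<le> (norm a + norm b + norm c)\<^sup>2" by (intro power_mono) auto
  also have "\<dots> \<le> 3 * ((norm a)\<^sup>2 + (norm b)\<^sup>2 + (norm c)\<^sup>2)"
  proof -
    have "0 \<le> (norm a - norm b)\<^sup>2 + (norm b - norm c)\<^sup>2 + (norm a - norm c)\<^sup>2" by simp
    then show ?thesis by (simp add: power2_eq_square algebra_simps)
  qed
  finally show ?thesis .
qed

lemma norm_add_power2_le:
  fixes a b :: "'a::real_normed_vector"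
  shows "(norm (a + b))\<^sup>2 \<le> 2 * ((norm a)\<^sup>2 + (norm b)\<^sup>2)"
proof -
  have "(norm (a + b))\<^sup>2 \<le> (norm a + norm b)\<^sup>2" by (intro power_mono norm_triangle_ineq) auto
  also have "\<dots> \<le> 2 * ((norm a)\<^sup>2 + (norm b)\<^sup>2)"
  proof -
    have "0 \<le> (norm a - norm b)\<^sup>2" by simp
    then show ?thesis by (simp add: power2_eq_square algebra_simps)
  qed
  finally show ?thesis .
qed

definition sup_convolution ::
  "real \<Rightarrow> 'a::real_normed_vector set \<Rightarrow> ('a \<Rightarrow> real) \<Rightarrow> 'a \<Rightarrow> real" where
  "sup_convolution \<kappa> S u t = (SUP s\<in>S. u s - \<kappa> / 2 * (norm (s - t))\<^sup>2)"

lemma sup_convolution_attained: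
  fixes u :: "'a::real_normed_vector \<Rightarrow> real"
  assumes S: "compact S" "S \<noteq> {}" and u: "usc_on S u"
  shows "\<exists>s\<in>S. sup_convolution \<kappa> S u t = u s - \<kappa> / 2 * (norm (s - t))\<^sup>2"
    and "s \<in> S \<Longrightarrow> u s - \<kappa> / 2 * (norm (s - t))\<^sup>2 \<le> sup_convolution \<kappa> S u t"
proof -
  have "usc_on S (\<lambda>s. u s + - (\<kappa> / 2 * (norm (s - t))\<^sup>2))"
    by (intro usc_on_add_continuous u continuous_intros)
  then obtain m where m: "m \<in> S" "\<And>s. s \<in> S \<Longrightarrow> u s - \<kappa> / 2 * (norm (s - t))\<^sup>2 \<le> u m - \<kappa> / 2 * (norm (m - t))\<^sup>2"
    using usc_on_attains_max[OF S] by fastforce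
  have eq: "sup_convolution \<kappa> S u t = u m - \<kappa> / 2 * (norm (m - t))\<^sup>2"
    unfolding sup_convolution_def using m by (intro cSup_eq_maximum) auto
  then show "\<exists>s\<in>S. sup_convolution \<kappa> S u t = u s - \<kappa> / 2 * (norm (s - t))\<^sup>2" using m(1) by blast
  show "s \<in> S \<Longrightarrow> u s - \<kappa> / 2 * (norm (s - t))\<^sup>2 \<le> sup_convolution \<kappa> S u t"
    unfolding eq by (rule m(2))
qed

text \<open>The maximiser \<open>s\<close> at \<open>t\<close> remains a competitor at
  \<open>t'\<close>; expanding the square yields a supporting paraboloid with slope
  \<open>\<kappa> *\<^sub>R (s - t)\<close>.\<close>

lemma sup_convolution_lower:
  fixes u :: "'a::real_inner \<Rightarrow> real"
  assumes S: "compact S" "S \<noteq> {}" and u: "usc_on S u"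
    and s: "s \<in> S" "sup_convolution \<kappa> S u t = u s - \<kappa> / 2 * (norm (s - t))\<^sup>2"
  shows "sup_convolution \<kappa> S u t + (\<kappa> *\<^sub>R (s - t)) \<bullet> (t' - t) - \<kappa> / 2 * (norm (t' - t))\<^sup>2 \<le> sup_convolution \<kappa> S u t'"
proof -
  have eq: "(norm (s - t'))\<^sup>2 = (norm (s - t))\<^sup>2 - 2 * ((s - t) \<bullet> (t' - t)) + (norm (t' - t))\<^sup>2"
    by (simp add: power2_norm_eq_inner inner_diff_left inner_diff_right inner_commute)
  have "\<kappa> / 2 * (norm (s - t'))\<^sup>2 = \<kappa> / 2 * (norm (s - t))\<^sup>2 - (\<kappa> *\<^sub>R (s - t)) \<bullet> (t' - t) + \<kappa> / 2 * (norm (t' - t))\<^sup>2"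
    unfolding eq by (simp add: distrib_left right_diff_distrib)
  then show ?thesis using sup_convolution_attained(2)[OF S u s(1), of \<kappa> t'] s(2) by linarith
qed

text \<open>The coupling term costs \<open>2 * c\<close> because the square of a difference is at
  most twice the sum of the squares; the last penalty costs just \<open>d\<close>.\<close>

lemma supported_below_pair:
  fixes U V :: "'a::real_inner \<Rightarrow> real"
  assumes U: "supported_below \<Lambda> U" and V: "supported_below \<Lambda> V"
    and c: "0 \<le> c" and d: "0 \<le> d"
  shows "supported_below (\<Lambda> + 2 * c + d)
     (\<lambda>t. U (fst t) + V (snd t) - c * (norm (fst t - snd t))\<^sup>2 - d * (norm t)\<^sup>2)"
  unfolding supported_below_def
proof
  fix x :: "'a \<times> 'a"
  obtain p where p: "\<And>y. U (fst x) + p \<bullet> (y - fst x) - \<Lambda> * (norm (y - fst x))\<^sup>2 \<le> U y"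
    using U unfolding supported_below_def by blast
  obtain q where q: "\<And>y. V (snd x) + q \<bullet> (y - snd x) - \<Lambda> * (norm (y - snd x))\<^sup>2 \<le> V y"
    using V unfolding supported_below_def by blast
  define D where "D = fst x - snd x"
  define g where "g = (p, q) - (2 * c) *\<^sub>R (D, - D) - (2 * d) *\<^sub>R x"
  show "\<exists>p. \<forall>y. U (fst x) + V (snd x) - c * (norm (fst x - snd x))\<^sup>2 - d * (norm x)\<^sup>2 + p \<bullet> (y - x)
           - (\<Lambda> + 2 * c + d) * (norm (y - x))\<^sup>2
        \<le> U (fst y) + V (snd y) - c * (norm (fst y - snd y))\<^sup>2 - d * (norm y)\<^sup>2"
  proof (intro exI[of _ g] allI)
    fix y :: "'a \<times> 'a"
    define h where "h = fst y - fst x"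
    define k where "k = snd y - snd x"
    have yx: "y - x = (h, k)" by (simp add: h_def k_def prod_eq_iff)
    have 1: "U (fst x) + p \<bullet> h - \<Lambda> * (norm h)\<^sup>2 \<le> U (fst y)" using p[of "fst y"] by (simp add: h_def)
    have 2: "V (snd x) + q \<bullet> k - \<Lambda> * (norm k)\<^sup>2 \<le> V (snd y)" using q[of "snd y"] by (simp add: k_def)
    have n: "(norm (y - x))\<^sup>2 = (norm h)\<^sup>2 + (norm k)\<^sup>2"
      unfolding yx by (simp add: power2_norm_eq_inner)
    have "fst y - snd y = D + (h - k)" by (simp add: D_def h_def k_def)
    then have "(norm (fst y - snd y))\<^sup>2 = (norm D)\<^sup>2 + 2 * (D \<bullet> (h - k)) + (norm (h - k))\<^sup>2"
      by (simp add: power2_norm_eq_inner inner_add_left inner_add_right inner_commute)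
    moreover have "(norm (h - k))\<^sup>2 \<le> 2 * ((norm h)\<^sup>2 + (norm k)\<^sup>2)"
      using norm_add_power2_le[of h "- k"] by simp
    ultimately have "(norm (fst y - snd y))\<^sup>2 \<le> (norm D)\<^sup>2 + 2 * (D \<bullet> (h - k)) + 2 * (norm (y - x))\<^sup>2"
      unfolding n by linarith
    then have 3: "c * (norm (fst y - snd y))\<^sup>2 \<le> c * (norm D)\<^sup>2 + 2 * c * (D \<bullet> (h - k)) + 2 * c * (norm (y - x))\<^sup>2"
      using mult_left_mono[OF _ c] by (fastforce simp: algebra_simps)
    have eq: "(norm y)\<^sup>2 = (norm x)\<^sup>2 + 2 * (x \<bullet> (y - x)) + (norm (y - x))\<^sup>2"
      by (simp add: power2_norm_eq_inner inner_diff_left inner_diff_right inner_commute)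
    have 4: "d * (norm y)\<^sup>2 = d * (norm x)\<^sup>2 + 2 * d * (x \<bullet> (y - x)) + d * (norm (y - x))\<^sup>2"
      unfolding eq by (simp add: distrib_left)
    have "((p, q) - (2 * c) *\<^sub>R (D, - D)) \<bullet> (h, k) = p \<bullet> h + q \<bullet> k - 2 * c * (D \<bullet> (h - k))"
      by (simp add: inner_diff_left inner_diff_right algebra_simps)
    then have 5: "g \<bullet> (y - x) = p \<bullet> h + q \<bullet> k - 2 * c * (D \<bullet> (h - k)) - 2 * d * (x \<bullet> (y - x))"
      unfolding g_def yx by (simp only: inner_diff_left) simp
    have 6: "(\<Lambda> + 2 * c + d) * (norm (y - x))\<^sup>2 = \<Lambda> * (norm h)\<^sup>2 + \<Lambda> * (norm k)\<^sup>2 + 2 * c * (norm (y - x))\<^sup>2 + d * (norm (y - x))\<^sup>2"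
      by (simp add: distrib_right n) (simp add: algebra_simps)
    show "U (fst x) + V (snd x) - c * (norm (fst x - snd x))\<^sup>2 - d * (norm x)\<^sup>2 + g \<bullet> (y - x)
           - (\<Lambda> + 2 * c + d) * (norm (y - x))\<^sup>2
        \<le> U (fst y) + V (snd y) - c * (norm (fst y - snd y))\<^sup>2 - d * (norm y)\<^sup>2"
      using 1 2 3 4 5 6 unfolding D_def[symmetric] by linarith
  qed
qed

section \<open>The theorem on sums of Crandall and Ishii\<close>

text \<open>The supporting slope is forced to equal \<open>p\<close>, and
  \<open>\<Lambda> \<le> C\<close> lets one opening serve both sides.\<close>

lemma second_order_jet_if_upper_bound:
  fixes U :: "'a::euclidean_space \<Rightarrow> real"
  assumes U: "supported_below \<Lambda> U" and up: "\<And>h. U (x + h) \<le> U x + p \<bullet> h + C * (norm h)\<^sup>2"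
    and "\<Lambda> \<le> C"
  shows "second_order_jet U C x p"
proof -
  obtain p' where p': "\<And>y. U x + p' \<bullet> (y - x) - \<Lambda> * (norm (y - x))\<^sup>2 \<le> U y"
    using U unfolding supported_below_def by blast
  have "(p' - p) \<bullet> h \<le> (\<Lambda> + C) * (norm h)\<^sup>2" for h
    using up[of h] p'[of "x + h"] by (simp add: inner_diff_left distrib_right)
  then have "p' = p" using inner_le_quadratic_imp_zero by (metis eq_iff_diff_eq_0)
  show ?thesis unfolding second_order_jet_def
  proof
    fix y
    have "\<Lambda> * (norm (y - x))\<^sup>2 \<le> C * (norm (y - x))\<^sup>2" using \<open>\<Lambda> \<le> C\<close> by (simp add: mult_right_mono)
    then show "\<bar>U y - U x - p \<bullet> (y - x)\<bar> \<le> C * (norm (y - x))\<^sup>2"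
      using up[of "y - x"] p'[of y] \<open>p' = p\<close> by (simp add: abs_le_iff)
  qed
qed

lemma contact_point_with_second_order_approx:
  fixes U V :: "'a::euclidean_space \<Rightarrow> real"
  assumes U: "supported_below (\<kappa> / 2) U" "U 0 = 0" and V: "supported_below (\<kappa> / 2) V" "V 0 = 0"
    and \<kappa>: "0 < \<kappa>" and UV: "\<And>s t. U s + V t \<le> \<kappa> / 2 * (norm (s - t))\<^sup>2" and \<eta>: "0 < \<eta>"
  obtains s t p q l where "norm s \<le> \<eta>" "norm t \<le> \<eta>"
    "second_order_jet U (\<kappa> + \<eta>) s p" "second_order_approx U s p"
    "second_order_jet V (\<kappa> + \<eta>) t q" "second_order_approx V t q"
    "\<And>h k. U (s + h) + V (t + k) - U s - V t
        \<le> l \<bullet> (h, k) + \<kappa> / 2 * (norm (h - k))\<^sup>2 + \<eta> / 2 * ((norm h)\<^sup>2 + (norm k)\<^sup>2)"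
proof -
  \<comment> \<open>The term with \<open>\<eta>\<close> makes the origin a maximum with quadratic
    decay, as the lemma on contact sets demands.\<close>
  define W where "W z = U (fst z) + V (snd z) - \<kappa> / 2 * (norm (fst z - snd z))\<^sup>2 - \<eta> / 2 * (norm z)\<^sup>2" for z
  have W: "supported_below (\<kappa> / 2 + 2 * (\<kappa> / 2) + \<eta> / 2) W"
    unfolding W_def using \<kappa> \<eta> by (intro supported_below_pair U V) auto
  have W1: "W z \<le> - (\<eta> / 2) * (norm z)\<^sup>2" for z using UV[of "fst z" "snd z"] by (simp add: W_def)
  have W0: "W 0 = 0" using U V by (simp add: W_def)
  \<comment> \<open>With tilts of this size, \<open>2 * r / \<eta>\<close> equals
    \<open>\<eta>\<close>, the bound wanted for the contact point.\<close>
  define r where "r = \<eta>\<^sup>2 / 2"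
  have r: "0 < r" using \<eta> by (simp add: r_def)
  define C where "C = \<kappa> + \<eta>"
  define E where "E = {z. \<exists>l\<in>supergradients W z. norm l \<le> r}"
  have nE: "\<not> negligible E" unfolding E_def by (rule not_negligible_contact_set[OF W W1 W0 \<eta> r])
  have Wl: "U (s + h) + V (t + k) - U s - V t
        \<le> (l + (\<kappa> *\<^sub>R (s - t) + \<eta> *\<^sub>R s, - (\<kappa> *\<^sub>R (s - t)) + \<eta> *\<^sub>R t)) \<bullet> (h, k)
          + \<kappa> / 2 * (norm (h - k))\<^sup>2 + \<eta> / 2 * ((norm h)\<^sup>2 + (norm k)\<^sup>2)"
    if "l \<in> supergradients W (s, t)" for s t h k l
  proof -
    have "W (s + h, t + k) \<le> W (s, t) + l \<bullet> ((s + h, t + k) - (s, t))"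
      using that unfolding supergradients_def by blast
    then have 1: "W (s + h, t + k) \<le> W (s, t) + l \<bullet> (h, k)" by simp
    have e1: "(norm ((s + h) - (t + k)))\<^sup>2 = (norm (s - t))\<^sup>2 + 2 * ((s - t) \<bullet> (h - k)) + (norm (h - k))\<^sup>2"
    proof -
      have "(s + h) - (t + k) = (s - t) + (h - k)" by simp
      then show ?thesis by (simp only: power2_norm_eq_inner inner_add_left inner_add_right) (simp add: inner_commute)
    qed
    have e2: "(norm (s + h, t + k))\<^sup>2 = (norm (s, t))\<^sup>2 + 2 * (s \<bullet> h + t \<bullet> k) + ((norm h)\<^sup>2 + (norm k)\<^sup>2)"
      by (simp add: power2_norm_eq_inner inner_add_left inner_add_right inner_commute)
    have e3: "(l + (\<kappa> *\<^sub>R (s - t) + \<eta> *\<^sub>R s, - (\<kappa> *\<^sub>R (s - t)) + \<eta> *\<^sub>R t)) \<bullet> (h, k)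
        = l \<bullet> (h, k) + \<kappa> * ((s - t) \<bullet> (h - k)) + \<eta> * (s \<bullet> h + t \<bullet> k)"
      by (simp add: inner_add_left inner_diff_left inner_diff_right algebra_simps)
    from 1 show ?thesis
      unfolding W_def fst_conv snd_conv e1 e2 e3 by (simp add: distrib_left)
  qed
  \<comment> \<open>Freezing one variable in the joint upper bound leaves an upper paraboloid for
    the other function alone, so a contact point of the pair is one for each function.\<close>
  have jets: "(\<exists>p. second_order_jet U C (fst z) p) \<and> (\<exists>q. second_order_jet V C (snd z) q)" if zE: "z \<in> E" for z
  proof -
    obtain s t where z: "z = (s, t)" by (cases z)
    obtain l where l: "l \<in> supergradients W (s, t)" using zE z unfolding E_def by blast
    define m where "m = l + (\<kappa> *\<^sub>R (s - t) + \<eta> *\<^sub>R s, - (\<kappa> *\<^sub>R (s - t)) + \<eta> *\<^sub>R t)"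
    have "U (s + h) \<le> U s + fst m \<bullet> h + C * (norm h)\<^sup>2" for h
    proof -
      have "U (s + h) - U s \<le> m \<bullet> (h, 0) + (\<kappa> + \<eta>) / 2 * (norm h)\<^sup>2"
        using Wl[OF l, of h 0] unfolding m_def by (simp add: add_divide_distrib distrib_right)
      moreover have "m \<bullet> (h, 0) = fst m \<bullet> h" by (cases m) simp
      moreover have "(\<kappa> + \<eta>) / 2 * (norm h)\<^sup>2 \<le> C * (norm h)\<^sup>2"
        using \<kappa> \<eta> by (intro mult_right_mono) (auto simp: C_def)
      ultimately show ?thesis by linarith
    qed
    then have "second_order_jet U C s (fst m)"
      using \<kappa> \<eta> by (intro second_order_jet_if_upper_bound[OF U(1)]) (auto simp: C_def)
    moreover have "V (t + k) \<le> V t + snd m \<bullet> k + C * (norm k)\<^sup>2" for k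
    proof -
      have "V (t + k) - V t \<le> m \<bullet> (0, k) + (\<kappa> + \<eta>) / 2 * (norm k)\<^sup>2"
        using Wl[OF l, of 0 k] unfolding m_def by (simp add: add_divide_distrib distrib_right)
      moreover have "m \<bullet> (0, k) = snd m \<bullet> k" by (cases m) simp
      moreover have "(\<kappa> + \<eta>) / 2 * (norm k)\<^sup>2 \<le> C * (norm k)\<^sup>2"
        using \<kappa> \<eta> by (intro mult_right_mono) (auto simp: C_def)
      ultimately show ?thesis by linarith
    qed
    then have "second_order_jet V C t (snd m)"
      using \<kappa> \<eta> by (intro second_order_jet_if_upper_bound[OF V(1)]) (auto simp: C_def)
    ultimately show ?thesis using z by auto
  qed
  define gU where "gU x = (SOME p. second_order_jet U C x p)" for x
  define gV where "gV x = (SOME p. second_order_jet V C x p)" for x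
  define EU where "EU = {x. \<exists>p. second_order_jet U C x p}"
  define EV where "EV = {x. \<exists>p. second_order_jet V C x p}"
  have gU: "second_order_jet U C x (gU x)" if "x \<in> EU" for x
    using that unfolding EU_def gU_def by (auto intro: someI_ex)
  have gV: "second_order_jet V C x (gV x)" if "x \<in> EV" for x
    using that unfolding EV_def gV_def by (auto intro: someI_ex)
  define NU where "NU = {x\<in>EU. \<not> second_order_approx U x (gU x)}"
  define NV where "NV = {x\<in>EV. \<not> second_order_approx V x (gV x)}"
  have "negligible NU" unfolding NU_def by (rule negligible_second_order_jet_not_approx) (rule gU)
  moreover have "negligible NV" unfolding NV_def by (rule negligible_second_order_jet_not_approx) (rule gV)
  ultimately have "negligible (NU \<times> (UNIV::'a set) \<union> (UNIV::'a set) \<times> NV)"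
    by (intro negligible_Un negligible_Times_UNIV)
  \<comment> \<open>The contact set lives in the product space and the bad sets in the factors; null
    cylinders cannot contain a set that is not null.\<close>
  then have "\<not> E \<subseteq> NU \<times> UNIV \<union> UNIV \<times> NV" using nE negligible_subset by blast
  then obtain s t where st: "(s, t) \<in> E" "s \<notin> NU" "t \<notin> NV" by auto
  then obtain l where l: "l \<in> supergradients W (s, t)" "norm l \<le> r" by (auto simp: E_def)
  have "norm (s, t) \<le> 2 * norm l / \<eta>" by (rule norm_le_if_supergradient[OF W1 W0 \<eta> l(1)])
  also have "\<dots> \<le> 2 * r / \<eta>" using l(2) \<eta> by (intro divide_right_mono) auto
  also have "\<dots> = \<eta>" using \<eta> by (simp add: r_def power2_eq_square)
  finally have "norm (s, t) \<le> \<eta>" .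
  then have "norm s \<le> \<eta>" "norm t \<le> \<eta>"
    using norm_fst_le[of s t] norm_snd_le[of t s] by linarith+
  moreover have "s \<in> EU" "t \<in> EV" using jets[OF st(1)] by (auto simp: EU_def EV_def)
  ultimately show ?thesis
    using st gU gV by (intro that[OF _ _ _ _ _ _ Wl[OF l(1)]]) (auto simp: NU_def NV_def C_def)
qed

lemma nonpos_if_small_and_homogeneous:
  fixes f :: "'a::real_normed_vector \<Rightarrow> real"
  assumes d: "0 < d" and small: "\<And>z. norm z < d \<Longrightarrow> f z \<le> 0"
    and hom: "\<And>c z. f (c *\<^sub>R z) = c\<^sup>2 * f z"
  shows "f z \<le> 0"
proof (cases "z = 0")
  case True then show ?thesis using small[of 0] d by simp
next
  case False
  define c where "c = d / (2 * norm z)"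
  have c: "c > 0" using d False by (simp add: c_def)
  have "norm (c *\<^sub>R z) < d" using d False by (simp add: c_def)
  then have "c\<^sup>2 * f z \<le> 0" using small hom by metis
  then show ?thesis using c by (simp add: mult_le_0_iff)
qed

text \<open>Adding the joint bounds at \<open>(h, k)\<close> and \<open>(- h, - k)\<close> cancels
  all first-order terms. The penalty contributes \<open>\<eta>\<close> and the expansions
  \<open>2 * \<eta>\<close>, hence the factor 3; homogeneity of degree two then removes the
  restriction to small arguments. The lower bounds come from the supporting paraboloid of each
  function.\<close>

lemma hessian_bounds_at_contact_point:
  fixes U V :: "'a::euclidean_space \<Rightarrow> real"
  assumes U: "supported_below (\<kappa> / 2) U" and V: "supported_below (\<kappa> / 2) V"
    and \<kappa>: "0 < \<kappa>" and \<eta>: "0 < \<eta>"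
    and jets: "second_order_jet U C s p" "second_order_jet V C t q"
    and TU: "linear TU" "0 < d" "\<And>h. norm h < d \<Longrightarrow> \<bar>U (s + h) - U s - p \<bullet> h - TU h \<bullet> h / 2\<bar> \<le> \<eta> * (norm h)\<^sup>2"
    and TV: "linear TV" "\<And>k. norm k < d \<Longrightarrow> \<bar>V (t + k) - V t - q \<bullet> k - TV k \<bullet> k / 2\<bar> \<le> \<eta> * (norm k)\<^sup>2"
    and l: "\<And>h k. U (s + h) + V (t + k) - U s - V t
        \<le> l \<bullet> (h, k) + \<kappa> / 2 * (norm (h - k))\<^sup>2 + \<eta> / 2 * ((norm h)\<^sup>2 + (norm k)\<^sup>2)"
  shows "TU h \<bullet> h + TV k \<bullet> k \<le> \<kappa> * (norm (h - k))\<^sup>2 + 3 * \<eta> * ((norm h)\<^sup>2 + (norm k)\<^sup>2)"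
    and "- (\<kappa> + 2 * \<eta>) * (norm h)\<^sup>2 \<le> TU h \<bullet> h" "- (\<kappa> + 2 * \<eta>) * (norm k)\<^sup>2 \<le> TV k \<bullet> k"
proof -
  define f where "f z = TU (fst z) \<bullet> fst z + TV (snd z) \<bullet> snd z - \<kappa> * (norm (fst z - snd z))\<^sup>2
      - 3 * \<eta> * ((norm (fst z))\<^sup>2 + (norm (snd z))\<^sup>2)" for z :: "'a \<times> 'a"
  have "f (h, k) \<le> 0"
  proof (rule nonpos_if_small_and_homogeneous[where f = f, OF TU(2)])
    fix z :: "'a \<times> 'a" assume z: "norm z < d"
    define h where "h = fst z"
    define k where "k = snd z"
    have hk: "norm h < d" "norm k < d"
      using z norm_fst_le[of h k] norm_snd_le[of k h] by (auto simp: h_def k_def)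
    have 1: "p \<bullet> h + TU h \<bullet> h / 2 - \<eta> * (norm h)\<^sup>2 \<le> U (s + h) - U s"
      and 2: "- (p \<bullet> h) + TU h \<bullet> h / 2 - \<eta> * (norm h)\<^sup>2 \<le> U (s - h) - U s"
      using TU(3)[of h] TU(3)[of "- h"] hk by (auto simp: abs_le_iff linear_neg[OF TU(1)])
    have 3: "q \<bullet> k + TV k \<bullet> k / 2 - \<eta> * (norm k)\<^sup>2 \<le> V (t + k) - V t"
      and 4: "- (q \<bullet> k) + TV k \<bullet> k / 2 - \<eta> * (norm k)\<^sup>2 \<le> V (t - k) - V t"
      using TV(2)[of k] TV(2)[of "- k"] hk by (auto simp: abs_le_iff linear_neg[OF TV(1)])
    have 5: "U (s + h) + V (t + k) - U s - V t
        \<le> l \<bullet> (h, k) + \<kappa> / 2 * (norm (h - k))\<^sup>2 + \<eta> / 2 * ((norm h)\<^sup>2 + (norm k)\<^sup>2)"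
      by (rule l)
    have 6: "U (s - h) + V (t - k) - U s - V t
        \<le> - (l \<bullet> (h, k)) + \<kappa> / 2 * (norm (h - k))\<^sup>2 + \<eta> / 2 * ((norm h)\<^sup>2 + (norm k)\<^sup>2)"
    proof -
      have "(- h, - k) = - (h, k)" by simp
      then have "l \<bullet> (- h, - k) = - (l \<bullet> (h, k))" by (simp only: inner_minus_right)
      moreover have "norm (- h - - k) = norm (h - k)" by (metis minus_diff_minus norm_minus_cancel)
      ultimately show ?thesis using l[of "- h" "- k"] by simp
    qed
    show "f z \<le> 0"
      using 1 2 3 4 5 6 unfolding f_def h_def[symmetric] k_def[symmetric] by (simp add: algebra_simps)
  next
    fix c :: real and z :: "'a \<times> 'a"
    have n: "(norm (c *\<^sub>R fst z - c *\<^sub>R snd z))\<^sup>2 = c\<^sup>2 * (norm (fst z - snd z))\<^sup>2"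
      by (simp add: scaleR_right_diff_distrib[symmetric] power_mult_distrib)
    have T: "TU (c *\<^sub>R x) \<bullet> (c *\<^sub>R x) = c\<^sup>2 * (TU x \<bullet> x)" "TV (c *\<^sub>R x) \<bullet> (c *\<^sub>R x) = c\<^sup>2 * (TV x \<bullet> x)" for x
      by (simp_all add: linear_cmul[OF TU(1)] linear_cmul[OF TV(1)] power2_eq_square)
    show "f (c *\<^sub>R z) = c\<^sup>2 * f z"
      unfolding f_def fst_scaleR snd_scaleR n T norm_scaleR power_mult_distrib power2_abs by (simp add: algebra_simps)
  qed
  then show "TU h \<bullet> h + TV k \<bullet> k \<le> \<kappa> * (norm (h - k))\<^sup>2 + 3 * \<eta> * ((norm h)\<^sup>2 + (norm k)\<^sup>2)"
    by (simp add: f_def)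
  have low: "- (\<kappa> + 2 * \<eta>) * (norm h)\<^sup>2 \<le> T h \<bullet> h"
    if F: "supported_below (\<kappa> / 2) F" "second_order_jet F C x g" and T: "linear T"
      "\<And>h. norm h < d \<Longrightarrow> \<bar>F (x + h) - F x - g \<bullet> h - T h \<bullet> h / 2\<bar> \<le> \<eta> * (norm h)\<^sup>2"
    for F :: "'a \<Rightarrow> real" and x g T h
  proof -
    define f where "f h = - (\<kappa> + 2 * \<eta>) * (norm h)\<^sup>2 - T h \<bullet> h" for h
    have "f h \<le> 0"
    proof (rule nonpos_if_small_and_homogeneous[where f = f, OF TU(2)])
      fix h :: 'a assume h: "norm h < d"
      obtain g' where g': "\<And>y. F x + g' \<bullet> (y - x) - \<kappa> / 2 * (norm (y - x))\<^sup>2 \<le> F y"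
        using F(1) unfolding supported_below_def by blast
      have "(g' - g) \<bullet> h \<le> (\<kappa> / 2 + C) * (norm h)\<^sup>2" for h
        using g'[of "x + h"] F(2)[unfolded second_order_jet_def, rule_format, of "x + h"]
        by (simp add: inner_diff_left distrib_right)
      then have "g' = g" using inner_le_quadratic_imp_zero by (metis eq_iff_diff_eq_0)
      then show "f h \<le> 0"
        using g'[of "x + h"] T(2)[OF h] unfolding f_def by (simp add: abs_le_iff algebra_simps)
    next
      fix c h
      have "T (c *\<^sub>R h) \<bullet> (c *\<^sub>R h) = c\<^sup>2 * (T h \<bullet> h)"
        by (simp add: linear_cmul[OF T(1)] power2_eq_square)
      then show "f (c *\<^sub>R h) = c\<^sup>2 * f h"
        unfolding f_def norm_scaleR power_mult_distrib power2_abs by (simp add: algebra_simps)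
    qed
    then show ?thesis by (simp add: f_def)
  qed
  show "- (\<kappa> + 2 * \<eta>) * (norm h)\<^sup>2 \<le> TU h \<bullet> h" by (rule low[OF U jets(1) TU(1,3)])
  show "- (\<kappa> + 2 * \<eta>) * (norm k)\<^sup>2 \<le> TV k \<bullet> k" by (rule low[OF V jets(2) TV])
qed

text \<open>The magic property: a shift of \<open>t\<close> is compensated by the same shift of the maximiser \<open>s\<close>.\<close>

lemma sup_convolution_touching:
  fixes u :: "'a::euclidean_space \<Rightarrow> real"
  assumes S: "compact S" "S \<noteq> {}" and u: "usc_on S u"
    and s: "s \<in> S" "sup_convolution \<kappa> S u t = u s - \<kappa> / 2 * (norm (s - t))\<^sup>2"
    and up: "\<And>h. norm h < d \<Longrightarrow> sup_convolution \<kappa> S u (t + h) \<le> sup_convolution \<kappa> S u t + p \<bullet> h + T h \<bullet> h / 2 + \<eta> * (norm h)\<^sup>2"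
    and x: "x \<in> S" "norm (x - s) < d"
  shows "u x \<le> u s + p \<bullet> (x - s) + T (x - s) \<bullet> (x - s) / 2 + \<eta> * (norm (x - s))\<^sup>2"
proof -
  have "u x - \<kappa> / 2 * (norm (x - (t + (x - s))))\<^sup>2 \<le> sup_convolution \<kappa> S u (t + (x - s))"
    by (rule sup_convolution_attained(2)[OF S u x(1)])
  moreover have "x - (t + (x - s)) = s - t" by simp
  ultimately show ?thesis using up[OF x(2)] s(2) by simp
qed

text \<open>The competitor 0 bounds the value at the maximiser from below, the growth bound with
  \<open>\<kappa> / 6\<close> from above. As this growth is slower than the penalty
  \<open>\<kappa> / 2\<close>, the maximiser cannot stray from \<open>t\<close> by more than a
  multiple of \<open>norm t\<close>.\<close>

lemma sup_convolution_maximizer_close: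
  fixes u :: "'a::euclidean_space \<Rightarrow> real"
  assumes S: "compact S" "0 \<in> S" and u: "usc_on S u" "u 0 = 0" and \<kappa>: "0 < \<kappa>"
    and b: "u s \<le> \<kappa> / 6 * (norm s)\<^sup>2"
    and s: "s \<in> S" "sup_convolution \<kappa> S u t = u s - \<kappa> / 2 * (norm (s - t))\<^sup>2"
    and t: "norm t \<le> \<eta>" "\<eta> \<le> 1"
  shows "norm (s - t) \<le> 3 * \<eta>" "norm s \<le> 4 * \<eta>" "\<bar>u s\<bar> \<le> 3 * \<kappa> * \<eta>"
proof -
  have \<eta>0: "0 \<le> \<eta>" using t(1) norm_ge_zero order_trans by blast
  have "S \<noteq> {}" using S by blast
  from sup_convolution_attained(2)[OF S(1) this u(1) S(2), of \<kappa> t]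
  have lo: "- (\<kappa> / 2 * (norm t)\<^sup>2) \<le> u s - \<kappa> / 2 * (norm (s - t))\<^sup>2" using s(2) u(2) by simp
  have "\<kappa> * (3 * (norm (s - t))\<^sup>2) \<le> \<kappa> * ((norm s)\<^sup>2 + 3 * (norm t)\<^sup>2)" using lo b by (simp add: algebra_simps)
  then have 1: "3 * (norm (s - t))\<^sup>2 \<le> (norm s)\<^sup>2 + 3 * (norm t)\<^sup>2" using \<kappa> by simp
  have "(norm s)\<^sup>2 \<le> 2 * ((norm (s - t))\<^sup>2 + (norm t)\<^sup>2)" using norm_add_power2_le[of "s - t" t] by simp
  with 1 have "(norm (s - t))\<^sup>2 \<le> 5 * (norm t)\<^sup>2" by argo
  also have "\<dots> \<le> 9 * \<eta>\<^sup>2"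
  proof -
    have "(norm t)\<^sup>2 \<le> \<eta>\<^sup>2" using t(1) by (intro power_mono) auto
    then show ?thesis using zero_le_power2[of \<eta>] by linarith
  qed
  also have "\<dots> = (3 * \<eta>)\<^sup>2" by (simp add: power_mult_distrib)
  finally show 2: "norm (s - t) \<le> 3 * \<eta>" by (rule power2_le_imp_le) (use \<eta>0 in simp)
  show 3: "norm s \<le> 4 * \<eta>" using 2 t(1) norm_triangle_ineq[of "s - t" t] by simp
  have "(norm s)\<^sup>2 \<le> (4 * \<eta>)\<^sup>2" using 3 by (intro power_mono) auto
  also have "\<dots> = 16 * (\<eta> * \<eta>)" by (simp add: power2_eq_square)
  also have "\<dots> \<le> 16 * \<eta>" using \<eta>0 t(2) by (simp add: mult_left_le)
  finally have "\<kappa> / 6 * (norm s)\<^sup>2 \<le> \<kappa> / 6 * (16 * \<eta>)" using \<kappa> by (intro mult_left_mono) auto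
  also have "\<dots> \<le> 3 * \<kappa> * \<eta>" using \<kappa> \<eta>0 by (simp add: mult_nonneg_nonneg)
  finally have up: "u s \<le> 3 * \<kappa> * \<eta>" using b by linarith
  have "(norm t)\<^sup>2 \<le> \<eta>\<^sup>2" using t(1) by (intro power_mono) auto
  also have "\<dots> \<le> \<eta>" using \<eta>0 t(2) by (simp add: power2_eq_square mult_left_le)
  finally have "\<kappa> / 2 * (norm t)\<^sup>2 \<le> \<kappa> / 2 * \<eta>" using \<kappa> by (intro mult_left_mono) auto
  also have "\<dots> \<le> 3 * \<kappa> * \<eta>" using \<kappa> \<eta>0 by (simp add: mult_nonneg_nonneg)
  finally have "- (3 * \<kappa> * \<eta>) \<le> u s - \<kappa> / 2 * (norm (s - t))\<^sup>2" using lo by linarith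
  moreover have "0 \<le> \<kappa> / 2 * (norm (s - t))\<^sup>2" using \<kappa> by simp
  ultimately show "\<bar>u s\<bar> \<le> 3 * \<kappa> * \<eta>" using up by linarith
qed

text \<open>In the application \<open>\<kappa> = 3 / \<epsilon>\<close>. Because \<open>(a + b + c)\<^sup>2 \<le> 3 (a\<^sup>2 + b\<^sup>2 + c\<^sup>2)\<close>, the sup-convolutions with constant
  \<open>\<kappa>\<close> of functions with doubling penalty \<open>\<kappa> / 6\<close> satisfy the penalty bound \<open>\<kappa> / 2\<close>; this yields exactly the
  constant 3 of the structure condition.\<close>

theorem theorem_on_sums:
  fixes u v :: "'a::euclidean_space \<Rightarrow> real"
  assumes S: "compact S" "0 \<in> S" and u: "usc_on S u" "u 0 = 0"
    and T: "compact T" "0 \<in> T" and v: "usc_on T v" "v 0 = 0"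
    and \<kappa>: "0 < \<kappa>" and \<eta>: "0 < \<eta>"
    and uv: "\<And>s t. \<lbrakk>s \<in> S; t \<in> T\<rbrakk> \<Longrightarrow> u s + v t \<le> \<kappa> / 6 * (norm (s - t))\<^sup>2"
  obtains s t p q X Z d where "s \<in> S" "t \<in> T" "norm s \<le> \<eta>" "norm t \<le> \<eta>"
    "norm p \<le> \<eta>" "norm q \<le> \<eta>" "\<bar>u s\<bar> \<le> \<eta>" "\<bar>v t\<bar> \<le> \<eta>" "linear X" "linear Z"
    "\<And>h k. X h \<bullet> h + Z k \<bullet> k \<le> \<kappa> * (norm (h - k))\<^sup>2 + \<eta> * ((norm h)\<^sup>2 + (norm k)\<^sup>2)"
    "\<And>h. - (\<kappa> + \<eta>) * (norm h)\<^sup>2 \<le> X h \<bullet> h" "\<And>k. - (\<kappa> + \<eta>) * (norm k)\<^sup>2 \<le> Z k \<bullet> k"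
    "0 < d"
    "\<And>x. \<lbrakk>x \<in> S; norm (x - s) < d\<rbrakk> \<Longrightarrow> u x \<le> u s + p \<bullet> (x - s) + X (x - s) \<bullet> (x - s) / 2 + \<eta> * (norm (x - s))\<^sup>2"
    "\<And>x. \<lbrakk>x \<in> T; norm (x - t) < d\<rbrakk> \<Longrightarrow> v x \<le> v t + q \<bullet> (x - t) + Z (x - t) \<bullet> (x - t) / 2 + \<eta> * (norm (x - t))\<^sup>2"
proof -
  define U where "U = sup_convolution \<kappa> S u"
  define V where "V = sup_convolution \<kappa> T v"
  have ne: "S \<noteq> {}" "T \<noteq> {}" using S T by auto
  note Ua = sup_convolution_attained[OF S(1) ne(1) u(1), where \<kappa> = \<kappa>, folded U_def]
  note Va = sup_convolution_attained[OF T(1) ne(2) v(1), where \<kappa> = \<kappa>, folded V_def]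
  note Ul = sup_convolution_lower[OF S(1) ne(1) u(1), where \<kappa> = \<kappa>, folded U_def]
  note Vl = sup_convolution_lower[OF T(1) ne(2) v(1), where \<kappa> = \<kappa>, folded V_def]
  have sbU: "supported_below (\<kappa> / 2) U" unfolding supported_below_def using Ua(1) Ul by blast
  have sbV: "supported_below (\<kappa> / 2) V" unfolding supported_below_def using Va(1) Vl by blast
  have UV: "U s + V t \<le> \<kappa> / 2 * (norm (s - t))\<^sup>2" for s t
  proof -
    obtain a where a: "a \<in> S" "U s = u a - \<kappa> / 2 * (norm (a - s))\<^sup>2" using Ua(1) by blast
    obtain b where b: "b \<in> T" "V t = v b - \<kappa> / 2 * (norm (b - t))\<^sup>2" using Va(1) by blast
    have "a - b = (a - s) + (s - t) + (t - b)" by simp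
    then have "(norm (a - b))\<^sup>2 \<le> 3 * ((norm (a - s))\<^sup>2 + (norm (s - t))\<^sup>2 + (norm (b - t))\<^sup>2)"
      using norm_add3_power2_le[of "a - s" "s - t" "t - b"] by (simp add: norm_minus_commute)
    then have "\<kappa> / 6 * (norm (a - b))\<^sup>2 \<le> \<kappa> / 6 * (3 * ((norm (a - s))\<^sup>2 + (norm (s - t))\<^sup>2 + (norm (b - t))\<^sup>2))"
      using \<kappa> by (intro mult_left_mono) auto
    then show ?thesis using uv[OF a(1) b(1)] a(2) b(2) by (simp add: algebra_simps)
  qed
  have "0 \<le> U 0" "0 \<le> V 0" using Ua(2)[OF S(2), of 0] Va(2)[OF T(2), of 0] u v by auto
  then have U0: "U 0 = 0" and V0: "V 0 = 0" using UV[of 0 0] by auto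
  \<comment> \<open>Slopes and values are bounded by \<open>3 * \<kappa> * \<epsilon>\<close>,
    positions and Hessian errors by at most \<open>4 * \<epsilon>\<close>; this choice puts all of
    them below \<open>\<eta>\<close>.\<close>
  define \<epsilon> where "\<epsilon> = min 1 (\<eta> / (3 * \<kappa> + 4))"
  have \<epsilon>: "0 < \<epsilon>" "\<epsilon> \<le> 1" using \<kappa> \<eta> by (auto simp: \<epsilon>_def)
  have "\<epsilon> \<le> \<eta> / (3 * \<kappa> + 4)" by (simp add: \<epsilon>_def)
  then have "(3 * \<kappa> + 4) * \<epsilon> \<le> \<eta>" using \<kappa> by (simp add: field_simps add_pos_pos)
  then have big: "3 * \<kappa> * \<epsilon> + 4 * \<epsilon> \<le> \<eta>" by (simp add: algebra_simps)
  have "0 < \<kappa> * \<epsilon>" using \<kappa> \<epsilon> by simp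
  then have small: "3 * \<kappa> * \<epsilon> \<le> \<eta>" "4 * \<epsilon> \<le> \<eta>" "\<kappa> * (3 * \<epsilon>) \<le> \<eta>" using big \<epsilon> by auto
  obtain s' t' p q l where st: "norm s' \<le> \<epsilon>" "norm t' \<le> \<epsilon>"
    and U: "second_order_jet U (\<kappa> + \<epsilon>) s' p" "second_order_approx U s' p"
    and V: "second_order_jet V (\<kappa> + \<epsilon>) t' q" "second_order_approx V t' q"
    and l: "\<And>h k. U (s' + h) + V (t' + k) - U s' - V t'
        \<le> l \<bullet> (h, k) + \<kappa> / 2 * (norm (h - k))\<^sup>2 + \<epsilon> / 2 * ((norm h)\<^sup>2 + (norm k)\<^sup>2)"
    by (rule contact_point_with_second_order_approx[OF sbU U0 sbV V0 \<kappa> UV \<epsilon>(1)]) blast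
  obtain X d1 where X: "linear X" "d1 > 0"
    "\<And>h. norm h < d1 \<Longrightarrow> \<bar>U (s' + h) - U s' - p \<bullet> h - X h \<bullet> h / 2\<bar> \<le> \<epsilon> * (norm h)\<^sup>2"
    using U(2) \<epsilon>(1) unfolding second_order_approx_def by meson
  obtain Z d2 where Z: "linear Z" "d2 > 0"
    "\<And>h. norm h < d2 \<Longrightarrow> \<bar>V (t' + h) - V t' - q \<bullet> h - Z h \<bullet> h / 2\<bar> \<le> \<epsilon> * (norm h)\<^sup>2"
    using V(2) \<epsilon>(1) unfolding second_order_approx_def by meson
  define d where "d = min d1 d2"
  have d: "0 < d" using X Z by (simp add: d_def)
  have Xd: "\<bar>U (s' + h) - U s' - p \<bullet> h - X h \<bullet> h / 2\<bar> \<le> \<epsilon> * (norm h)\<^sup>2"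
    and Zd: "\<bar>V (t' + h) - V t' - q \<bullet> h - Z h \<bullet> h / 2\<bar> \<le> \<epsilon> * (norm h)\<^sup>2" if "norm h < d" for h
    using X(3) Z(3) that by (auto simp: d_def)
  note hess = hessian_bounds_at_contact_point[OF sbU sbV \<kappa> \<epsilon>(1) U(1)
      V(1)[unfolded second_order_jet_def, folded second_order_jet_def] X(1) d Xd Z(1) Zd l]
  obtain s where s: "s \<in> S" "U s' = u s - \<kappa> / 2 * (norm (s - s'))\<^sup>2" using Ua(1) by blast
  obtain t where t: "t \<in> T" "V t' = v t - \<kappa> / 2 * (norm (t - t'))\<^sup>2" using Va(1) by blast
  have "u s \<le> \<kappa> / 6 * (norm s)\<^sup>2" using uv[OF s(1) T(2)] v(2) by simp
  note sc = sup_convolution_maximizer_close[OF S u \<kappa> this s[unfolded U_def] st(1) \<epsilon>(2)]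
  have "v t \<le> \<kappa> / 6 * (norm t)\<^sup>2" using uv[OF S(2) t(1)] u(2) by simp
  note tc = sup_convolution_maximizer_close[OF T v \<kappa> this t[unfolded V_def] st(2) \<epsilon>(2)]
  \<comment> \<open>By uniqueness of the slope, \<open>p\<close> and \<open>q\<close> equal
    \<open>\<kappa>\<close> times the displacement of the maximiser, and are small with it.\<close>
  have grad: "norm g \<le> \<kappa> * (3 * \<epsilon>)"
    if jet: "second_order_jet F C x g" and low: "\<And>y. F x + (\<kappa> *\<^sub>R w) \<bullet> (y - x) - \<kappa> / 2 * (norm (y - x))\<^sup>2 \<le> F y"
      and w: "norm w \<le> 3 * \<epsilon>" for F :: "'a \<Rightarrow> real" and C x g w
  proof -
    have "(\<kappa> *\<^sub>R w - g) \<bullet> h \<le> (\<kappa> / 2 + C) * (norm h)\<^sup>2" for h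
      using low[of "x + h"] jet[unfolded second_order_jet_def, rule_format, of "x + h"]
      by (simp add: inner_diff_left distrib_right)
    then have "g = \<kappa> *\<^sub>R w" using inner_le_quadratic_imp_zero by (metis eq_iff_diff_eq_0)
    then show ?thesis using w \<kappa> by simp
  qed
  have pn: "norm p \<le> \<kappa> * (3 * \<epsilon>)" by (rule grad[OF U(1) Ul[OF s] sc(1)])
  have qn: "norm q \<le> \<kappa> * (3 * \<epsilon>)" by (rule grad[OF V(1) Vl[OF t] tc(1)])
  have wk: "\<epsilon> * (norm h)\<^sup>2 \<le> \<eta> * (norm h)\<^sup>2" "2 * \<epsilon> * (norm h)\<^sup>2 \<le> \<eta> * (norm h)\<^sup>2"
    "3 * \<epsilon> * (norm h)\<^sup>2 \<le> \<eta> * (norm h)\<^sup>2" for h :: 'a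
    using small(2) \<epsilon>(1) by (auto intro!: mult_right_mono)
  show ?thesis
  proof (rule that[of s t p q X Z d])
    show "X h \<bullet> h + Z k \<bullet> k \<le> \<kappa> * (norm (h - k))\<^sup>2 + \<eta> * ((norm h)\<^sup>2 + (norm k)\<^sup>2)" for h k
      using hess(1)[of h k] wk(3)[of h] wk(3)[of k] by (simp add: algebra_simps)
    show "- (\<kappa> + \<eta>) * (norm h)\<^sup>2 \<le> X h \<bullet> h" "- (\<kappa> + \<eta>) * (norm h)\<^sup>2 \<le> Z h \<bullet> h" for h
      using hess(2,3)[of h] wk(2)[of h] by (simp_all add: algebra_simps)
    show "u x \<le> u s + p \<bullet> (x - s) + X (x - s) \<bullet> (x - s) / 2 + \<eta> * (norm (x - s))\<^sup>2"
      if x: "x \<in> S" "norm (x - s) < d" for x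
    proof -
      have "u x \<le> u s + p \<bullet> (x - s) + X (x - s) \<bullet> (x - s) / 2 + \<epsilon> * (norm (x - s))\<^sup>2"
        by (rule sup_convolution_touching[OF S(1) ne(1) u(1) s[unfolded U_def] _ x])
          (use Xd in \<open>force simp: U_def abs_le_iff\<close>)
      then show ?thesis using wk(1)[of "x - s"] by linarith
    qed
    show "v x \<le> v t + q \<bullet> (x - t) + Z (x - t) \<bullet> (x - t) / 2 + \<eta> * (norm (x - t))\<^sup>2"
      if x: "x \<in> T" "norm (x - t) < d" for x
    proof -
      have "v x \<le> v t + q \<bullet> (x - t) + Z (x - t) \<bullet> (x - t) / 2 + \<epsilon> * (norm (x - t))\<^sup>2"
        by (rule sup_convolution_touching[OF T(1) ne(2) v(1) t[unfolded V_def] _ x])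
          (use Zd in \<open>force simp: V_def abs_le_iff\<close>)
      then show ?thesis using wk(1)[of "x - t"] by linarith
    qed
  qed (use s t sc tc small pn qn X Z d in auto)
qed

section \<open>Symmetric matrices\<close>

lemma inner_transpose_matrix:
  fixes A :: "real ^ 'n ^ 'm"
  shows "(transpose A *v x) \<bullet> y = x \<bullet> (A *v y)"
  by (metis dot_lmul_matrix transpose_matrix_vector)

lemma sym_mats_inner: "A \<in> sym_mats \<Longrightarrow> (A *v x) \<bullet> y = x \<bullet> (A *v y)"
  using inner_transpose_matrix[of A x y] by (simp add: sym_mats_def)

lemma sym_matsI:
  assumes "\<And>i j. A $ i $ j = A $ j $ i"
  shows "A \<in> sym_mats"
  using assms by (simp add: sym_mats_def transpose_def vec_eq_iff)

lemma sym_matsD: "A \<in> sym_mats \<Longrightarrow> A $ i $ j = A $ j $ i"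
  unfolding sym_mats_def transpose_def by (metis (mono_tags) mem_Collect_eq vec_lambda_beta)

lemma sym_mats_closed:
  "A \<in> sym_mats \<Longrightarrow> B \<in> sym_mats \<Longrightarrow> A + B \<in> sym_mats"
  "A \<in> sym_mats \<Longrightarrow> B \<in> sym_mats \<Longrightarrow> A - B \<in> sym_mats"
  "A \<in> sym_mats \<Longrightarrow> - A \<in> sym_mats"
  "A \<in> sym_mats \<Longrightarrow> c *\<^sub>R A \<in> sym_mats"
  by (auto intro!: sym_matsI) (metis sym_matsD)+

lemma mat_sym_mats [simp]: "mat c \<in> sym_mats"
  by (auto intro!: sym_matsI simp: mat_def)

lemma axis_inner_matrix: "axis i 1 \<bullet> (A *v axis j (1::real)) = A $ i $ j"
  by (simp add: inner_axis' matrix_vector_mul_component inner_axis)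

lemma scaleR_matrix_vector: "(c *\<^sub>R A) *v x = c *\<^sub>R (A *v (x :: real ^ 'n))"
  by (metis scaleR_matrix_vector_assoc)

lemma norm_matrix_vector_le:
  fixes A :: "real ^ 'n ^ 'm"
  shows "norm (A *v x) \<le> norm A * norm x"
proof -
  have "norm (A *v x) = L2_set (\<lambda>i. A $ i \<bullet> x) UNIV"
    by (simp add: matrix_mult_dot norm_vec_def L2_set_def)
  also have "\<dots> \<le> L2_set (\<lambda>i. norm (A $ i) * norm x) UNIV"
    unfolding L2_set_def
    by (intro real_sqrt_le_mono sum_mono) (metis Cauchy_Schwarz_ineq2 abs_ge_zero power2_abs power_mono)
  also have "\<dots> = norm A * norm x"
    unfolding norm_vec_def[of A] by (rule L2_set_left_distrib[symmetric]) simp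
  finally show ?thesis .
qed

lemma quadratic_form_le_norm: "\<bar>x \<bullet> (A *v x)\<bar> \<le> norm A * (norm (x :: real ^ 'n))\<^sup>2"
proof -
  have "\<bar>x \<bullet> (A *v x)\<bar> \<le> norm x * norm (A *v x)" by (rule Cauchy_Schwarz_ineq2)
  also have "\<dots> \<le> norm x * (norm A * norm x)" by (intro mult_left_mono norm_matrix_vector_le) auto
  finally show ?thesis by (simp add: power2_eq_square mult_ac)
qed

text \<open>Polarisation recovers the entries from the quadratic form. A crude constant is enough,
  as the bound serves only to extract convergent Hessians.\<close>

lemma norm_sym_mats_le:
  fixes A :: "real ^ 'n ^ 'n"
  assumes A: "A \<in> sym_mats" and b: "\<And>x. \<bar>x \<bullet> (A *v x)\<bar> \<le> B * (norm x)\<^sup>2"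
  shows "norm A \<le> real CARD('n) * (real CARD('n) * (3 * B))"
proof -
  have "\<bar>A $ i $ j\<bar> \<le> 3 * B" for i j
  proof -
    define e f :: "real ^ 'n" where "e = axis i 1" and "f = axis j 1"
    have "(e + f) \<bullet> (A *v (e + f)) = e \<bullet> (A *v e) + f \<bullet> (A *v f) + 2 * (e \<bullet> (A *v f))"
      using sym_mats_inner[OF A, of f e]
      by (simp add: matrix_vector_right_distrib inner_add_left inner_add_right inner_commute)
    moreover have B: "0 \<le> B" using b[of e] by (simp add: e_def)
    have "(norm (e + f))\<^sup>2 \<le> 2 * ((norm e)\<^sup>2 + (norm f)\<^sup>2)" by (rule norm_add_power2_le)
    then have "(norm (e + f))\<^sup>2 \<le> 4" by (simp add: e_def f_def)
    then have "B * (norm (e + f))\<^sup>2 \<le> B * 4" using B by (rule mult_left_mono)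
    then have "\<bar>(e + f) \<bullet> (A *v (e + f))\<bar> \<le> 4 * B" using b[of "e + f"] by linarith
    moreover have "\<bar>e \<bullet> (A *v e)\<bar> \<le> B" "\<bar>f \<bullet> (A *v f)\<bar> \<le> B" using b[of e] b[of f] by (auto simp: e_def f_def)
    moreover have "e \<bullet> (A *v f) = A $ i $ j" by (simp add: e_def f_def axis_inner_matrix)
    ultimately show ?thesis by linarith
  qed
  then have row: "norm (A $ i) \<le> real CARD('n) * (3 * B)" for i
    using norm_le_l1_cart[of "A $ i"] sum_mono[of UNIV "\<lambda>j. \<bar>A $ i $ j\<bar>" "\<lambda>_. 3 * B"] by (simp add: order_trans)
  have "norm A \<le> (\<Sum>i\<in>UNIV. norm (A $ i))"
    unfolding norm_vec_def by (rule L2_set_le_sum) simp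
  also have "\<dots> \<le> (\<Sum>i\<in>(UNIV :: 'n set). real CARD('n) * (3 * B))" by (rule sum_mono[OF row])
  finally show ?thesis by simp
qed

subsection \<open>Monotonicity of the determinant\<close>

definition outer_product :: "real ^ 'm \<Rightarrow> real ^ 'n \<Rightarrow> real ^ 'n ^ 'm" where
  "outer_product d c = (\<chi> i j. d $ i * c $ j)"

lemma outer_product_mult: "outer_product d c *v x = (c \<bullet> x) *\<^sub>R d"
  by (simp add: outer_product_def vec_eq_iff matrix_vector_mult_def inner_vec_def sum_distrib_left mult_ac)

text \<open>The matrix determinant lemma. An orthogonal change of basis makes \<open>c\<close> a
  multiple of an axis vector; then a single column of the identity changes, and Cramer's lemma
  evaluates the determinant.\<close>

lemma det_mat_1_add_outer_product:
  fixes c d :: "real ^ 'n"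
  shows "det (mat 1 + outer_product d c) = 1 + c \<bullet> d"
proof (cases "c = 0")
  case True
  then have "outer_product d c = 0" by (simp add: outer_product_def vec_eq_iff)
  then show ?thesis using True by simp
next
  case False
  fix k :: 'n
  define a where "a = (1 / norm c) *\<^sub>R c"
  have "norm a = 1" using False by (simp add: a_def)
  then obtain Q where Q: "orthogonal_matrix Q" "Q *v axis k 1 = a"
    using orthogonal_matrix_exists_basis by blast
  have QQ: "transpose Q ** Q = mat 1" "Q ** transpose Q = mat 1" using Q(1) by (auto simp: orthogonal_matrix_def)
  define \<alpha> where "\<alpha> = norm c"
  define d' where "d' = transpose Q *v d"
  have c: "c = \<alpha> *\<^sub>R (Q *v axis k 1)" using False Q(2) by (simp add: a_def \<alpha>_def)
  have cQ: "transpose Q *v c = \<alpha> *\<^sub>R axis k 1"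
    unfolding c by (simp add: matrix_vector_mult_scaleR matrix_vector_mul_assoc QQ)
  have eq: "transpose Q ** (mat 1 + outer_product d c) ** Q = mat 1 + outer_product d' (\<alpha> *\<^sub>R axis k 1)"
  proof (subst matrix_eq, intro allI)
    fix x :: "real ^ 'n"
    have "(transpose Q ** (mat 1 + outer_product d c) ** Q) *v x = transpose Q *v (Q *v x + (c \<bullet> (Q *v x)) *\<^sub>R d)"
      by (simp add: matrix_vector_mul_assoc[symmetric] matrix_vector_mult_add_rdistrib outer_product_mult)
    also have "\<dots> = x + (c \<bullet> (Q *v x)) *\<^sub>R d'"
      by (simp add: matrix_vector_right_distrib matrix_vector_mul_assoc QQ matrix_vector_mult_scaleR d'_def)
    also have "c \<bullet> (Q *v x) = (\<alpha> *\<^sub>R axis k 1) \<bullet> x"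
      using inner_transpose_matrix[of Q c x] cQ by simp
    finally show "(transpose Q ** (mat 1 + outer_product d c) ** Q) *v x = (mat 1 + outer_product d' (\<alpha> *\<^sub>R axis k 1)) *v x"
      by (simp add: matrix_vector_mult_add_rdistrib outer_product_mult)
  qed
  define x where "x = axis k 1 + \<alpha> *\<^sub>R d'"
  have "mat 1 + outer_product d' (\<alpha> *\<^sub>R axis k 1) = (\<chi> i j. if j = k then (mat 1 *v x) $ i else (mat 1 :: real ^ 'n ^ 'n) $ i $ j)"
    by (simp only: matrix_vector_mul_lid) (auto simp: vec_eq_iff outer_product_def mat_def x_def axis_def)
  then have "det (mat 1 + outer_product d' (\<alpha> *\<^sub>R axis k 1)) = x $ k * det (mat 1 :: real ^ 'n ^ 'n)"
    using cramer_lemma[of k "mat 1" x] by simp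
  also have "\<dots> = 1 + \<alpha> * d' $ k" by (simp add: x_def)
  also have "\<alpha> * d' $ k = (\<alpha> *\<^sub>R axis k 1) \<bullet> d'" by (simp add: inner_axis')
  also have "\<dots> = c \<bullet> d"
    unfolding cQ[symmetric] d'_def
    by (metis inner_transpose_matrix matrix_vector_mul_assoc QQ(2) matrix_vector_mul_lid)
  finally have 1: "det (transpose Q ** (mat 1 + outer_product d c) ** Q) = 1 + c \<bullet> d" using eq by simp
  have "det (transpose Q) * det Q = 1" using QQ(1) by (metis det_I det_mul)
  moreover have "det (transpose Q ** (mat 1 + outer_product d c) ** Q)
      = (det (transpose Q) * det Q) * det (mat 1 + outer_product d c)"
    by (simp only: det_mul mult_ac)
  ultimately show ?thesis using 1 by simp
qed

text \<open>Factoring out \<open>A\<close> leaves 1 plus the quadratic form of its inverse at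
  \<open>c\<close>. Positivity of \<open>det A\<close> is assumed because for matrices above a
  multiple of the identity it is itself derived from the monotonicity built on this step.\<close>

lemma det_add_outer_product_ge:
  fixes A :: "real ^ 'n ^ 'n"
  assumes A: "pos_definite A" "0 < det A"
  shows "det A \<le> det (A + outer_product c c)"
proof -
  have "invertible A" using A(2) by (simp add: invertible_det_nz)
  then obtain B where B: "A ** B = mat 1" unfolding invertible_def by blast
  define y where "y = B *v c"
  have Ay: "A *v y = c" by (simp add: y_def matrix_vector_mul_assoc B)
  have "A + outer_product c c = A ** (mat 1 + outer_product y c)"
    by (subst matrix_eq) (simp add: matrix_vector_mult_add_rdistrib outer_product_mult matrix_vector_mul_assoc[symmetric]
        matrix_vector_right_distrib matrix_vector_mult_scaleR Ay)
  then have "det (A + outer_product c c) = det A * (1 + c \<bullet> y)"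
    by (simp add: det_mul det_mat_1_add_outer_product)
  moreover have "0 \<le> y \<bullet> (A *v y)"
    using A(1) by (cases "y = 0") (auto simp: pos_definite_def less_imp_le)
  then have "0 \<le> c \<bullet> y" by (simp add: Ay inner_commute)
  ultimately show ?thesis using A(2) by (simp add: distrib_left)
qed

definition psd :: "real ^ 'n ^ 'n \<Rightarrow> bool" where
  "psd A \<longleftrightarrow> A \<in> sym_mats \<and> (\<forall>x. 0 \<le> x \<bullet> (A *v x))"

lemma psd_Cauchy_Schwarz:
  assumes "psd C"
  shows "(x \<bullet> (C *v y))\<^sup>2 \<le> (x \<bullet> (C *v x)) * (y \<bullet> (C *v y))"
proof -
  have q: "0 \<le> x \<bullet> (C *v x) + 2 * t * (x \<bullet> (C *v y)) + t\<^sup>2 * (y \<bullet> (C *v y))" for t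
  proof -
    have "0 \<le> (x + t *\<^sub>R y) \<bullet> (C *v (x + t *\<^sub>R y))" using assms by (simp add: psd_def)
    also have "\<dots> = x \<bullet> (C *v x) + 2 * t * (x \<bullet> (C *v y)) + t\<^sup>2 * (y \<bullet> (C *v y))"
      using sym_mats_inner[of C y x] assms
      by (simp add: psd_def matrix_vector_right_distrib matrix_vector_mult_scaleR inner_add_left inner_add_right
          inner_commute power2_eq_square algebra_simps)
    finally show ?thesis .
  qed
  define a b c where "a = x \<bullet> (C *v x)" and "b = x \<bullet> (C *v y)" and "c = y \<bullet> (C *v y)"
  have c: "0 \<le> c" "0 \<le> a" using assms by (auto simp: c_def a_def psd_def)
  have q': "0 \<le> a + 2 * t * b + t\<^sup>2 * c" for t using q by (simp add: a_def b_def c_def)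
  have "b\<^sup>2 \<le> a * c"
  proof (cases "c = 0")
    case True
    have "b = 0"
    proof (rule ccontr)
      assume "b \<noteq> 0"
      then show False using q'[of "- (a + 1) / (2 * b)"] True by (simp add: field_simps)
    qed
    then show ?thesis using True by simp
  next
    case False
    then have "c > 0" using c by simp
    have "0 \<le> a + 2 * (- b / c) * b + (- b / c)\<^sup>2 * c" by (rule q')
    also have "\<dots> = a - b\<^sup>2 / c" using \<open>c > 0\<close> by (simp add: power2_eq_square field_simps)
    finally show ?thesis using \<open>c > 0\<close> by (simp add: field_simps)
  qed
  then show ?thesis by (simp add: a_def b_def c_def)
qed

text \<open>A positive semidefinite matrix is a sum of rank-one matrices: subtracting a suitable one
  makes a diagonal entry, and with it a whole row and column, vanish.\<close>

lemma det_add_psd_ge: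
  fixes A C :: "real ^ 'n ^ 'n"
  assumes "pos_definite A" "0 < det A" "psd C"
  shows "det A \<le> det (A + C)"
  using assms
\<comment> \<open>A vanishing diagonal entry kills its row and column by Cauchy-Schwarz, so the
  number of nonzero diagonal entries measures what is left.\<close>
proof (induction "card {i. C $ i $ i \<noteq> 0}" arbitrary: A C rule: less_induct)
  case less
  note C = \<open>psd C\<close>
  have CS: "(C $ i $ j)\<^sup>2 \<le> (C $ i $ i) * (C $ j $ j)" for i j
    using psd_Cauchy_Schwarz[OF C, of "axis i 1" "axis j 1"] by (simp add: axis_inner_matrix)
  show ?case
  proof (cases "{i. C $ i $ i \<noteq> 0} = {}")
    case True
    have "C $ i $ j = 0" for i j using CS[of i j] True by simp
    then have "C = 0" by (simp add: vec_eq_iff)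
    then show ?thesis by simp
  next
    case False
    then obtain k where k: "C $ k $ k \<noteq> 0" by blast
    define e :: "real ^ 'n" where "e = axis k 1"
    have "0 \<le> e \<bullet> (C *v e)" using C by (simp add: psd_def)
    then have ck: "0 < C $ k $ k" using k by (simp add: e_def axis_inner_matrix)
    \<comment> \<open>Chosen so that the rank-one matrix agrees with \<open>C\<close> in row and
      column \<open>k\<close>; the remainder is semidefinite by Cauchy-Schwarz.\<close>
    define w where "w = (1 / sqrt (C $ k $ k)) *\<^sub>R (C *v e)"
    define C' where "C' = C - outer_product w w"
    have Cs: "C \<in> sym_mats" using C by (simp add: psd_def)
    have os: "outer_product w w \<in> sym_mats" by (rule sym_matsI) (simp add: outer_product_def)
    have qo: "x \<bullet> (outer_product w w *v x) = (x \<bullet> (C *v e))\<^sup>2 / C $ k $ k" for x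
      using ck by (simp add: outer_product_mult w_def inner_commute power2_eq_square real_sqrt_mult_self)
    have qC': "x \<bullet> (C' *v x) = x \<bullet> (C *v x) - (x \<bullet> (C *v e))\<^sup>2 / C $ k $ k" for x
      using qo[of x] by (simp add: C'_def matrix_vector_mult_diff_rdistrib inner_diff_right)
    have C': "psd C'"
      unfolding psd_def
    proof (intro conjI allI)
      show "C' \<in> sym_mats" unfolding C'_def by (rule sym_mats_closed(2)[OF Cs os])
      fix x
      have "(x \<bullet> (C *v e))\<^sup>2 \<le> (x \<bullet> (C *v x)) * (C $ k $ k)"
        using psd_Cauchy_Schwarz[OF C, of x e] by (simp add: e_def axis_inner_matrix)
      then show "0 \<le> x \<bullet> (C' *v x)" unfolding qC' using ck by (simp add: field_simps)
    qed
    have diag: "C' $ i $ i = C $ i $ i - (C $ i $ k)\<^sup>2 / C $ k $ k" for i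
      using qC'[of "axis i 1"] by (simp add: axis_inner_matrix e_def)
    have "{i. C' $ i $ i \<noteq> 0} \<subseteq> {i. C $ i $ i \<noteq> 0} - {k}"
    proof
      fix i assume i: "i \<in> {i. C' $ i $ i \<noteq> 0}"
      have "i \<noteq> k" using i ck by (auto simp: diag power2_eq_square)
      moreover have "C $ i $ i \<noteq> 0"
      proof
        assume z: "C $ i $ i = 0"
        then have "C $ i $ k = 0" using CS[of i k] by simp
        then show False using i z by (simp add: diag)
      qed
      ultimately show "i \<in> {i. C $ i $ i \<noteq> 0} - {k}" by simp
    qed
    then have "{i. C' $ i $ i \<noteq> 0} \<subset> {i. C $ i $ i \<noteq> 0}" using k by blast
    then have card: "card {i. C' $ i $ i \<noteq> 0} < card {i. C $ i $ i \<noteq> 0}"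
      by (intro psubset_card_mono) auto
    have 1: "det A \<le> det (A + outer_product w w)" by (rule det_add_outer_product_ge[OF less.prems(1,2)])
    have "pos_definite (A + outer_product w w)"
      unfolding pos_definite_def
    proof (intro conjI allI impI)
      show "A + outer_product w w \<in> sym_mats"
        using less.prems(1) os sym_mats_closed(1) by (auto simp: pos_definite_def)
      fix x :: "real ^ 'n" assume "x \<noteq> 0"
      then have "0 < x \<bullet> (A *v x)" using less.prems(1) by (simp add: pos_definite_def)
      moreover have "0 \<le> x \<bullet> (outer_product w w *v x)" unfolding qo using ck by simp
      ultimately show "0 < x \<bullet> ((A + outer_product w w) *v x)"
        by (simp add: matrix_vector_mult_add_rdistrib inner_add_right)
    qed
    then have "det (A + outer_product w w) \<le> det (A + outer_product w w + C')"
      using 1 less.prems(2) by (intro less.hyps card C') auto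
    moreover have "A + outer_product w w + C' = A + C" by (simp add: C'_def)
    ultimately show ?thesis using 1 by simp
  qed
qed

lemma det_scaleR_matrix: "det (c *\<^sub>R (A :: real ^ 'n ^ 'n)) = c ^ CARD('n) * det A"
proof -
  have "c *\<^sub>R A = matrix ((*\<^sub>R) c) ** A"
    by (subst matrix_eq) (simp add: matrix_vector_mul_assoc[symmetric] scaleR_matrix_vector
        matrix_works linear_matrix_vector_mul_eq)
  then show ?thesis by (simp only: det_mul det_matrix_scaleR)
qed

lemma loewner_le_scaleR_mat_1:
  "c *\<^sub>R mat 1 \<preceq> A \<longleftrightarrow> A \<in> sym_mats \<and> (\<forall>x. c * (norm x)\<^sup>2 \<le> x \<bullet> (A *v x))"
  by (auto simp: loewner_le_def scaleR_matrix_vector sym_mats_closed power2_norm_eq_inner)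

text \<open>The multiple of the identity has an explicit positive determinant, and \<open>A\<close>
  exceeds it by a semidefinite matrix.\<close>

lemma pos_definite_if_ge_mat:
  fixes A :: "real ^ 'n ^ 'n"
  assumes "0 < c" "c *\<^sub>R mat 1 \<preceq> A"
  shows "pos_definite A" "0 < det A"
proof -
  have A: "A \<in> sym_mats" "\<And>x. c * (norm x)\<^sup>2 \<le> x \<bullet> (A *v x)" using assms(2) by (auto simp: loewner_le_scaleR_mat_1)
  have p: "0 < x \<bullet> (A *v x)" if "x \<noteq> 0" for x
    using A(2)[of x] that assms(1) by (smt (verit) mult_pos_pos zero_less_norm_iff zero_less_power)
  then show "pos_definite A" using A(1) by (simp add: pos_definite_def)
  define I where "I = c *\<^sub>R (mat 1 :: real ^ 'n ^ 'n)"
  have Is: "I \<in> sym_mats" by (simp add: I_def sym_mats_closed)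
  have "pos_definite I"
    using assms(1) Is by (auto simp: I_def pos_definite_def scaleR_matrix_vector)
  moreover have dI: "0 < det I" using assms(1) by (simp add: I_def det_scaleR_matrix)
  moreover have "psd (A - I)"
    unfolding psd_def using sym_mats_closed(2)[OF A(1) Is] A(2)
    by (simp add: matrix_vector_mult_diff_rdistrib inner_diff_right I_def scaleR_matrix_vector power2_norm_eq_inner)
  ultimately have "det I \<le> det (I + (A - I))" by (rule det_add_psd_ge)
  then show "0 < det A" using dI by simp
qed

text \<open>As \<open>B\<close> is at least \<open>\<gamma> - \<delta>\<close> times the identity,
  the additive error is absorbed by a multiple of \<open>B\<close>: \<open>A\<close> lies below
  \<open>\<gamma> / (\<gamma> - \<delta>)\<close> times \<open>B\<close>. The logarithm turns this
  factor into a term that vanishes with \<open>\<delta>\<close>.\<close>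

lemma ln_det_le:
  fixes A B :: "real ^ 'm ^ 'm"
  assumes A: "\<gamma> *\<^sub>R mat 1 \<preceq> A" and B: "B \<in> sym_mats" and \<delta>: "0 \<le> \<delta>" "\<delta> < \<gamma>"
    and AB: "\<And>x. x \<bullet> (A *v x) \<le> x \<bullet> (B *v x) + \<delta> * (norm x)\<^sup>2"
  shows "(\<gamma> - \<delta>) *\<^sub>R mat 1 \<preceq> B" and "ln (det A) \<le> real CARD('m) * ln (\<gamma> / (\<gamma> - \<delta>)) + ln (det B)"
proof -
  have As: "A \<in> sym_mats" "\<And>x. \<gamma> * (norm x)\<^sup>2 \<le> x \<bullet> (A *v x)" using A by (auto simp: loewner_le_scaleR_mat_1)
  have Bx: "(\<gamma> - \<delta>) * (norm x)\<^sup>2 \<le> x \<bullet> (B *v x)" for x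
    using As(2)[of x] AB[of x] by (simp add: left_diff_distrib)
  then show B': "(\<gamma> - \<delta>) *\<^sub>R mat 1 \<preceq> B" using B by (simp add: loewner_le_scaleR_mat_1)
  define c where "c = \<gamma> / (\<gamma> - \<delta>)"
  have c: "c > 0" "c = 1 + \<delta> / (\<gamma> - \<delta>)" using \<delta> by (auto simp: c_def field_simps)
  have dA: "0 < det A" "pos_definite A" using pos_definite_if_ge_mat[OF _ A] \<delta> by auto
  have dB: "0 < det B" using pos_definite_if_ge_mat[OF _ B'] \<delta> by auto
  have "psd (c *\<^sub>R B - A)"
    unfolding psd_def
  proof (intro conjI allI)
    show "c *\<^sub>R B - A \<in> sym_mats" by (intro sym_mats_closed B As(1))
    fix x
    have "\<delta> / (\<gamma> - \<delta>) * ((\<gamma> - \<delta>) * (norm x)\<^sup>2) \<le> \<delta> / (\<gamma> - \<delta>) * (x \<bullet> (B *v x))"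
      using \<delta> by (intro mult_left_mono Bx) auto
    then have "\<delta> * (norm x)\<^sup>2 \<le> \<delta> / (\<gamma> - \<delta>) * (x \<bullet> (B *v x))" using \<delta> by simp
    then have "x \<bullet> (A *v x) \<le> c * (x \<bullet> (B *v x))"
      using AB[of x] unfolding c(2) distrib_right by linarith
    then show "0 \<le> x \<bullet> ((c *\<^sub>R B - A) *v x)"
      by (simp add: matrix_vector_mult_diff_rdistrib inner_diff_right scaleR_matrix_vector)
  qed
  then have "det A \<le> det (A + (c *\<^sub>R B - A))" by (rule det_add_psd_ge[OF dA(2,1)])
  then have "det A \<le> c ^ CARD('m) * det B" by (simp add: det_scaleR_matrix)
  then have "ln (det A) \<le> ln (c ^ CARD('m) * det B)" using dA by simp
  also have "\<dots> = real CARD('m) * ln c + ln (det B)"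
    using c dB by (simp add: ln_mult ln_realpow)
  finally show "ln (det A) \<le> real CARD('m) * ln (\<gamma> / (\<gamma> - \<delta>)) + ln (det B)" by (simp add: c_def)
qed

subsection \<open>Block matrices\<close>

lemma sum_UNIV_sum_type: "(\<Sum>i\<in>(UNIV :: ('a::finite + 'b::finite) set). f i) = (\<Sum>i\<in>UNIV. f (Inl i)) + (\<Sum>i\<in>UNIV. f (Inr i))"
  by (simp add: UNIV_Plus_UNIV[symmetric] sum.Plus del: UNIV_Plus_UNIV)

lemma block_mat_quadratic_form:
  fixes \<xi> :: "real ^ ('n::finite + 'n)"
  defines "x \<equiv> (\<chi> i. \<xi> $ Inl i)" and "y \<equiv> (\<chi> i. \<xi> $ Inr i)"
  shows "\<xi> \<bullet> (block_mat A B C D *v \<xi>) = x \<bullet> (A *v x) + x \<bullet> (B *v y) + y \<bullet> (C *v x) + y \<bullet> (D *v y)"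
  by (simp add: inner_vec_def matrix_vector_mult_def sum_UNIV_sum_type block_mat_def x_def y_def
      distrib_left sum.distrib)

lemma block_mat_sym:
  assumes "A \<in> sym_mats" "D \<in> sym_mats" "transpose B = C"
  shows "block_mat A B C D \<in> sym_mats"
proof (rule sym_matsI)
  fix i j
  show "block_mat A B C D $ i $ j = block_mat A B C D $ j $ i"
    using sym_matsD[OF assms(1)] sym_matsD[OF assms(2)] assms(3)
    by (auto simp: block_mat_def transpose_def split: sum.split)
qed

text \<open>Limits are taken in the form of bounds on the separate quadratic forms; on a block
  vector with parts \<open>h\<close> and \<open>k\<close> these are what the structure condition
  says.\<close>

lemma block_mat_sandwich:
  fixes X Y :: "real ^ 'n ^ 'n"
  assumes sym: "X \<in> sym_mats" "Y \<in> sym_mats"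
    and up: "\<And>h k. h \<bullet> (X *v h) - k \<bullet> (Y *v k) \<le> \<kappa> * (norm (h - k))\<^sup>2"
    and lo: "\<And>h. - \<kappa> * (norm h)\<^sup>2 \<le> h \<bullet> (X *v h)" "\<And>k. k \<bullet> (Y *v k) \<le> \<kappa> * (norm k)\<^sup>2"
  shows "(- \<kappa>) *\<^sub>R block_mat (mat 1) 0 0 (mat 1) \<preceq> block_mat X 0 0 (- Y)"
    and "block_mat X 0 0 (- Y) \<preceq> \<kappa> *\<^sub>R block_mat (mat 1) (- mat 1) (- mat 1) (mat 1)"
proof -
  have t: "transpose (0 :: real ^ 'n ^ 'n) = 0" "transpose (- mat 1 :: real ^ 'n ^ 'n) = - mat 1"
    by (auto simp: transpose_def vec_eq_iff mat_def)
  have s: "block_mat X 0 0 (- Y) \<in> sym_mats" "c *\<^sub>R block_mat (mat 1 :: real ^ 'n ^ 'n) 0 0 (mat 1) \<in> sym_mats"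
    "c *\<^sub>R block_mat (mat 1 :: real ^ 'n ^ 'n) (- mat 1) (- mat 1) (mat 1) \<in> sym_mats" for c
    using sym by (auto intro!: block_mat_sym sym_mats_closed mat_sym_mats simp: t)
  have m: "(- A) *v x = - (A *v x)" for A :: "real ^ 'n ^ 'n" and x
    using matrix_vector_mult_diff_rdistrib[of 0 A x] by simp
  show "(- \<kappa>) *\<^sub>R block_mat (mat 1) 0 0 (mat 1) \<preceq> block_mat X 0 0 (- Y)"
    unfolding loewner_le_def
  proof (intro conjI allI s)
    fix \<xi> :: "real ^ ('n + 'n)"
    show "\<xi> \<bullet> (((- \<kappa>) *\<^sub>R block_mat (mat 1) 0 0 (mat 1)) *v \<xi>) \<le> \<xi> \<bullet> (block_mat X 0 0 (- Y) *v \<xi>)"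
      using lo(1)[of "\<chi> i. \<xi> $ Inl i"] lo(2)[of "\<chi> i. \<xi> $ Inr i"]
      unfolding scaleR_matrix_vector block_mat_quadratic_form inner_scaleR_right
      by (simp add: m power2_norm_eq_inner algebra_simps)
  qed
  show "block_mat X 0 0 (- Y) \<preceq> \<kappa> *\<^sub>R block_mat (mat 1) (- mat 1) (- mat 1) (mat 1)"
    unfolding loewner_le_def
  proof (intro conjI allI s)
    fix \<xi> :: "real ^ ('n + 'n)"
    show "\<xi> \<bullet> (block_mat X 0 0 (- Y) *v \<xi>) \<le> \<xi> \<bullet> ((\<kappa> *\<^sub>R block_mat (mat 1) (- mat 1) (- mat 1) (mat 1)) *v \<xi>)"
      using up[of "\<chi> i. \<xi> $ Inl i" "\<chi> i. \<xi> $ Inr i"]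
      unfolding scaleR_matrix_vector block_mat_quadratic_form inner_scaleR_right
      by (simp add: m power2_norm_eq_inner inner_diff_left inner_diff_right inner_commute algebra_simps)
  qed
qed

section \<open>Quartic test functions\<close>

text \<open>The quartic term turns local touching into global touching without changing the derivatives up
  to order two at \<open>x0\<close>.\<close>

definition quartic :: "real ^ 'n \<Rightarrow> real ^ 'n \<Rightarrow> real ^ 'n ^ 'n \<Rightarrow> real \<Rightarrow> real ^ 'n \<Rightarrow> real" where
  "quartic x0 p X M x = p \<bullet> (x - x0) + (x - x0) \<bullet> (X *v (x - x0)) / 2 + M * ((x - x0) \<bullet> (x - x0))\<^sup>2"

lemma has_derivative_matrix_vector [derivative_intros]:
  "(f has_derivative f') F \<Longrightarrow> ((\<lambda>x. A *v f x) has_derivative (\<lambda>h. (A :: real ^ 'n ^ 'm) *v f' h)) F"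
  by (rule bounded_linear.has_derivative[OF matrix_vector_mul_bounded_linear])

lemma grad_quartic:
  assumes X: "X \<in> sym_mats"
  shows "GDERIV (quartic x0 p X M) x :> p + X *v (x - x0) + (4 * M * ((x - x0) \<bullet> (x - x0))) *\<^sub>R (x - x0)"
  unfolding gderiv_def quartic_def[abs_def]
  by (rule derivative_eq_intros refl | simp)+
     (use sym_mats_inner[OF X] in \<open>simp add: fun_eq_iff inner_add_right inner_commute power2_eq_square algebra_simps diff_divide_distrib\<close>)

lemma hess_quartic:
  assumes X: "X \<in> sym_mats"
  shows "grad (quartic x0 p X M) differentiable (at x)"
    and "hess (quartic x0 p X M) x = X + (4 * M * ((x - x0) \<bullet> (x - x0))) *\<^sub>R mat 1 + (8 * M) *\<^sub>R outer_product (x - x0) (x - x0)"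
proof -
  have g: "grad (quartic x0 p X M) = (\<lambda>x. p + X *v (x - x0) + (4 * M * ((x - x0) \<bullet> (x - x0))) *\<^sub>R (x - x0))"
    by (rule ext, rule grad_eqI, rule grad_quartic[OF X])
  define H where "H = X + (4 * M * ((x - x0) \<bullet> (x - x0))) *\<^sub>R mat 1 + (8 * M) *\<^sub>R outer_product (x - x0) (x - x0)"
  have d: "(grad (quartic x0 p X M) has_derivative (\<lambda>h. H *v h)) (at x)"
    unfolding g
    by (rule derivative_eq_intros refl | simp)+
       (simp add: fun_eq_iff H_def matrix_vector_mult_add_rdistrib scaleR_matrix_vector outer_product_mult
          inner_commute algebra_simps)
  then show "grad (quartic x0 p X M) differentiable (at x)" by (rule differentiableI)
  show "hess (quartic x0 p X M) x = H"
    unfolding hess_def jacobian_def frechet_derivative_at[OF d, symmetric] by simp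
qed

lemma C2_closure_quartic:
  assumes X: "X \<in> sym_mats"
  shows "C2_closure \<Omega> (quartic x0 p X M)"
proof -
  let ?\<phi> = "quartic x0 p X M"
  have diff: "?\<phi> differentiable (at x)" for x
    using grad_quartic[OF X] unfolding gderiv_def by (rule differentiableI)
  have h: "hess ?\<phi> = (\<lambda>x. X + (4 * M * ((x - x0) \<bullet> (x - x0))) *\<^sub>R mat 1 + (8 * M) *\<^sub>R outer_product (x - x0) (x - x0))"
    using hess_quartic(2)[OF X] by blast
  have "continuous_on S (hess ?\<phi>)" for S
    unfolding h outer_product_def by (intro continuous_intros)
  moreover have "continuous_on S (grad ?\<phi>)" for S
    using hess_quartic(1)[OF X] by (meson continuous_at_imp_continuous_on differentiable_imp_continuous_within)
  moreover have "continuous_on S ?\<phi>" for S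
    using diff by (meson continuous_at_imp_continuous_on differentiable_imp_continuous_within)
  ultimately show ?thesis
    unfolding C2_closure_def C2_on_def using diff hess_quartic(1)[OF X] by blast
qed

lemma quartic_at_center:
  fixes x0 :: "real ^ 'n"
  assumes X: "X \<in> sym_mats"
  shows "quartic x0 p X M x0 = 0" "grad (quartic x0 p X M) x0 = p" "hess (quartic x0 p X M) x0 = X"
proof -
  show "grad (quartic x0 p X M) x0 = p"
    by (rule grad_eqI) (use grad_quartic[OF X, of x0 p M x0] in simp)
  have "outer_product (0 :: real ^ 'n) (0 :: real ^ 'n) = 0" by (simp add: outer_product_def vec_eq_iff)
  then show "hess (quartic x0 p X M) x0 = X" using hess_quartic(2)[OF X, of x0 p M x0] by simp
qed (simp add: quartic_def)

lemma quartic_touching: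
  fixes f :: "real ^ 'n \<Rightarrow> real"
  assumes S: "bounded S" and f: "bounded (f ` S)" and x0: "x0 \<in> S" and d: "0 < d"
    and loc: "\<And>x. \<lbrakk>x \<in> S; norm (x - x0) < d\<rbrakk> \<Longrightarrow> f x \<le> f x0 + p \<bullet> (x - x0) + (x - x0) \<bullet> (X *v (x - x0)) / 2"
  obtains M where "\<And>x. x \<in> S \<Longrightarrow> f x - quartic x0 p X M x \<le> f x0"
proof -
  obtain B where B: "\<And>x. x \<in> S \<Longrightarrow> \<bar>f x\<bar> \<le> B" using f unfolding bounded_iff by auto
  obtain R0 where R0: "\<And>x. x \<in> S \<Longrightarrow> norm x \<le> R0" using S unfolding bounded_iff by auto
  define R where "R = R0 + norm x0"
  have R: "norm (x - x0) \<le> R" if "x \<in> S" for x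
    using R0[OF that] norm_triangle_ineq4[of x x0] by (simp add: R_def)
  \<comment> \<open>\<open>N\<close> bounds the variation of \<open>f\<close> and of the quadratic
    part on the bounded set; at distance at least \<open>d\<close> the quartic term with
    \<open>M = N / d ^ 4\<close> outweighs it.\<close>
  define N where "N = 2 * B + norm p * R + norm X * R\<^sup>2"
  have N: "0 \<le> N" using B[OF x0] R[OF x0] by (auto simp: N_def intro!: add_nonneg_nonneg)
  define M where "M = N / d ^ 4"
  have M: "0 \<le> M" using N d by (simp add: M_def)
  show ?thesis
  proof (rule that[of M])
    fix x assume x: "x \<in> S"
    define z where "z = x - x0"
    have zz: "(z \<bullet> z)\<^sup>2 = norm z ^ 4" by (simp add: power2_norm_eq_inner[symmetric])
    show "f x - quartic x0 p X M x \<le> f x0"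
    proof (cases "norm z < d")
      case True
      have "0 \<le> M * (z \<bullet> z)\<^sup>2" using M by simp
      then show ?thesis using loc[OF x] True by (simp add: quartic_def z_def)
    next
      case False
      have Rz: "norm z \<le> R" using R[OF x] by (simp add: z_def)
      have "d ^ 4 \<le> norm z ^ 4" using False d by (intro power_mono) auto
      then have "M * d ^ 4 \<le> M * norm z ^ 4" using M by (rule mult_left_mono)
      then have 1: "N \<le> M * (z \<bullet> z)\<^sup>2" using d by (simp add: zz M_def)
      have "\<bar>p \<bullet> z\<bar> \<le> norm p * norm z" by (rule Cauchy_Schwarz_ineq2)
      also have "\<dots> \<le> norm p * R" using Rz by (intro mult_left_mono) auto
      finally have 2: "\<bar>p \<bullet> z\<bar> \<le> norm p * R" .
      have "\<bar>z \<bullet> (X *v z)\<bar> \<le> norm X * (norm z)\<^sup>2" by (rule quadratic_form_le_norm)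
      also have "\<dots> \<le> norm X * R\<^sup>2" using Rz by (intro mult_left_mono power_mono) auto
      finally have 3: "\<bar>z \<bullet> (X *v z)\<bar> \<le> norm X * R\<^sup>2" .
      have "0 \<le> norm X * R\<^sup>2" by simp
      then have "f x - f x0 \<le> p \<bullet> z + z \<bullet> (X *v z) / 2 + M * (z \<bullet> z)\<^sup>2"
        using 1 2 3 B[OF x] B[OF x0] unfolding N_def abs_le_iff by argo
      then show ?thesis unfolding quartic_def z_def[symmetric] by linarith
    qed
  qed
qed

section \<open>Viscosity inequalities at points of local contact\<close>

lemma augmented_hess_sym:
  assumes "X \<in> sym_mats" "A x p \<in> sym_mats"
  shows "augmented_hess \<sigma> A x p X \<in> sym_mats"
proof -
  have "transpose (transpose (\<sigma> x) ** X ** \<sigma> x) = transpose (\<sigma> x) ** X ** \<sigma> x"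
    using assms(1) by (simp add: sym_mats_def matrix_transpose_mul matrix_mul_assoc)
  then have "transpose (\<sigma> x) ** X ** \<sigma> x \<in> sym_mats" by (simp add: sym_mats_def)
  then show ?thesis unfolding augmented_hess_def by (rule sym_mats_closed(1)) (rule assms(2))
qed

lemma augmented_hess_quadratic_form:
  "\<xi> \<bullet> (augmented_hess \<sigma> A x p X *v \<xi>) = (\<sigma> x *v \<xi>) \<bullet> (X *v (\<sigma> x *v \<xi>)) + \<xi> \<bullet> (A x p *v \<xi>)"
proof -
  have "\<xi> \<bullet> ((transpose (\<sigma> x) ** X ** \<sigma> x) *v \<xi>) = \<xi> \<bullet> (transpose (\<sigma> x) *v (X *v (\<sigma> x *v \<xi>)))"
    by (simp add: matrix_vector_mul_assoc[symmetric])
  also have "\<dots> = (\<sigma> x *v \<xi>) \<bullet> (X *v (\<sigma> x *v \<xi>))"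
    by (metis inner_commute inner_transpose_matrix)
  finally show ?thesis
    by (simp add: augmented_hess_def matrix_vector_mult_add_rdistrib inner_add_right)
qed

lemma matrix_vector_mult_minus_left: "(- A) *v x = - ((A :: real ^ 'n ^ 'm) *v x)"
  using matrix_vector_mult_diff_rdistrib[of 0 A x] by simp

text \<open>One quartic serves both definitions: it is smooth up to the closure, as the scalar
  inequality demands, and its maximum over the closure is also one over \<open>\<Omega>\<close>, as
  the matrix inequality demands.\<close>

lemma subsolution_at_touching_point:
  assumes \<Omega>: "bounded \<Omega>" "open \<Omega>" and u: "bounded (u ` closure \<Omega>)"
    and mat: "visc_subsol_matrix \<Omega> (\<lambda>x p X. - (transpose (\<sigma> x) ** X ** \<sigma> x) - A x p) (- (\<gamma> *\<^sub>R mat 1)) u"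
    and logdet: "visc_subsol_logdet \<Omega> \<sigma> A K c u"
    and x0: "x0 \<in> \<Omega>" and X: "X \<in> sym_mats" and d: "0 < d"
    and loc: "\<And>x. \<lbrakk>x \<in> closure \<Omega>; norm (x - x0) < d\<rbrakk> \<Longrightarrow> u x \<le> u x0 + p \<bullet> (x - x0) + (x - x0) \<bullet> (X *v (x - x0)) / 2"
  shows "\<gamma> *\<^sub>R mat 1 \<preceq> augmented_hess \<sigma> A x0 p X"
    and "- ln (det (augmented_hess \<sigma> A x0 p X)) + K x0 (u x0) p X \<le> c"
proof -
  have x0': "x0 \<in> closure \<Omega>" using x0 closure_subset by blast
  obtain M where M: "\<And>x. x \<in> closure \<Omega> \<Longrightarrow> u x - quartic x0 p X M x \<le> u x0"
    using quartic_touching[OF bounded_closure[OF \<Omega>(1)] u x0' d loc] by blast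
  let ?\<phi> = "quartic x0 p X M"
  note at = quartic_at_center[OF X, of x0 p M]
  have C2: "C2_closure \<Omega> ?\<phi>" "C2_on \<Omega> ?\<phi>" using C2_closure_quartic[OF X] by (auto simp: C2_closure_def)
  show "- ln (det (augmented_hess \<sigma> A x0 p X)) + K x0 (u x0) p X \<le> c"
  proof -
    have "\<forall>y\<in>closure \<Omega>. u y - ?\<phi> y \<le> u x0 - ?\<phi> x0" using M at(1) by simp
    then have "- ln (det (augmented_hess \<sigma> A x0 (grad ?\<phi> x0) (hess ?\<phi> x0))) + K x0 (u x0) (grad ?\<phi> x0) (hess ?\<phi> x0) \<le> c"
      using logdet C2(1) x0 unfolding visc_subsol_logdet_def by blast
    then show ?thesis unfolding at .
  qed
  have le: "- (transpose (\<sigma> x0) ** X ** \<sigma> x0) - A x0 p \<preceq> - (\<gamma> *\<^sub>R mat 1)"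
  proof -
    have "\<forall>y\<in>\<Omega>. u y - ?\<phi> y \<le> u x0 - ?\<phi> x0" using M at(1) closure_subset[of \<Omega>] by auto
    then have "- (transpose (\<sigma> x0) ** hess ?\<phi> x0 ** \<sigma> x0) - A x0 (grad ?\<phi> x0) \<preceq> - (\<gamma> *\<^sub>R mat 1)"
      using mat C2(2) x0 unfolding visc_subsol_matrix_def by blast
    then show ?thesis unfolding at .
  qed
  have eq: "- (transpose (\<sigma> x0) ** X ** \<sigma> x0) - A x0 p = - augmented_hess \<sigma> A x0 p X"
    by (simp add: augmented_hess_def)
  show "\<gamma> *\<^sub>R mat 1 \<preceq> augmented_hess \<sigma> A x0 p X"
    using le sym_mats_closed(3)[of "- augmented_hess \<sigma> A x0 p X"] unfolding eq loewner_le_def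
    by (simp add: matrix_vector_mult_minus_left sym_mats_closed)
qed

lemma supersolution_at_touching_point:
  assumes \<Omega>: "bounded \<Omega>" "open \<Omega>" and v: "bounded (v ` closure \<Omega>)"
    and logdet: "visc_supersol_logdet \<Omega> \<sigma> A K v"
    and x0: "x0 \<in> \<Omega>" and X: "X \<in> sym_mats" and d: "0 < d"
    and loc: "\<And>x. \<lbrakk>x \<in> closure \<Omega>; norm (x - x0) < d\<rbrakk> \<Longrightarrow> v x0 + p \<bullet> (x - x0) + (x - x0) \<bullet> (X *v (x - x0)) / 2 \<le> v x"
    and pd: "pos_definite (augmented_hess \<sigma> A x0 p X)"
  shows "0 \<le> - ln (det (augmented_hess \<sigma> A x0 p X)) + K x0 (v x0) p X"
proof -
  have x0': "x0 \<in> closure \<Omega>" using x0 closure_subset by blast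
  \<comment> \<open>Contact from below is reduced to contact from above for \<open>- v\<close>; the
    sign change turns the quartic coefficient into \<open>- M\<close>.\<close>
  have "bounded ((\<lambda>x. - v x) ` closure \<Omega>)" using v by (simp add: bounded_iff)
  moreover have "- v x \<le> - v x0 + (- p) \<bullet> (x - x0) + (x - x0) \<bullet> ((- X) *v (x - x0)) / 2"
    if "x \<in> closure \<Omega>" "norm (x - x0) < d" for x
    using loc[OF that] by (simp add: matrix_vector_mult_minus_left)
  ultimately have "\<exists>M. \<forall>x\<in>closure \<Omega>. - v x - quartic x0 (- p) (- X) M x \<le> - v x0"
    using quartic_touching[OF bounded_closure[OF \<Omega>(1)] _ x0' d, of "\<lambda>x. - v x" "- p" "- X"] by metis
  then obtain M where M: "\<And>x. x \<in> closure \<Omega> \<Longrightarrow> - v x - quartic x0 (- p) (- X) M x \<le> - v x0"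
    by blast
  let ?\<phi> = "quartic x0 p X (- M)"
  have "quartic x0 (- p) (- X) M x = - ?\<phi> x" for x
    by (simp add: quartic_def matrix_vector_mult_minus_left)
  then have "\<forall>x\<in>closure \<Omega>. v x0 - ?\<phi> x0 \<le> v x - ?\<phi> x"
    using M quartic_at_center(1)[OF X, of x0 p "- M"] by force
  then have "pos_definite (augmented_hess \<sigma> A x0 (grad ?\<phi> x0) (hess ?\<phi> x0)) \<Longrightarrow>
      0 \<le> - ln (det (augmented_hess \<sigma> A x0 (grad ?\<phi> x0) (hess ?\<phi> x0))) + K x0 (v x0) (grad ?\<phi> x0) (hess ?\<phi> x0)"
    using logdet C2_closure_quartic[OF X, of \<Omega> x0 p "- M"] x0 unfolding visc_supersol_logdet_def by blast
  then show ?thesis unfolding quartic_at_center[OF X, of x0 p "- M"] using pd by blast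
qed

section \<open>The comparison principle\<close>

text \<open>Averaging with the transpose keeps the quadratic form and supplies the symmetry that
  Hessians of test functions have.\<close>

lemma symmetric_matrix_of_linear:
  fixes T :: "real ^ 'n \<Rightarrow> real ^ 'n"
  assumes "linear T"
  obtains S where "S \<in> sym_mats" "\<And>h. h \<bullet> (S *v h) = T h \<bullet> h"
proof
  define B where "B = matrix T"
  have B: "B *v h = T h" for h using matrix_vector_mul(2)[OF assms] by (metis B_def)
  show "(1 / 2) *\<^sub>R (B + transpose B) \<in> sym_mats"
    by (rule sym_matsI) (simp add: transpose_def)
  fix h
  have "h \<bullet> (transpose B *v h) = h \<bullet> (B *v h)"
    using inner_transpose_matrix[of B h h] by (simp add: inner_commute)
  then show "h \<bullet> (((1 / 2) *\<^sub>R (B + transpose B)) *v h) = T h \<bullet> h"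
    by (simp add: scaleR_matrix_vector matrix_vector_mult_add_rdistrib inner_add_right B inner_commute)
qed

section \<open>Semicontinuity and limits of matrices\<close>

lemma usc_on_translate:
  fixes f :: "'a::real_normed_vector \<Rightarrow> real"
  assumes "usc_on S f"
  shows "usc_on ((\<lambda>x. x - a) ` S) (\<lambda>s. f (a + s))"
  unfolding usc_on_def
proof (intro ballI allI impI)
  fix s c assume s: "s \<in> (\<lambda>x. x - a) ` S" and c: "f (a + s) < c"
  then have "a + s \<in> S" by auto
  then have "\<forall>\<^sub>F y in at (a + s) within S. f y < c" using assms c unfolding usc_on_def by blast
  then obtain d where d: "d > 0" "\<And>y. \<lbrakk>y \<in> S; y \<noteq> a + s; dist y (a + s) < d\<rbrakk> \<Longrightarrow> f y < c"
    unfolding eventually_at by blast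
  show "\<forall>\<^sub>F t in at s within (\<lambda>x. x - a) ` S. f (a + t) < c"
    unfolding eventually_at
  proof (intro exI[of _ d] conjI ballI impI d(1))
    fix t assume "t \<in> (\<lambda>x. x - a) ` S" and "t \<noteq> s \<and> dist t s < d"
    then show "f (a + t) < c" by (intro d(2)) (auto simp: dist_norm)
  qed
qed

lemma lsc_on_uminus: "lsc_on S f \<Longrightarrow> usc_on S (\<lambda>x. - f x)"
  unfolding lsc_on_def usc_on_def
proof (intro ballI allI impI)
  fix x c assume f: "\<forall>x\<in>S. \<forall>c<f x. \<forall>\<^sub>F y in at x within S. c < f y" and "x \<in> S" "- f x < c"
  then have "\<forall>\<^sub>F y in at x within S. - c < f y" by simp
  then show "\<forall>\<^sub>F y in at x within S. - f y < c" by eventually_elim simp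
qed

lemma usc_on_sequentially:
  fixes f :: "'a::metric_space \<Rightarrow> real"
  assumes f: "usc_on S f" and x: "\<And>n. x n \<in> S" "x \<longlonglongrightarrow> a" "a \<in> S" and c: "f a < c"
  shows "\<forall>\<^sub>F n in sequentially. f (x n) < c"
proof -
  have "\<forall>\<^sub>F y in at a within S. f y < c" using f x(3) c unfolding usc_on_def by blast
  then obtain d where d: "d > 0" "\<And>y. \<lbrakk>y \<in> S; y \<noteq> a; dist y a < d\<rbrakk> \<Longrightarrow> f y < c"
    unfolding eventually_at by blast
  have "\<forall>\<^sub>F n in sequentially. dist (x n) a < d" using x(2) d(1) by (rule tendstoD)
  then show ?thesis by eventually_elim (use d(2) x(1) c in metis)
qed

lemma usc_on_pair:
  fixes f :: "'a::metric_space \<Rightarrow> real" and g :: "'b::metric_space \<Rightarrow> real"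
  assumes f: "usc_on S f" and g: "usc_on T g"
  shows "usc_on (S \<times> T) (\<lambda>z. f (fst z) + g (snd z))"
  unfolding usc_on_def
proof (intro ballI allI impI)
  fix z c assume z: "z \<in> S \<times> T" and c: "f (fst z) + g (snd z) < c"
  define e where "e = (c - (f (fst z) + g (snd z))) / 2"
  have e: "e > 0" using c by (simp add: e_def)
  have "\<forall>\<^sub>F y in at (fst z) within S. f y < f (fst z) + e" using f z e unfolding usc_on_def by auto
  then obtain d1 where d1: "d1 > 0" "\<And>y. \<lbrakk>y \<in> S; y \<noteq> fst z; dist y (fst z) < d1\<rbrakk> \<Longrightarrow> f y < f (fst z) + e"
    unfolding eventually_at by blast
  have "\<forall>\<^sub>F y in at (snd z) within T. g y < g (snd z) + e" using g z e unfolding usc_on_def by auto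
  then obtain d2 where d2: "d2 > 0" "\<And>y. \<lbrakk>y \<in> T; y \<noteq> snd z; dist y (snd z) < d2\<rbrakk> \<Longrightarrow> g y < g (snd z) + e"
    unfolding eventually_at by blast
  show "\<forall>\<^sub>F y in at z within S \<times> T. f (fst y) + g (snd y) < c"
    unfolding eventually_at
  proof (intro exI[of _ "min d1 d2"] conjI ballI impI)
    fix y assume y: "y \<in> S \<times> T" and d: "y \<noteq> z \<and> dist y z < min d1 d2"
    have "dist (fst y) (fst z) < d1" "dist (snd y) (snd z) < d2"
      using d dist_fst_le[of y z] dist_snd_le[of y z] by linarith+
    then have "f (fst y) < f (fst z) + e" "g (snd y) < g (snd z) + e"
      using d1(2)[of "fst y"] d2(2)[of "snd y"] y e by fastforce+
    then show "f (fst y) + g (snd y) < c" by (simp add: e_def field_simps)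
  qed (use d1 d2 in auto)
qed

lemma tendsto_quadratic_form:
  fixes X :: "nat \<Rightarrow> real ^ 'n ^ 'n"
  assumes "X \<longlonglongrightarrow> X0"
  shows "(\<lambda>n. h \<bullet> (X n *v h)) \<longlonglongrightarrow> h \<bullet> (X0 *v h)"
  unfolding inner_vec_def matrix_vector_mult_def
  by (auto intro!: tendsto_intros tendsto_vec_nth assms)

lemma tendsto_matrix_mult:
  fixes X :: "nat \<Rightarrow> real ^ 'n ^ 'm" and Y :: "nat \<Rightarrow> real ^ 'k ^ 'n"
  assumes "X \<longlonglongrightarrow> X0" "Y \<longlonglongrightarrow> Y0"
  shows "(\<lambda>n. X n ** Y n) \<longlonglongrightarrow> X0 ** Y0"
  unfolding matrix_matrix_mult_def
  by (intro vec_tendstoI) (auto intro!: tendsto_intros tendsto_vec_nth assms)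

lemma tendsto_transpose:
  fixes X :: "nat \<Rightarrow> real ^ 'n ^ 'm"
  assumes "X \<longlonglongrightarrow> X0"
  shows "(\<lambda>n. transpose (X n)) \<longlonglongrightarrow> transpose X0"
  unfolding transpose_def
  by (intro vec_tendstoI) (simp only: vec_lambda_beta, intro tendsto_vec_nth assms)

lemma tendsto_det:
  fixes X :: "nat \<Rightarrow> real ^ 'n ^ 'n"
  assumes "X \<longlonglongrightarrow> X0"
  shows "(\<lambda>n. det (X n)) \<longlonglongrightarrow> det X0"
  unfolding det_def by (intro tendsto_sum tendsto_mult tendsto_const tendsto_prod tendsto_vec_nth assms)

lemma closed_sym_mats_sequentially:
  fixes X :: "nat \<Rightarrow> real ^ 'n ^ 'n"
  assumes "X \<longlonglongrightarrow> X0" "\<And>n. X n \<in> sym_mats"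
  shows "X0 \<in> sym_mats"
proof (rule sym_matsI)
  fix i j
  have "(\<lambda>n. X n $ i $ j) \<longlonglongrightarrow> X0 $ i $ j" by (intro tendsto_vec_nth assms(1))
  moreover have "(\<lambda>n. X n $ j $ i) \<longlonglongrightarrow> X0 $ j $ i" by (intro tendsto_vec_nth assms(1))
  ultimately show "X0 $ i $ j = X0 $ j $ i"
    unfolding sym_matsD[OF assms(2), of _ j i] by (rule LIMSEQ_unique)
qed

section \<open>Doubling of variables with a fixed penalty\<close>

locale comparison =
  fixes \<Omega> :: "(real ^ 'n) set"
    and K :: "real ^ 'n \<Rightarrow> real \<Rightarrow> real ^ 'n \<Rightarrow> real ^ 'n ^ 'n \<Rightarrow> real"
    and \<omega> :: "real \<Rightarrow> real"
    and \<sigma> :: "real ^ 'n \<Rightarrow> real ^ 'm ^ 'n"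
    and A :: "real ^ 'n \<Rightarrow> real ^ 'n \<Rightarrow> real ^ 'm ^ 'm"
    and C1 \<gamma> \<gamma>1 L :: real
    and u v :: "real ^ 'n \<Rightarrow> real"
  assumes bounded_\<Omega>: "bounded \<Omega>" and open_\<Omega>: "open \<Omega>" and nonempty_\<Omega>: "\<Omega> \<noteq> {}"
    and K_cont: "continuous_on (closure \<Omega> \<times> UNIV \<times> UNIV \<times> sym_mats) (\<lambda>(x, r, p, X). K x r p X)"
    and K_mono: "\<And>x r s p X Y. \<lbrakk>x \<in> closure \<Omega>; r \<le> s; X \<in> sym_mats; Y \<in> sym_mats; Y \<preceq> X\<rbrakk>
                   \<Longrightarrow> K x r p X \<le> K x s p Y"
    and \<omega>: "modulus \<omega>"
    and K_struct: "\<And>\<epsilon> x y r X Y.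
          \<lbrakk>\<epsilon> > 0; x \<in> closure \<Omega>; y \<in> closure \<Omega>; X \<in> sym_mats; Y \<in> sym_mats;
           (- (3 / \<epsilon>)) *\<^sub>R block_mat (mat 1) 0 0 (mat 1) \<preceq> block_mat X 0 0 (- Y);
           block_mat X 0 0 (- Y) \<preceq> (3 / \<epsilon>) *\<^sub>R block_mat (mat 1) (- mat 1) (- mat 1) (mat 1)\<rbrakk>
          \<Longrightarrow> K y r ((1 / \<epsilon>) *\<^sub>R (x - y)) Y - K x r ((1 / \<epsilon>) *\<^sub>R (x - y)) X
                \<le> \<omega> (norm (x - y) * (1 + norm (x - y) / \<epsilon>))"
    and \<sigma>_lipschitz: "L-lipschitz_on (closure \<Omega>) \<sigma>"
    and A_sym: "\<And>x p. x \<in> closure \<Omega> \<Longrightarrow> A x p \<in> sym_mats"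
    and A_cont: "continuous_on (closure \<Omega> \<times> UNIV) (\<lambda>(x, p). A x p)"
    and A_lipschitz: "\<And>x y p. \<lbrakk>x \<in> closure \<Omega>; y \<in> closure \<Omega>\<rbrakk> \<Longrightarrow>
          A x p - A y p \<preceq> (C1 * norm (x - y) * (1 + norm p)) *\<^sub>R mat 1"
    and u_usc: "usc_on (closure \<Omega>) u" and u_bounded: "bounded (u ` closure \<Omega>)"
    and \<gamma>: "\<gamma> > 0" and \<gamma>1: "\<gamma>1 > 0"
    and u_matrix: "visc_subsol_matrix \<Omega>
          (\<lambda>x p X. - (transpose (\<sigma> x) ** X ** \<sigma> x) - A x p) (- (\<gamma> *\<^sub>R mat 1)) u"
    and u_logdet: "visc_subsol_logdet \<Omega> \<sigma> A K (- \<gamma>1) u"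
    and v_lsc: "lsc_on (closure \<Omega>) v" and v_bounded: "bounded (v ` closure \<Omega>)"
    and v_logdet: "visc_supersol_logdet \<Omega> \<sigma> A K v"
begin

abbreviation operator :: "real ^ 'n \<Rightarrow> real \<Rightarrow> real ^ 'n \<Rightarrow> real ^ 'n ^ 'n \<Rightarrow> real" where
  "operator x r p X \<equiv> - ln (det (augmented_hess \<sigma> A x p X)) + K x r p X"

lemma \<Omega>_closure: "x \<in> \<Omega> \<Longrightarrow> x \<in> closure \<Omega>"
  using closure_subset by blast

text \<open>The situation before \<open>\<eta>\<close> tends to 0. The values of \<open>u\<close>
  and \<open>v\<close> carry the factor \<open>1 + norm p\<close> because the linear part of the
  penalty is split off first. The supersolution inequality stays conditional: positivity at the
  second point is established only after the limit.\<close>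

definition approximate_jets ::
  "real \<Rightarrow> real ^ 'n \<Rightarrow> real ^ 'n \<Rightarrow> real ^ 'n \<Rightarrow> real \<Rightarrow>
    real ^ 'n \<Rightarrow> real ^ 'n \<Rightarrow> real ^ 'n \<Rightarrow> real ^ 'n \<Rightarrow> real ^ 'n ^ 'n \<Rightarrow> real ^ 'n ^ 'n \<Rightarrow> bool" where
  "approximate_jets \<epsilon> x0 y0 p \<eta> x y p' q' X Y \<longleftrightarrow>
    x \<in> \<Omega> \<and> y \<in> \<Omega> \<and> norm (x - x0) \<le> \<eta> \<and> norm (y - y0) \<le> \<eta> \<and>
    norm (p' - p) \<le> \<eta> \<and> norm (q' - p) \<le> \<eta> \<and>
    \<bar>u x - u x0\<bar> \<le> \<eta> * (1 + norm p) \<and> \<bar>v y - v y0\<bar> \<le> \<eta> * (1 + norm p) \<and>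
    X \<in> sym_mats \<and> Y \<in> sym_mats \<and>
    (\<forall>h k. h \<bullet> (X *v h) - k \<bullet> (Y *v k) \<le> 3 / \<epsilon> * (norm (h - k))\<^sup>2 + 3 * \<eta> * ((norm h)\<^sup>2 + (norm k)\<^sup>2)) \<and>
    (\<forall>h. - (3 / \<epsilon> + \<eta>) * (norm h)\<^sup>2 \<le> h \<bullet> (X *v h)) \<and> (\<forall>k. k \<bullet> (Y *v k) \<le> (3 / \<epsilon> + \<eta>) * (norm k)\<^sup>2) \<and>
    \<gamma> *\<^sub>R mat 1 \<preceq> augmented_hess \<sigma> A x p' X \<and> operator x (u x) p' X \<le> - \<gamma>1 \<and>
    (pos_definite (augmented_hess \<sigma> A y q' Y) \<longrightarrow> 0 \<le> operator y (v y) q' Y)"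

lemma jets_near_doubling_maximum:
  assumes \<epsilon>: "0 < \<epsilon>" and xy: "x0 \<in> \<Omega>" "y0 \<in> \<Omega>" and p: "p = (1 / \<epsilon>) *\<^sub>R (x0 - y0)"
    and max: "\<And>x y. \<lbrakk>x \<in> closure \<Omega>; y \<in> closure \<Omega>\<rbrakk> \<Longrightarrow>
        u x - v y - (norm (x - y))\<^sup>2 / (2 * \<epsilon>) \<le> u x0 - v y0 - (norm (x0 - y0))\<^sup>2 / (2 * \<epsilon>)"
    and \<eta>: "0 < \<eta>" "cball x0 \<eta> \<subseteq> \<Omega>" "cball y0 \<eta> \<subseteq> \<Omega>"
  shows "\<exists>x y p' q' X Y. approximate_jets \<epsilon> x0 y0 p \<eta> x y p' q' X Y"
proof -
  define \<kappa> where "\<kappa> = 3 / \<epsilon>"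
  have \<kappa>: "0 < \<kappa>" using \<epsilon> by (simp add: \<kappa>_def)
  \<comment> \<open>Splitting off the values and the linear part of the penalty leaves functions
    that vanish at 0 and satisfy the purely quadratic bound of \<open>theorem_on_sums\<close>. As
    \<open>V\<close> is built from \<open>- v\<close>, its Hessian is negated later.\<close>
  define U where "U s = u (x0 + s) + (- u x0 - p \<bullet> s)" for s
  define V where "V t = - v (y0 + t) + (v y0 + p \<bullet> t)" for t
  define S where "S = (\<lambda>x. x - x0) ` closure \<Omega>"
  define T where "T = (\<lambda>y. y - y0) ` closure \<Omega>"
  have cpt: "compact (closure \<Omega>)" using bounded_\<Omega> by (simp add: compact_closure)
  have S: "compact S" "0 \<in> S" unfolding S_def
    using xy(1) \<Omega>_closure by (auto intro!: compact_continuous_image continuous_intros cpt simp: image_iff)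
  have T: "compact T" "0 \<in> T" unfolding T_def
    using xy(2) \<Omega>_closure by (auto intro!: compact_continuous_image continuous_intros cpt simp: image_iff)
  have U: "usc_on S U" "U 0 = 0"
    unfolding U_def[abs_def] S_def by (auto intro!: usc_on_add_continuous usc_on_translate u_usc continuous_intros)
  have V: "usc_on T V" "V 0 = 0"
    unfolding V_def[abs_def] T_def
    by (intro usc_on_add_continuous usc_on_translate[of _ "\<lambda>x. - v x"] lsc_on_uminus v_lsc continuous_intros) simp
  have UV: "U s + V t \<le> \<kappa> / 6 * (norm (s - t))\<^sup>2" if "s \<in> S" "t \<in> T" for s t
  proof -
    have "x0 + s \<in> closure \<Omega>" "y0 + t \<in> closure \<Omega>" using that by (auto simp: S_def T_def)
    from max[OF this] have 1: "u (x0 + s) - v (y0 + t) - (norm (x0 + s - (y0 + t)))\<^sup>2 / (2 * \<epsilon>)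
        \<le> u x0 - v y0 - (norm (x0 - y0))\<^sup>2 / (2 * \<epsilon>)" .
    have "x0 + s - (y0 + t) = (x0 - y0) + (s - t)" by simp
    then have "(norm (x0 + s - (y0 + t)))\<^sup>2 = (norm (x0 - y0))\<^sup>2 + 2 * ((x0 - y0) \<bullet> (s - t)) + (norm (s - t))\<^sup>2"
      by (simp only: power2_norm_eq_inner inner_add_left inner_add_right) (simp add: inner_commute)
    then have "(norm (x0 + s - (y0 + t)))\<^sup>2 / (2 * \<epsilon>) = (norm (x0 - y0))\<^sup>2 / (2 * \<epsilon>) + p \<bullet> (s - t) + (norm (s - t))\<^sup>2 / (2 * \<epsilon>)"
      using \<epsilon> by (simp add: p add_divide_distrib)
    then show ?thesis using 1 by (simp add: U_def V_def \<kappa>_def inner_diff_right)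
  qed
  show ?thesis
  proof (rule theorem_on_sums[OF S U T V \<kappa> \<eta>(1) UV])
    fix s t p1 q1 X0 Z0 d
    assume st: "s \<in> S" "t \<in> T" "norm s \<le> \<eta>" "norm t \<le> \<eta>"
      and pq: "norm p1 \<le> \<eta>" "norm q1 \<le> \<eta>" and uv: "\<bar>U s\<bar> \<le> \<eta>" "\<bar>V t\<bar> \<le> \<eta>" and lin: "linear X0" "linear Z0"
      and XZ: "\<And>h k. X0 h \<bullet> h + Z0 k \<bullet> k \<le> \<kappa> * (norm (h - k))\<^sup>2 + \<eta> * ((norm h)\<^sup>2 + (norm k)\<^sup>2)"
      and X0: "\<And>h. - (\<kappa> + \<eta>) * (norm h)\<^sup>2 \<le> X0 h \<bullet> h" and Z0: "\<And>k. - (\<kappa> + \<eta>) * (norm k)\<^sup>2 \<le> Z0 k \<bullet> k"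
      and d: "0 < d"
      and Ut: "\<And>x. \<lbrakk>x \<in> S; norm (x - s) < d\<rbrakk> \<Longrightarrow> U x \<le> U s + p1 \<bullet> (x - s) + X0 (x - s) \<bullet> (x - s) / 2 + \<eta> * (norm (x - s))\<^sup>2"
      and Vt: "\<And>x. \<lbrakk>x \<in> T; norm (x - t) < d\<rbrakk> \<Longrightarrow> V x \<le> V t + q1 \<bullet> (x - t) + Z0 (x - t) \<bullet> (x - t) / 2 + \<eta> * (norm (x - t))\<^sup>2"
    obtain X1 where X1: "X1 \<in> sym_mats" "\<And>h. h \<bullet> (X1 *v h) = X0 h \<bullet> h"
      using symmetric_matrix_of_linear[OF lin(1)] by metis
    obtain Z1 where Z1: "Z1 \<in> sym_mats" "\<And>h. h \<bullet> (Z1 *v h) = Z0 h \<bullet> h"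
      using symmetric_matrix_of_linear[OF lin(2)] by metis
    \<comment> \<open>The added multiple of the identity contributes exactly \<open>\<eta>\<close>
      times the squared norm after halving; it swallows the error of the expansion and makes the
      contact exact. The price is \<open>3 * \<eta>\<close> instead of \<open>\<eta>\<close> in the
      joint bound.\<close>
    define X where "X = X1 + (2 * \<eta>) *\<^sub>R mat 1"
    define Y where "Y = - (Z1 + (2 * \<eta>) *\<^sub>R mat 1)"
    have sym: "X \<in> sym_mats" "Y \<in> sym_mats" unfolding X_def Y_def
      by (intro sym_mats_closed mat_sym_mats X1 Z1)+
    have qX: "h \<bullet> (X *v h) = X0 h \<bullet> h + 2 * \<eta> * (norm h)\<^sup>2" for h
      by (simp add: X_def matrix_vector_mult_add_rdistrib scaleR_matrix_vector inner_add_right X1(2) power2_norm_eq_inner)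
    have qY: "h \<bullet> (Y *v h) = - (Z0 h \<bullet> h) - 2 * \<eta> * (norm h)\<^sup>2" for h
      unfolding Y_def matrix_vector_mult_minus_left
      by (simp add: matrix_vector_mult_add_rdistrib scaleR_matrix_vector inner_diff_right Z1(2) power2_norm_eq_inner)
    define x where "x = x0 + s"
    define y where "y = y0 + t"
    have x: "x \<in> \<Omega>" using \<eta>(2) st(3) by (auto simp: x_def dist_norm subset_iff)
    have y: "y \<in> \<Omega>" using \<eta>(3) st(4) by (auto simp: y_def dist_norm subset_iff)
    have locu: "u z \<le> u x + (p + p1) \<bullet> (z - x) + (z - x) \<bullet> (X *v (z - x)) / 2" if z: "z \<in> closure \<Omega>" "norm (z - x) < d" for z
    proof -
      have "z - x0 \<in> S" "z - x0 - s = z - x" using z by (auto simp: S_def x_def)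
      then have "U (z - x0) \<le> U s + p1 \<bullet> (z - x) + X0 (z - x) \<bullet> (z - x) / 2 + \<eta> * (norm (z - x))\<^sup>2"
        using Ut[of "z - x0"] z(2) by metis
      then show ?thesis
        by (simp add: U_def qX x_def inner_diff_right inner_add_left inner_add_right add_divide_distrib)
    qed
    have locv: "v y + (p - q1) \<bullet> (z - y) + (z - y) \<bullet> (Y *v (z - y)) / 2 \<le> v z" if z: "z \<in> closure \<Omega>" "norm (z - y) < d" for z
    proof -
      have "z - y0 \<in> T" "z - y0 - t = z - y" using z by (auto simp: T_def y_def)
      then have "V (z - y0) \<le> V t + q1 \<bullet> (z - y) + Z0 (z - y) \<bullet> (z - y) / 2 + \<eta> * (norm (z - y))\<^sup>2"
        using Vt[of "z - y0"] z(2) by metis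
      then show ?thesis
        by (simp add: V_def qY y_def inner_diff_right inner_diff_left inner_add_left inner_add_right add_divide_distrib diff_divide_distrib)
    qed
    have sub: "\<gamma> *\<^sub>R mat 1 \<preceq> augmented_hess \<sigma> A x (p + p1) X" "operator x (u x) (p + p1) X \<le> - \<gamma>1"
      by (rule subsolution_at_touching_point[OF bounded_\<Omega> open_\<Omega> u_bounded u_matrix u_logdet x sym(1) d locu]; assumption)+
    have super: "0 \<le> operator y (v y) (p - q1) Y" if "pos_definite (augmented_hess \<sigma> A y (p - q1) Y)"
      by (rule supersolution_at_touching_point[OF bounded_\<Omega> open_\<Omega> v_bounded v_logdet y sym(2) d locv that])
    have ps: "\<bar>p \<bullet> s\<bar> \<le> \<eta> * norm p" "\<bar>p \<bullet> t\<bar> \<le> \<eta> * norm p"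
      using Cauchy_Schwarz_ineq2[of p s] Cauchy_Schwarz_ineq2[of p t] st(3,4)
      by (metis mult.commute mult_right_mono norm_ge_zero order_trans)+
    show ?thesis unfolding approximate_jets_def
    proof (intro exI conjI allI impI)
      show "x \<in> \<Omega>" "y \<in> \<Omega>" by (rule x y)+
      show "norm (x - x0) \<le> \<eta>" "norm (y - y0) \<le> \<eta>" using st by (auto simp: x_def y_def)
      show "norm (p + p1 - p) \<le> \<eta>" "norm (p - q1 - p) \<le> \<eta>" using pq by auto
      show "\<bar>u x - u x0\<bar> \<le> \<eta> * (1 + norm p)" using uv(1) ps(1) by (simp add: U_def x_def distrib_left)
      show "\<bar>v y - v y0\<bar> \<le> \<eta> * (1 + norm p)" using uv(2) ps(2) by (simp add: V_def y_def distrib_left)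
      show "X \<in> sym_mats" "Y \<in> sym_mats" by (rule sym)+
      show "h \<bullet> (X *v h) - k \<bullet> (Y *v k) \<le> 3 / \<epsilon> * (norm (h - k))\<^sup>2 + 3 * \<eta> * ((norm h)\<^sup>2 + (norm k)\<^sup>2)" for h k
        using XZ[of h k] unfolding qX qY \<kappa>_def distrib_left by linarith
      show "- (3 / \<epsilon> + \<eta>) * (norm h)\<^sup>2 \<le> h \<bullet> (X *v h)" for h
      proof -
        have "0 \<le> \<eta> * (norm h)\<^sup>2" using \<eta>(1) by simp
        then show ?thesis using X0[of h] unfolding qX \<kappa>_def by linarith
      qed
      show "k \<bullet> (Y *v k) \<le> (3 / \<epsilon> + \<eta>) * (norm k)\<^sup>2" for k
      proof -
        have "0 \<le> \<eta> * (norm k)\<^sup>2" using \<eta>(1) by simp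
        moreover have "- (\<kappa> + \<eta>) * (norm k)\<^sup>2 = - ((\<kappa> + \<eta>) * (norm k)\<^sup>2)" by (rule mult_minus_left)
        ultimately show ?thesis using Z0[of k] unfolding qY \<kappa>_def by linarith
      qed
    qed (use sub super in auto)
  qed
qed

end

lemma tendsto_if_norm_le_null:
  fixes f :: "nat \<Rightarrow> 'a::real_normed_vector"
  assumes e: "e \<longlonglongrightarrow> 0" and "\<And>n. norm (f n - a) \<le> e n * c"
  shows "f \<longlonglongrightarrow> a"
proof (rule LIM_zero_cancel, rule Lim_null_comparison)
  show "\<forall>\<^sub>F n in sequentially. norm (f n - a) \<le> e n * c" using assms(2) by simp
  show "(\<lambda>n. e n * c) \<longlonglongrightarrow> 0" using tendsto_mult_left_zero[OF e] .
qed

context comparison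
begin

lemma tendsto_augmented_hess:
  assumes x: "x \<longlonglongrightarrow> x0" "\<And>n. x n \<in> closure \<Omega>" "x0 \<in> closure \<Omega>" and p: "p \<longlonglongrightarrow> p0"
    and X: "X \<longlonglongrightarrow> X0"
  shows "(\<lambda>n. augmented_hess \<sigma> A (x n) (p n) (X n)) \<longlonglongrightarrow> augmented_hess \<sigma> A x0 p0 X0"
proof -
  have "(\<lambda>n. \<sigma> (x n)) \<longlonglongrightarrow> \<sigma> x0"
    using lipschitz_on_continuous_on[OF \<sigma>_lipschitz] x by (auto simp: continuous_on_sequentially o_def)
  moreover have "(\<lambda>n. A (x n) (p n)) \<longlonglongrightarrow> A x0 p0"
  proof -
    have "(\<lambda>n. (x n, p n)) \<longlonglongrightarrow> (x0, p0)" by (intro tendsto_intros x p)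
    from continuous_on_tendsto_compose[OF A_cont this] show ?thesis using x by simp
  qed
  ultimately show ?thesis
    unfolding augmented_hess_def by (intro tendsto_intros tendsto_matrix_mult tendsto_transpose X)
qed

lemma tendsto_operator:
  assumes x: "x \<longlonglongrightarrow> x0" "\<And>n. x n \<in> closure \<Omega>" "x0 \<in> closure \<Omega>" and r: "r \<longlonglongrightarrow> r0" and p: "p \<longlonglongrightarrow> p0"
    and X: "X \<longlonglongrightarrow> X0" "\<And>n. X n \<in> sym_mats" and det: "0 < det (augmented_hess \<sigma> A x0 p0 X0)"
  shows "(\<lambda>n. operator (x n) (r n) (p n) (X n)) \<longlonglongrightarrow> operator x0 r0 p0 X0"
proof -
  have "X0 \<in> sym_mats" using closed_sym_mats_sequentially[OF X] .
  moreover have "(\<lambda>n. (x n, r n, p n, X n)) \<longlonglongrightarrow> (x0, r0, p0, X0)" by (intro tendsto_intros x r p X)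
  ultimately have "(\<lambda>n. K (x n) (r n) (p n) (X n)) \<longlonglongrightarrow> K x0 r0 p0 X0"
    using continuous_on_tendsto_compose[OF K_cont, of "\<lambda>n. (x n, r n, p n, X n)" "(x0, r0, p0, X0)" sequentially] x X by simp
  moreover have "(\<lambda>n. det (augmented_hess \<sigma> A (x n) (p n) (X n))) \<longlonglongrightarrow> det (augmented_hess \<sigma> A x0 p0 X0)"
    by (intro tendsto_det tendsto_augmented_hess x p X)
  ultimately show ?thesis using det by (intro tendsto_intros) auto
qed

text \<open>At the perturbed points neither the exact slope nor the sharp constant
  \<open>3 / \<epsilon>\<close> is available. With \<open>\<epsilon>\<close> fixed the Hessians stay
  bounded as \<open>\<eta>\<close> vanishes, and a subsequence gives exact data at
  \<open>(x0, y0)\<close>.\<close>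

lemma limiting_jets_at_doubling_maximum:
  assumes \<epsilon>: "0 < \<epsilon>" and xy: "x0 \<in> \<Omega>" "y0 \<in> \<Omega>" and p: "p = (1 / \<epsilon>) *\<^sub>R (x0 - y0)"
    and max: "\<And>x y. \<lbrakk>x \<in> closure \<Omega>; y \<in> closure \<Omega>\<rbrakk> \<Longrightarrow>
        u x - v y - (norm (x - y))\<^sup>2 / (2 * \<epsilon>) \<le> u x0 - v y0 - (norm (x0 - y0))\<^sup>2 / (2 * \<epsilon>)"
  obtains X Y where "X \<in> sym_mats" "Y \<in> sym_mats"
    "\<And>h k. h \<bullet> (X *v h) - k \<bullet> (Y *v k) \<le> 3 / \<epsilon> * (norm (h - k))\<^sup>2"
    "\<And>h. - (3 / \<epsilon>) * (norm h)\<^sup>2 \<le> h \<bullet> (X *v h)" "\<And>k. k \<bullet> (Y *v k) \<le> 3 / \<epsilon> * (norm k)\<^sup>2"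
    "\<gamma> *\<^sub>R mat 1 \<preceq> augmented_hess \<sigma> A x0 p X" "operator x0 (u x0) p X \<le> - \<gamma>1"
    "\<And>c. \<lbrakk>0 < c; c *\<^sub>R mat 1 \<preceq> augmented_hess \<sigma> A y0 p Y\<rbrakk> \<Longrightarrow> 0 \<le> operator y0 (v y0) p Y"
proof -
  obtain \<rho>1 where \<rho>1: "\<rho>1 > 0" "cball x0 \<rho>1 \<subseteq> \<Omega>" using open_\<Omega> xy(1) open_contains_cball by blast
  obtain \<rho>2 where \<rho>2: "\<rho>2 > 0" "cball y0 \<rho>2 \<subseteq> \<Omega>" using open_\<Omega> xy(2) open_contains_cball by blast
  define \<eta> where "\<eta> n = min (min \<rho>1 \<rho>2) (1 / real (Suc n))" for n
  have \<eta>: "0 < \<eta> n" "\<eta> n \<le> 1" "cball x0 (\<eta> n) \<subseteq> \<Omega>" "cball y0 (\<eta> n) \<subseteq> \<Omega>" for n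
  proof -
    show "0 < \<eta> n" using \<rho>1 \<rho>2 by (simp add: \<eta>_def)
    have "1 / real (Suc n) \<le> 1" by simp
    then show "\<eta> n \<le> 1" by (simp add: \<eta>_def min_le_iff_disj del: of_nat_Suc)
    have "\<eta> n \<le> \<rho>1" "\<eta> n \<le> \<rho>2" by (auto simp: \<eta>_def)
    then show "cball x0 (\<eta> n) \<subseteq> \<Omega>" "cball y0 (\<eta> n) \<subseteq> \<Omega>"
      using \<rho>1(2) \<rho>2(2) subset_cball by (metis order_trans)+
  qed
  have \<eta>0: "\<eta> \<longlonglongrightarrow> 0"
  proof (rule real_tendsto_sandwich)
    show "\<forall>\<^sub>F n in sequentially. 0 \<le> \<eta> n" using \<eta>(1) by (simp add: less_imp_le)
    show "\<forall>\<^sub>F n in sequentially. \<eta> n \<le> 1 / real (Suc n)" by (simp add: \<eta>_def)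
    show "(\<lambda>n. 1 / real (Suc n)) \<longlonglongrightarrow> 0" using LIMSEQ_inverse_real_of_nat by (simp add: inverse_eq_divide)
  qed simp
  have "\<exists>x y p' q' X Y. approximate_jets \<epsilon> x0 y0 p (\<eta> n) x y p' q' X Y" for n
    by (rule jets_near_doubling_maximum[OF \<epsilon> xy p max \<eta>(1) \<eta>(3) \<eta>(4)])
  then obtain xs ys ps qs Xs Ys where jets: "\<And>n. approximate_jets \<epsilon> x0 y0 p (\<eta> n) (xs n) (ys n) (ps n) (qs n) (Xs n) (Ys n)"
    by metis
  note jets = jets[unfolded approximate_jets_def]
  have in\<Omega>: "xs n \<in> closure \<Omega>" "ys n \<in> closure \<Omega>" for n using jets[of n] \<Omega>_closure by auto
  have sym: "Xs n \<in> sym_mats" "Ys n \<in> sym_mats" for n using jets[of n] by auto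
  \<comment> \<open>As \<open>\<eta> n \<le> 1\<close>, all error terms fit into a bound independent
    of \<open>n\<close>.\<close>
  define b where "b = 3 / \<epsilon> + 3"
  have up: "h \<bullet> (Xs n *v h) - k \<bullet> (Ys n *v k) \<le> 3 / \<epsilon> * (norm (h - k))\<^sup>2 + 3 * \<eta> n * ((norm h)\<^sup>2 + (norm k)\<^sup>2)"
    and loX: "- (3 / \<epsilon> + \<eta> n) * (norm h)\<^sup>2 \<le> h \<bullet> (Xs n *v h)" and upY: "k \<bullet> (Ys n *v k) \<le> (3 / \<epsilon> + \<eta> n) * (norm k)\<^sup>2"
    for h k n using jets[of n] by blast+
  have \<eta>h: "\<eta> n * (norm h)\<^sup>2 \<le> (norm h)\<^sup>2" "0 \<le> \<eta> n * (norm h)\<^sup>2" for n and h :: "real ^ 'n"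
    using \<eta>(1,2)[of n] by (auto simp: mult_left_le_one_le less_imp_le)
  have bX: "\<bar>h \<bullet> (Xs n *v h)\<bar> \<le> b * (norm h)\<^sup>2" for h n
    using up[of h n 0] loX[of n h] \<eta>h[where n = n and h = h] by (simp add: b_def abs_le_iff algebra_simps)
  have bY: "\<bar>k \<bullet> (Ys n *v k)\<bar> \<le> b * (norm k)\<^sup>2" for k n
    using up[of 0 n k] upY[of k n] \<eta>h[where n = n and h = k] by (simp add: b_def abs_le_iff algebra_simps)
  have "bounded (range (\<lambda>n. (Xs n, Ys n)))"
    unfolding bounded_iff
  proof (intro exI ballI)
    fix z assume "z \<in> range (\<lambda>n. (Xs n, Ys n))"
    then obtain n where z: "z = (Xs n, Ys n)" by blast
    show "norm z \<le> real CARD('n) * (real CARD('n) * (3 * b)) + real CARD('n) * (real CARD('n) * (3 * b))"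
      unfolding z by (intro order_trans[OF norm_Pair_le] add_mono norm_sym_mats_le sym bX bY)
  qed
  then obtain l r where r: "strict_mono r" "((\<lambda>n. (Xs n, Ys n)) \<circ> r) \<longlonglongrightarrow> l"
    using bounded_imp_convergent_subsequence by blast
  define X where "X = fst l"
  define Y where "Y = snd l"
  have X: "(\<lambda>n. Xs (r n)) \<longlonglongrightarrow> X" and Y: "(\<lambda>n. Ys (r n)) \<longlonglongrightarrow> Y"
    using tendsto_fst[OF r(2)] tendsto_snd[OF r(2)] by (simp_all add: X_def Y_def o_def)
  have Xsym: "X \<in> sym_mats" using closed_sym_mats_sequentially[OF X sym(1)] .
  have Ysym: "Y \<in> sym_mats" using closed_sym_mats_sequentially[OF Y sym(2)] .
  have \<eta>r: "(\<lambda>n. \<eta> (r n)) \<longlonglongrightarrow> 0" using LIMSEQ_subseq_LIMSEQ[OF \<eta>0 r(1)] by (simp add: o_def)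
  have x: "(\<lambda>n. xs (r n)) \<longlonglongrightarrow> x0" and y: "(\<lambda>n. ys (r n)) \<longlonglongrightarrow> y0"
    and p': "(\<lambda>n. ps (r n)) \<longlonglongrightarrow> p" and q': "(\<lambda>n. qs (r n)) \<longlonglongrightarrow> p"
    by (rule tendsto_if_norm_le_null[OF \<eta>r, where c = 1], use jets in simp)+
  have ul: "(\<lambda>n. u (xs (r n))) \<longlonglongrightarrow> u x0" and vl: "(\<lambda>n. v (ys (r n))) \<longlonglongrightarrow> v y0"
    by (rule tendsto_if_norm_le_null[OF \<eta>r, where c = "1 + norm p"], use jets in simp)+
  note aX = tendsto_augmented_hess[OF x in\<Omega>(1) \<Omega>_closure[OF xy(1)] p' X]
  note aY = tendsto_augmented_hess[OF y in\<Omega>(2) \<Omega>_closure[OF xy(2)] q' Y]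
  have ge: "\<gamma> *\<^sub>R mat 1 \<preceq> augmented_hess \<sigma> A x0 p X"
    unfolding loewner_le_scaleR_mat_1
  proof (intro conjI allI augmented_hess_sym Xsym A_sym \<Omega>_closure xy(1))
    fix \<xi>
    have "\<gamma> * (norm \<xi>)\<^sup>2 \<le> \<xi> \<bullet> (augmented_hess \<sigma> A (xs (r n)) (ps (r n)) (Xs (r n)) *v \<xi>)" for n
      using jets[of "r n"] by (simp add: loewner_le_scaleR_mat_1)
    then show "\<gamma> * (norm \<xi>)\<^sup>2 \<le> \<xi> \<bullet> (augmented_hess \<sigma> A x0 p X *v \<xi>)"
      by (intro LIMSEQ_le_const[OF tendsto_quadratic_form[OF aX]]) auto
  qed
  have opX: "operator x0 (u x0) p X \<le> - \<gamma>1"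
  proof (rule LIMSEQ_le_const2)
    show "(\<lambda>n. operator (xs (r n)) (u (xs (r n))) (ps (r n)) (Xs (r n))) \<longlonglongrightarrow> operator x0 (u x0) p X"
      using x in\<Omega>(1) \<Omega>_closure[OF xy(1)] ul p' X sym(1) pos_definite_if_ge_mat(2)[OF \<gamma> ge] by (rule tendsto_operator)
    show "\<exists>N. \<forall>n\<ge>N. operator (xs (r n)) (u (xs (r n))) (ps (r n)) (Xs (r n)) \<le> - \<gamma>1" using jets by blast
  qed
  \<comment> \<open>A margin \<open>c\<close> at the limit leaves the approximating matrices above
    \<open>c / 2\<close> from some index on; this releases the conditional inequality before the
    limit is taken.\<close>
  have opY: "0 \<le> operator y0 (v y0) p Y" if c: "0 < c" "c *\<^sub>R mat 1 \<preceq> augmented_hess \<sigma> A y0 p Y" for c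
  proof (rule tendsto_lowerbound)
    show "(\<lambda>n. operator (ys (r n)) (v (ys (r n))) (qs (r n)) (Ys (r n))) \<longlonglongrightarrow> operator y0 (v y0) p Y"
      using y in\<Omega>(2) \<Omega>_closure[OF xy(2)] vl q' Y sym(2) pos_definite_if_ge_mat(2)[OF c] by (rule tendsto_operator)
    have "\<forall>\<^sub>F n in sequentially. dist (augmented_hess \<sigma> A (ys (r n)) (qs (r n)) (Ys (r n))) (augmented_hess \<sigma> A y0 p Y) < c / 2"
      using aY half_gt_zero[OF c(1)] by (rule tendstoD)
    then show "\<forall>\<^sub>F n in sequentially. 0 \<le> operator (ys (r n)) (v (ys (r n))) (qs (r n)) (Ys (r n))"
    proof eventually_elim
      case (elim n)
      let ?B = "augmented_hess \<sigma> A (ys (r n)) (qs (r n)) (Ys (r n))"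
      have "(c / 2) *\<^sub>R mat 1 \<preceq> ?B"
        unfolding loewner_le_scaleR_mat_1
      proof (intro conjI allI augmented_hess_sym sym A_sym in\<Omega>)
        fix \<xi>
        have "\<bar>\<xi> \<bullet> ((?B - augmented_hess \<sigma> A y0 p Y) *v \<xi>)\<bar> \<le> norm (?B - augmented_hess \<sigma> A y0 p Y) * (norm \<xi>)\<^sup>2"
          by (rule quadratic_form_le_norm)
        also have "\<dots> \<le> c / 2 * (norm \<xi>)\<^sup>2" using elim by (intro mult_right_mono) (auto simp: dist_norm)
        finally have "- (c / 2 * (norm \<xi>)\<^sup>2) \<le> \<xi> \<bullet> (?B *v \<xi>) - \<xi> \<bullet> (augmented_hess \<sigma> A y0 p Y *v \<xi>)"
          unfolding matrix_vector_mult_diff_rdistrib inner_diff_right by linarith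
        moreover have "c * (norm \<xi>)\<^sup>2 \<le> \<xi> \<bullet> (augmented_hess \<sigma> A y0 p Y *v \<xi>)"
          using c(2) by (simp add: loewner_le_scaleR_mat_1)
        ultimately show "c / 2 * (norm \<xi>)\<^sup>2 \<le> \<xi> \<bullet> (?B *v \<xi>)" by linarith
      qed
      then have "pos_definite ?B" using pos_definite_if_ge_mat(1) c(1) half_gt_zero by blast
      then show ?case using jets[of "r n"] by blast
    qed
  qed simp
  show ?thesis
  proof (rule that[OF Xsym Ysym _ _ _ ge opX opY])
    fix h k :: "real ^ 'n"
    have "(\<lambda>n. 3 / \<epsilon> * (norm (h - k))\<^sup>2 + 3 * \<eta> (r n) * ((norm h)\<^sup>2 + (norm k)\<^sup>2)) \<longlonglongrightarrow> 3 / \<epsilon> * (norm (h - k))\<^sup>2 + 3 * 0 * ((norm h)\<^sup>2 + (norm k)\<^sup>2)"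
      by (intro tendsto_intros \<eta>r)
    moreover have "(\<lambda>n. h \<bullet> (Xs (r n) *v h) - k \<bullet> (Ys (r n) *v k)) \<longlonglongrightarrow> h \<bullet> (X *v h) - k \<bullet> (Y *v k)"
      by (intro tendsto_diff tendsto_quadratic_form X Y)
    ultimately have "h \<bullet> (X *v h) - k \<bullet> (Y *v k) \<le> 3 / \<epsilon> * (norm (h - k))\<^sup>2 + 3 * 0 * ((norm h)\<^sup>2 + (norm k)\<^sup>2)"
      using up by (intro LIMSEQ_le[of _ "h \<bullet> (X *v h) - k \<bullet> (Y *v k)"]) auto
    then show "h \<bullet> (X *v h) - k \<bullet> (Y *v k) \<le> 3 / \<epsilon> * (norm (h - k))\<^sup>2" by simp
  next
    fix h :: "real ^ 'n"
    have "(\<lambda>n. - (3 / \<epsilon> + \<eta> (r n)) * (norm h)\<^sup>2) \<longlonglongrightarrow> - (3 / \<epsilon> + 0) * (norm h)\<^sup>2"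
      by (intro tendsto_intros \<eta>r)
    from LIMSEQ_le[OF this tendsto_quadratic_form[OF X]] show "- (3 / \<epsilon>) * (norm h)\<^sup>2 \<le> h \<bullet> (X *v h)"
      using loX by simp
  next
    fix k :: "real ^ 'n"
    have "(\<lambda>n. (3 / \<epsilon> + \<eta> (r n)) * (norm k)\<^sup>2) \<longlonglongrightarrow> (3 / \<epsilon> + 0) * (norm k)\<^sup>2"
      by (intro tendsto_intros \<eta>r)
    from LIMSEQ_le[OF tendsto_quadratic_form[OF Y] this] show "k \<bullet> (Y *v k) \<le> 3 / \<epsilon> * (norm k)\<^sup>2"
      using upY by simp
  qed
qed

text \<open>\<open>\<delta>\<close> is the loss in carrying the matrix inequality from
  \<open>x0\<close> to \<open>y0\<close>: its first term stems from the Lipschitz bound on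
  \<open>\<sigma>\<close>, its second from that on \<open>A\<close>. Then the scalar inequalities
  are subtracted; monotonicity of \<open>K\<close> handles the values, the structure condition the
  Hessians.\<close>

lemma strict_subsolution_gap:
  assumes \<epsilon>: "0 < \<epsilon>" and xy: "x0 \<in> \<Omega>" "y0 \<in> \<Omega>" and uv: "v y0 \<le> u x0"
    and max: "\<And>x y. \<lbrakk>x \<in> closure \<Omega>; y \<in> closure \<Omega>\<rbrakk> \<Longrightarrow>
        u x - v y - (norm (x - y))\<^sup>2 / (2 * \<epsilon>) \<le> u x0 - v y0 - (norm (x0 - y0))\<^sup>2 / (2 * \<epsilon>)"
    and \<delta>: "\<delta> = 3 / \<epsilon> * (L * norm (x0 - y0))\<^sup>2 + \<bar>C1\<bar> * (norm (x0 - y0) * (1 + norm (x0 - y0) / \<epsilon>))" "\<delta> < \<gamma>"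
  shows "\<gamma>1 \<le> real CARD('m) * ln (\<gamma> / (\<gamma> - \<delta>)) + \<omega> (norm (x0 - y0) * (1 + norm (x0 - y0) / \<epsilon>))"
proof -
  define p where "p = (1 / \<epsilon>) *\<^sub>R (x0 - y0)"
  have cl: "x0 \<in> closure \<Omega>" "y0 \<in> closure \<Omega>" using xy \<Omega>_closure by auto
  obtain X Y where sym: "X \<in> sym_mats" "Y \<in> sym_mats"
    and up: "\<And>h k. h \<bullet> (X *v h) - k \<bullet> (Y *v k) \<le> 3 / \<epsilon> * (norm (h - k))\<^sup>2"
    and lo: "\<And>h. - (3 / \<epsilon>) * (norm h)\<^sup>2 \<le> h \<bullet> (X *v h)" "\<And>k. k \<bullet> (Y *v k) \<le> 3 / \<epsilon> * (norm k)\<^sup>2"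
    and ge: "\<gamma> *\<^sub>R mat 1 \<preceq> augmented_hess \<sigma> A x0 p X" and opX: "operator x0 (u x0) p X \<le> - \<gamma>1"
    and opY: "\<And>c. \<lbrakk>0 < c; c *\<^sub>R mat 1 \<preceq> augmented_hess \<sigma> A y0 p Y\<rbrakk> \<Longrightarrow> 0 \<le> operator y0 (v y0) p Y"
    using limiting_jets_at_doubling_maximum[OF \<epsilon> xy p_def max] by metis
  have np: "norm p = norm (x0 - y0) / \<epsilon>" using \<epsilon> by (simp add: p_def)
  have \<delta>0: "0 \<le> \<delta>" using \<epsilon> by (auto simp: \<delta>(1) intro!: add_nonneg_nonneg mult_nonneg_nonneg)
  \<comment> \<open>With \<open>h = \<sigma> x0 *v \<xi>\<close> and
    \<open>k = \<sigma> y0 *v \<xi>\<close> the joint bound involves only the difference of the two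
    vectors, which tames the large factor \<open>3 / \<epsilon>\<close>.\<close>
  have quad: "\<xi> \<bullet> (augmented_hess \<sigma> A x0 p X *v \<xi>) \<le> \<xi> \<bullet> (augmented_hess \<sigma> A y0 p Y *v \<xi>) + \<delta> * (norm \<xi>)\<^sup>2" for \<xi>
  proof -
    have "norm (\<sigma> x0 *v \<xi> - \<sigma> y0 *v \<xi>) \<le> norm (\<sigma> x0 - \<sigma> y0) * norm \<xi>"
      using norm_matrix_vector_le[of "\<sigma> x0 - \<sigma> y0" \<xi>] by (simp add: matrix_vector_mult_diff_rdistrib)
    also have "\<dots> \<le> (L * norm (x0 - y0)) * norm \<xi>"
      using lipschitz_onD[OF \<sigma>_lipschitz cl] by (intro mult_right_mono) (auto simp: dist_norm)
    finally have "(norm (\<sigma> x0 *v \<xi> - \<sigma> y0 *v \<xi>))\<^sup>2 \<le> ((L * norm (x0 - y0)) * norm \<xi>)\<^sup>2"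
      by (intro power_mono) auto
    then have "3 / \<epsilon> * (norm (\<sigma> x0 *v \<xi> - \<sigma> y0 *v \<xi>))\<^sup>2 \<le> 3 / \<epsilon> * ((L * norm (x0 - y0)) * norm \<xi>)\<^sup>2"
      using \<epsilon> by (intro mult_left_mono) auto
    also have "\<dots> = 3 / \<epsilon> * (L * norm (x0 - y0))\<^sup>2 * (norm \<xi>)\<^sup>2" by (simp add: power_mult_distrib)
    finally have 1: "(\<sigma> x0 *v \<xi>) \<bullet> (X *v (\<sigma> x0 *v \<xi>)) - (\<sigma> y0 *v \<xi>) \<bullet> (Y *v (\<sigma> y0 *v \<xi>))
        \<le> 3 / \<epsilon> * (L * norm (x0 - y0))\<^sup>2 * (norm \<xi>)\<^sup>2"
      using up[of "\<sigma> x0 *v \<xi>" "\<sigma> y0 *v \<xi>"] by linarith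
    have "\<xi> \<bullet> (A x0 p *v \<xi>) - \<xi> \<bullet> (A y0 p *v \<xi>) \<le> C1 * norm (x0 - y0) * (1 + norm p) * (norm \<xi>)\<^sup>2"
      using A_lipschitz[OF cl, of p]
      by (simp add: loewner_le_def scaleR_matrix_vector matrix_vector_mult_diff_rdistrib inner_diff_right power2_norm_eq_inner)
    also have "\<dots> \<le> \<bar>C1\<bar> * (norm (x0 - y0) * (1 + norm (x0 - y0) / \<epsilon>)) * (norm \<xi>)\<^sup>2"
      unfolding np mult.assoc using \<epsilon> by (intro mult_right_mono mult_nonneg_nonneg) auto
    finally have 2: "\<xi> \<bullet> (A x0 p *v \<xi>) - \<xi> \<bullet> (A y0 p *v \<xi>)
        \<le> \<bar>C1\<bar> * (norm (x0 - y0) * (1 + norm (x0 - y0) / \<epsilon>)) * (norm \<xi>)\<^sup>2" .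
    show ?thesis
      using 1 2 unfolding augmented_hess_quadratic_form \<delta>(1) distrib_right[of _ _ "(norm \<xi>)\<^sup>2"] by linarith
  qed
  note det = ln_det_le[OF ge augmented_hess_sym[where x = y0 and A = A and p = p and \<sigma> = \<sigma>, OF sym(2) A_sym[OF cl(2)]] \<delta>0 \<delta>(2) quad]
  \<comment> \<open>The margin left at \<open>y0\<close> is \<open>\<gamma> - \<delta> > 0\<close>,
    so the supersolution inequality is available.\<close>
  have "0 \<le> operator y0 (v y0) p Y" using opY[OF _ det(1)] \<delta>(2) by simp
  moreover have "K y0 (v y0) p Y \<le> K y0 (u x0) p Y"
    using sym(2) uv cl(2) by (intro K_mono) (auto simp: loewner_le_def)
  moreover have "K y0 (u x0) p Y - K x0 (u x0) p X \<le> \<omega> (norm (x0 - y0) * (1 + norm (x0 - y0) / \<epsilon>))"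
    unfolding p_def by (intro K_struct \<epsilon> cl sym block_mat_sandwich up lo)
  ultimately show ?thesis using det(2) opX by linarith
qed

end

lemma usc_on_subset: "usc_on S f \<Longrightarrow> T \<subseteq> S \<Longrightarrow> usc_on T f"
  unfolding usc_on_def by (meson at_le filter_leD subsetD)

lemma modulus_tendsto_0:
  assumes \<omega>: "modulus \<omega>" and b: "b \<longlonglongrightarrow> 0" "\<And>n. 0 \<le> b n"
  shows "(\<lambda>n. \<omega> (b n)) \<longlonglongrightarrow> 0"
proof (rule tendstoI)
  fix e :: real assume e: "0 < e"
  have "\<forall>\<^sub>F s in at_right 0. dist (\<omega> s) 0 < e" using \<omega> e unfolding modulus_def by (blast intro: tendstoD)
  then obtain d where d: "d > 0" "\<And>s. \<lbrakk>0 < s; s < d\<rbrakk> \<Longrightarrow> dist (\<omega> s) 0 < e"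
    unfolding eventually_at_right_field by auto
  have "\<forall>\<^sub>F n in sequentially. b n < d" using b(1) d(1) by (rule order_tendstoD)
  then show "\<forall>\<^sub>F n in sequentially. dist (\<omega> (b n)) 0 < e"
  proof eventually_elim
    case (elim n)
    show ?case
    \<comment> \<open>The limit in \<open>modulus\<close> is one-sided and ignores the point 0,
      where the value is prescribed.\<close>
    proof (cases "b n = 0")
      case True then show ?thesis using \<omega> e by (simp add: modulus_def)
    next
      case False then show ?thesis using d(2)[of "b n"] b(2)[of n] elim by simp
    qed
  qed
qed

section \<open>The limit of vanishing doubling parameter\<close>

context comparison
begin

lemma usc_difference: "usc_on (closure \<Omega> \<times> closure \<Omega>) (\<lambda>z. u (fst z) + - v (snd z))"
  by (intro usc_on_pair u_usc lsc_on_uminus v_lsc)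

lemma usc_diagonal: "usc_on (closure \<Omega>) (\<lambda>x. u x - v x)"
  unfolding usc_on_def
proof (intro ballI allI impI)
  fix x c assume x: "x \<in> closure \<Omega>" and c: "u x - v x < c"
  define e where "e = (c - (u x - v x)) / 2"
  have e: "e > 0" using c by (simp add: e_def)
  have "\<forall>\<^sub>F y in at x within closure \<Omega>. u y < u x + e" using u_usc x e unfolding usc_on_def by simp
  moreover have "\<forall>\<^sub>F y in at x within closure \<Omega>. - v y < - v x + e"
    using lsc_on_uminus[OF v_lsc] x e unfolding usc_on_def by simp
  ultimately show "\<forall>\<^sub>F y in at x within closure \<Omega>. u y - v y < c"
    by eventually_elim (simp add: e_def field_simps)
qed

lemma bdd_above_difference: "bdd_above ((\<lambda>x. u x - v x) ` \<Omega>)"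
proof -
  obtain a where a: "\<And>x. x \<in> closure \<Omega> \<Longrightarrow> \<bar>u x\<bar> \<le> a" using u_bounded by (auto simp: bounded_iff)
  obtain b where b: "\<And>x. x \<in> closure \<Omega> \<Longrightarrow> \<bar>v x\<bar> \<le> b" using v_bounded by (auto simp: bounded_iff)
  show ?thesis
  proof (rule bdd_aboveI2)
    fix x assume "x \<in> \<Omega>"
    then show "u x - v x \<le> a + b" using a[of x] b[of x] \<Omega>_closure[of x] by (simp add: abs_le_iff)
  qed
qed

text \<open>The classical penalisation argument: the maxima of the doubled problem converge to an interior
  maximum of \<open>u - v\<close>, and the penalty term vanishes in the limit.\<close>

lemma sup_difference_le:
  assumes M: "0 \<le> M" "\<And>x. x \<in> frontier \<Omega> \<Longrightarrow> u x - v x \<le> M"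
  shows "(SUP x\<in>\<Omega>. u x - v x) \<le> M"
proof (rule ccontr)
  define S where "S = (SUP x\<in>\<Omega>. u x - v x)"
  assume "\<not> (SUP x\<in>\<Omega>. u x - v x) \<le> M"
  then have SM: "M < S" by (simp add: S_def)
  have cpt: "compact (closure \<Omega>)" using bounded_\<Omega> by (simp add: compact_closure)
  have ne: "closure \<Omega> \<noteq> {}" using nonempty_\<Omega> by simp
  define \<epsilon> where "\<epsilon> n = 1 / real (Suc n)" for n
  have \<epsilon>: "0 < \<epsilon> n" for n by (simp add: \<epsilon>_def)
  have \<epsilon>0: "\<epsilon> \<longlonglongrightarrow> 0" using LIMSEQ_inverse_real_of_nat by (simp add: \<epsilon>_def[abs_def] inverse_eq_divide)
  define \<Phi> where "\<Phi> n z = u (fst z) + - v (snd z) + - ((norm (fst z - snd z))\<^sup>2 / (2 * \<epsilon> n))" for n z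
  have "\<exists>z\<in>closure \<Omega> \<times> closure \<Omega>. \<forall>z'\<in>closure \<Omega> \<times> closure \<Omega>. \<Phi> n z' \<le> \<Phi> n z" for n
    unfolding \<Phi>_def using \<epsilon>[of n] ne
    by (intro usc_on_attains_max usc_on_add_continuous usc_difference continuous_intros compact_Times cpt) auto
  then obtain z where z: "\<And>n. z n \<in> closure \<Omega> \<times> closure \<Omega>" "\<And>n z'. z' \<in> closure \<Omega> \<times> closure \<Omega> \<Longrightarrow> \<Phi> n z' \<le> \<Phi> n (z n)"
    by metis
  obtain l r where l: "l \<in> closure \<Omega> \<times> closure \<Omega>" and r: "strict_mono r" "(z \<circ> r) \<longlonglongrightarrow> l"
    using z(1) compact_Times[OF cpt cpt] unfolding compact_def by metis
  define x where "x n = fst (z (r n))" for n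
  define y where "y n = snd (z (r n))" for n
  define e where "e n = \<epsilon> (r n)" for n
  define a where "a n = (norm (x n - y n))\<^sup>2 / (2 * e n)" for n
  have e: "0 < e n" for n using \<epsilon> by (simp add: e_def)
  have e0: "e \<longlonglongrightarrow> 0" using LIMSEQ_subseq_LIMSEQ[OF \<epsilon>0 r(1)] by (simp add: e_def[abs_def] o_def)
  have xy: "x n \<in> closure \<Omega>" "y n \<in> closure \<Omega>" for n using z(1)[of "r n"] by (auto simp: x_def y_def mem_Times_iff)
  have x_lim: "x \<longlonglongrightarrow> fst l" and y_lim: "y \<longlonglongrightarrow> snd l"
    using tendsto_fst[OF r(2)] tendsto_snd[OF r(2)] by (simp_all add: x_def[abs_def] y_def[abs_def] o_def)
  have max: "u s - v t - (norm (s - t))\<^sup>2 / (2 * e n) \<le> u (x n) - v (y n) - (norm (x n - y n))\<^sup>2 / (2 * e n)"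
    if "s \<in> closure \<Omega>" "t \<in> closure \<Omega>" for s t n
    using z(2)[of "(s, t)" "r n"] that by (simp add: \<Phi>_def x_def y_def e_def)
  have a0: "0 \<le> a n" for n using e[of n] by (simp add: a_def)
  \<comment> \<open>Diagonal pairs carry no penalty, so the doubled maximum dominates the
    supremum.\<close>
  have S: "S + a n \<le> u (x n) - v (y n)" for n
  proof -
    have "S \<le> u (x n) - v (y n) - a n" unfolding S_def
    proof (rule cSUP_least[OF nonempty_\<Omega>])
      fix s assume "s \<in> \<Omega>"
      then have "s \<in> closure \<Omega>" by (rule \<Omega>_closure)
      from max[OF this this, of n] show "u s - v s \<le> u (x n) - v (y n) - a n" by (simp add: a_def)
    qed
    then show ?thesis by simp
  qed
  obtain B where B: "\<And>n. a n \<le> B"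
  proof -
    obtain b1 where b1: "\<And>x. x \<in> closure \<Omega> \<Longrightarrow> \<bar>u x\<bar> \<le> b1" using u_bounded by (auto simp: bounded_iff)
    obtain b2 where b2: "\<And>x. x \<in> closure \<Omega> \<Longrightarrow> \<bar>v x\<bar> \<le> b2" using v_bounded by (auto simp: bounded_iff)
    show ?thesis
    proof (rule that[of "b1 + b2 - S"])
      fix n show "a n \<le> b1 + b2 - S" using S[of n] b1[OF xy(1)[of n]] b2[OF xy(2)[of n]] by (simp add: abs_le_iff)
    qed
  qed
  have sq: "(norm (x n - y n))\<^sup>2 = 2 * e n * a n" for n using e[of n] by (simp add: a_def)
  have "(\<lambda>n. (norm (x n - y n))\<^sup>2) \<longlonglongrightarrow> 0"
  proof (rule tendsto_sandwich[of "\<lambda>_. 0"])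
    show "\<forall>\<^sub>F n in sequentially. (norm (x n - y n))\<^sup>2 \<le> 2 * e n * B"
      unfolding sq using B e by (simp add: mult_left_mono less_imp_le)
    have "(\<lambda>n. 2 * e n * B) \<longlonglongrightarrow> 2 * 0 * B" by (intro tendsto_intros e0)
    then show "(\<lambda>n. 2 * e n * B) \<longlonglongrightarrow> 0" by simp
  qed auto
  then have n0: "(\<lambda>n. norm (x n - y n)) \<longlonglongrightarrow> 0"
    using tendsto_real_sqrt by fastforce
  then have "(\<lambda>n. x n - y n) \<longlonglongrightarrow> 0" by (rule tendsto_norm_zero_cancel)
  moreover have "(\<lambda>n. x n - y n) \<longlonglongrightarrow> fst l - snd l" by (intro tendsto_intros x_lim y_lim)
  ultimately have eq: "snd l = fst l" using LIMSEQ_unique by fastforce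
  define w where "w = fst l"
  have w: "w \<in> closure \<Omega>" "x \<longlonglongrightarrow> w" "y \<longlonglongrightarrow> w" using l x_lim y_lim eq by (auto simp: w_def mem_Times_iff)
  \<comment> \<open>Used twice: with \<open>a n\<close> dropped it shows that \<open>w\<close>
    reaches at least \<open>S\<close>; once \<open>w\<close> is known to be interior, the value
    there is at most \<open>S\<close>, and the same estimate forces \<open>a n\<close> to 0.\<close>
  have close: "\<forall>\<^sub>F n in sequentially. S + a n < u w - v w + \<tau>" if "0 < \<tau>" for \<tau>
  proof -
    have "\<forall>\<^sub>F n in sequentially. u (x n) < u w + \<tau> / 2"
      by (rule usc_on_sequentially[OF u_usc xy(1) w(2,1)]) (use that in simp)
    moreover have "\<forall>\<^sub>F n in sequentially. - v (y n) < - v w + \<tau> / 2"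
      by (rule usc_on_sequentially[OF lsc_on_uminus[OF v_lsc] xy(2) w(3,1)]) (use that in simp)
    ultimately show ?thesis
    proof eventually_elim
      case (elim n) then show ?case using S[of n] by simp
    qed
  qed
  have Sw: "S \<le> u w - v w"
  proof (rule field_le_epsilon)
    fix \<tau> :: real assume "0 < \<tau>"
    from eventually_happens[OF close[OF this]] obtain n where "S + a n < u w - v w + \<tau>" by auto
    then show "S \<le> u w - v w + \<tau>" using a0[of n] by linarith
  qed
  \<comment> \<open>On the boundary the difference is at most \<open>M < S\<close>.\<close>
  have w\<Omega>: "w \<in> \<Omega>"
  proof -
    have "w \<notin> frontier \<Omega>" using M(2)[of w] Sw SM by auto
    then show ?thesis using w(1) open_\<Omega> by (simp add: frontier_def interior_open)
  qed
  then have "u w - v w \<le> S" unfolding S_def by (intro cSUP_upper bdd_above_difference)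
  then have a_lim: "a \<longlonglongrightarrow> 0"
    using close a0 by (intro LIMSEQ_I) (fastforce simp: eventually_sequentially)
  \<comment> \<open>Convergence of \<open>x n - y n\<close> alone does not control its quotients by
    \<open>e n\<close>; everything is therefore expressed through \<open>a n\<close>, since the
    squared distance divided by \<open>e n\<close> is \<open>2 * a n\<close>.\<close>
  define b where "b n = norm (x n - y n) * (1 + norm (x n - y n) / e n)" for n
  have b_eq: "b n = norm (x n - y n) + 2 * a n" for n
    using e[of n] by (simp add: b_def a_def distrib_left power2_eq_square)
  have "(\<lambda>n. norm (x n - y n) + 2 * a n) \<longlonglongrightarrow> 0 + 2 * 0" by (intro tendsto_intros n0 a_lim)
  then have b0: "b \<longlonglongrightarrow> 0" by (simp add: b_eq[abs_def])
  have bn: "0 \<le> b n" for n using a0[of n] by (simp add: b_eq)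
  define \<delta> where "\<delta> n = 3 / e n * (L * norm (x n - y n))\<^sup>2 + \<bar>C1\<bar> * b n" for n
  have \<delta>_eq: "\<delta> n = 6 * L\<^sup>2 * a n + \<bar>C1\<bar> * b n" for n
    using e[of n] by (simp add: \<delta>_def a_def power_mult_distrib)
  have "(\<lambda>n. 6 * L\<^sup>2 * a n + \<bar>C1\<bar> * b n) \<longlonglongrightarrow> 6 * L\<^sup>2 * 0 + \<bar>C1\<bar> * 0" by (intro tendsto_intros a_lim b0)
  then have \<delta>0: "\<delta> \<longlonglongrightarrow> 0" by (simp add: \<delta>_eq[abs_def])
  have "\<forall>\<^sub>F n in sequentially. x n \<in> \<Omega>" "\<forall>\<^sub>F n in sequentially. y n \<in> \<Omega>"
    using topological_tendstoD[OF w(2) open_\<Omega> w\<Omega>] topological_tendstoD[OF w(3) open_\<Omega> w\<Omega>] by auto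
  moreover have "\<forall>\<^sub>F n in sequentially. \<delta> n < \<gamma>" using \<delta>0 \<gamma> by (rule order_tendstoD)
  ultimately have "\<forall>\<^sub>F n in sequentially. \<gamma>1 \<le> real CARD('m) * ln (\<gamma> / (\<gamma> - \<delta> n)) + \<omega> (b n)"
  proof eventually_elim
    case (elim n)
    \<comment> \<open>The order of the values needed for the monotonicity of \<open>K\<close> comes
      from \<open>S > M \<ge> 0\<close>; here the positive part on the boundary matters.\<close>
    have "v (y n) \<le> u (x n)" using S[of n] a0[of n] SM M(1) by linarith
    from strict_subsolution_gap[OF e elim(1,2) this max \<delta>_def[of n, unfolded b_def] elim(3)]
    show ?case by (simp add: b_def)
  qed
  moreover have "(\<lambda>n. real CARD('m) * ln (\<gamma> / (\<gamma> - \<delta> n)) + \<omega> (b n)) \<longlonglongrightarrow> real CARD('m) * ln (\<gamma> / (\<gamma> - 0)) + 0"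
    using \<gamma> by (intro tendsto_intros \<delta>0 modulus_tendsto_0[OF \<omega> b0 bn]) auto
  \<comment> \<open>The logarithm tends to \<open>ln 1\<close>, which leaves
    \<open>\<gamma>1 \<le> 0\<close>.\<close>
  ultimately have "\<gamma>1 \<le> real CARD('m) * ln (\<gamma> / (\<gamma> - 0)) + 0"
    by (intro tendsto_lowerbound) auto
  then show False using \<gamma> \<gamma>1 by simp
qed

lemma comparison_principle:
  "\<exists>M. is_max_of (\<lambda>x. max (u x - v x) 0) (frontier \<Omega>) M \<and> (SUP x\<in>\<Omega>. u x - v x) \<le> M"
proof -
  \<comment> \<open>A bounded set is not the whole space, and a nonempty proper subset of a
    connected space has boundary points.\<close>
  have "\<Omega> \<noteq> UNIV" using bounded_\<Omega> not_bounded_UNIV by auto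
  then have ne: "frontier \<Omega> \<noteq> {}" using nonempty_\<Omega> frontier_eq_empty by blast
  have "usc_on (frontier \<Omega>) (\<lambda>x. u x - v x)"
    by (rule usc_on_subset[OF usc_diagonal]) (auto simp: frontier_def)
  then obtain z where z: "z \<in> frontier \<Omega>" "\<And>x. x \<in> frontier \<Omega> \<Longrightarrow> u x - v x \<le> u z - v z"
    using usc_on_attains_max[OF compact_frontier_bounded[OF bounded_\<Omega>] ne] by blast
  define M where "M = max (u z - v z) 0"
  have "is_max_of (\<lambda>x. max (u x - v x) 0) (frontier \<Omega>) M"
    unfolding is_max_of_def
  proof (intro conjI bexI ballI)
    show "max (u z - v z) 0 = M" by (simp add: M_def)
    fix x assume "x \<in> frontier \<Omega>"
    then show "max (u x - v x) 0 \<le> M" using z(2)[of x] by (auto simp: M_def)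
  qed (rule z(1))
  moreover have "(SUP x\<in>\<Omega>. u x - v x) \<le> M"
    by (rule sup_difference_le) (use z(2) in \<open>auto simp: M_def le_max_iff_disj\<close>)
  ultimately show ?thesis by blast
qed

end

theorem theorem2p1:
  fixes \<Omega> :: "(real ^ 'n) set"
    and K :: "real ^ 'n \<Rightarrow> real \<Rightarrow> real ^ 'n \<Rightarrow> real ^ 'n ^ 'n \<Rightarrow> real"
    and \<omega> :: "real \<Rightarrow> real"
    and \<sigma> :: "real ^ 'n \<Rightarrow> real ^ 'm ^ 'n"
    and A :: "real ^ 'n \<Rightarrow> real ^ 'n \<Rightarrow> real ^ 'm ^ 'm"
    and C1 \<gamma> \<gamma>1 :: real
    and u v :: "real ^ 'n \<Rightarrow> real"
  assumes "bounded \<Omega>" and "open \<Omega>" and "\<Omega> \<noteq> {}"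
    and "CARD('m) \<le> CARD('n)"
    and K_cont: "continuous_on (closure \<Omega> \<times> UNIV \<times> UNIV \<times> sym_mats) (\<lambda>(x, r, p, X). K x r p X)"
    and K_mono: "\<And>x r s p X Y. \<lbrakk>x \<in> closure \<Omega>; r \<le> s; X \<in> sym_mats; Y \<in> sym_mats; Y \<preceq> X\<rbrakk>
                   \<Longrightarrow> K x r p X \<le> K x s p Y"
    and \<omega>: "modulus \<omega>"
    and K_struct: "\<And>\<epsilon> x y r X Y.
          \<lbrakk>\<epsilon> > 0; x \<in> closure \<Omega>; y \<in> closure \<Omega>; X \<in> sym_mats; Y \<in> sym_mats;
           (- (3 / \<epsilon>)) *\<^sub>R block_mat (mat 1) 0 0 (mat 1) \<preceq> block_mat X 0 0 (- Y);
           block_mat X 0 0 (- Y) \<preceq> (3 / \<epsilon>) *\<^sub>R block_mat (mat 1) (- mat 1) (- mat 1) (mat 1)\<rbrakk>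
          \<Longrightarrow> K y r ((1 / \<epsilon>) *\<^sub>R (x - y)) Y - K x r ((1 / \<epsilon>) *\<^sub>R (x - y)) X
                \<le> \<omega> (norm (x - y) * (1 + norm (x - y) / \<epsilon>))"
    and \<sigma>_lipschitz: "\<exists>L. L-lipschitz_on (closure \<Omega>) \<sigma>"
    and A_sym: "\<And>x p. x \<in> closure \<Omega> \<Longrightarrow> A x p \<in> sym_mats"
    and A_cont: "continuous_on (closure \<Omega> \<times> UNIV) (\<lambda>(x, p). A x p)"
    and A_lipschitz: "\<And>x y p. \<lbrakk>x \<in> closure \<Omega>; y \<in> closure \<Omega>\<rbrakk> \<Longrightarrow>
          (- (C1 * norm (x - y) * (1 + norm p))) *\<^sub>R mat 1 \<preceq> A x p - A y p \<and>
          A x p - A y p \<preceq> (C1 * norm (x - y) * (1 + norm p)) *\<^sub>R mat 1"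
    and u: "usc_on (closure \<Omega>) u" "bounded (u ` closure \<Omega>)"
    and "\<gamma> > 0" and "\<gamma>1 > 0"
    and u_matrix: "visc_subsol_matrix \<Omega>
          (\<lambda>x p X. - (transpose (\<sigma> x) ** X ** \<sigma> x) - A x p) (- (\<gamma> *\<^sub>R mat 1)) u"
    and u_logdet: "visc_subsol_logdet \<Omega> \<sigma> A K (- \<gamma>1) u"
    and v: "lsc_on (closure \<Omega>) v" "bounded (v ` closure \<Omega>)"
    and v_logdet: "visc_supersol_logdet \<Omega> \<sigma> A K v"
  shows "\<exists>M. is_max_of (\<lambda>x. max (u x - v x) 0) (frontier \<Omega>) M \<and> (SUP x\<in>\<Omega>. u x - v x) \<le> M"
proof -
  obtain L where "L-lipschitz_on (closure \<Omega>) \<sigma>" using \<sigma>_lipschitz by blast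
  then interpret comparison \<Omega> K \<omega> \<sigma> A C1 \<gamma> \<gamma>1 L u v
    using assms by unfold_locales blast+
  show ?thesis by (rule comparison_principle)
qed

end
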